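(* Let $q>2$ and $2<p<3$ satisfy $(p-1)(pq-1)>p+2$, and fix $\mu$ satisfying the conditions stated in the context. Let $f,\tilde f\in C_0^2(\mathbb{R})$ and $g,\tilde g\in C_0^1(\mathbb{R})$ be even functions. Then there exist $\varepsilon_2>0$ and $C_2>0$ such that, for every $0<\varepsilon<\varepsilon_2$, the system of integral equations $$u=\varepsilon U_0+L|v|^q,\qquad v=\varepsilon V_0+L|\partial_tu|^p$$ has a unique global solution $(u,v)$ on $[0,\infty)\times\mathbb{R}$ satisfying all of the following: - $\|(\partial_tu,v)\|\le C_2\varepsilon$; - $u(t,-r)=u(t,r)$ and $v(t,-r)=v(t,r)$; - $u,v,\partial_tu\in C([0,\infty)\times\mathbb{R})$; - $ru,\,rv\in C^2([0,\infty)\times\mathbb{R})$.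
   Context: For even functions, define $$U_0(t,r)=\frac1{2r}\{(r+t)f(r+t)+(r-t)f(r-t)\}+\frac1{2r}\int_{r-t}^{r+t}\rho g(\rho)\,d\rho,$$ and define $V_0$ in the same way with $f,g$ replaced by $\tilde f,\tilde g$. For a function $F(s,\rho)$ even in $\rho$, define $$LF(t,r)=\frac1{2r}\int_0^t\int_{r-(t-s)}^{r+(t-s)}\rho F(s,\rho)\,d\rho\, ds.$$ (This is the radial Duhamel formula for the 3D wave equation.) Let $\langle\xi\rangle=\sqrt{1+\xi^2}$, and define weights for $t,r\ge0$: $$w_1(t,r)=\langle r\rangle\langle t-r\rangle^{\mu/p},$$ $$w_2(t,r)=\begin{cases}\langle r\rangle^{p-2}\langle t+r\rangle^{\mu} & (r<t/2),\\ \langle t-r\rangle^{p-3+\mu}\langle t+r\rangle & (r\ge t/2),\end{cases}$$ $$w_3(t,r)=\langle t-r\rangle^{\mu}.$$ Here $\mu$ is a fixed number with $$3-p<\mu<1\qquad\text{and}\qquad p\{2-(p-2)q\}<(pq-1)\mu$$ (such $\mu$ exists under the assumptions). Set $$\|(w,v)\|=\|w_1w\|_{L^\infty_{t,r}}+\|w_2v\|_{L^\infty_{t,r}}+\|w_3\,r\partial_rv\|_{L^\infty_{t,r}},$$ where $L^\infty_{t,r}=L^\infty([0,\infty)\times[0,\infty))$. *)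

theory Defs
  imports "HOL-Analysis.Analysis"
begin

definition jb :: "real \<Rightarrow> real" where
  "jb \<xi> = sqrt (1 + \<xi>\<^sup>2)"

definition C02 :: "(real \<Rightarrow> real) \<Rightarrow> bool" where
  "C02 f \<longleftrightarrow> (\<exists>f' f''. (\<forall>x. (f has_real_derivative f' x) (at x)) \<and>
      (\<forall>x. (f' has_real_derivative f'' x) (at x)) \<and> continuous_on UNIV f'')
     \<and> bounded {x. f x \<noteq> 0}"

definition C01 :: "(real \<Rightarrow> real) \<Rightarrow> bool" where
  "C01 f \<longleftrightarrow> (\<exists>f'. (\<forall>x. (f has_real_derivative f' x) (at x)) \<and> continuous_on UNIV f')
     \<and> bounded {x. f x \<noteq> 0}"

definition even_fun :: "(real \<Rightarrow> real) \<Rightarrow> bool" where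
  "even_fun f \<longleftrightarrow> (\<forall>x. f (- x) = f x)"

definition C2_on :: "(real \<times> real) set \<Rightarrow> (real \<times> real \<Rightarrow> real) \<Rightarrow> bool" where
  "C2_on S h \<longleftrightarrow> (\<exists>(h' :: real \<times> real \<Rightarrow> ((real \<times> real) \<Rightarrow>\<^sub>L real))
       (h'' :: real \<times> real \<Rightarrow> ((real \<times> real) \<Rightarrow>\<^sub>L ((real \<times> real) \<Rightarrow>\<^sub>L real))).
     (\<forall>x\<in>S. (h has_derivative blinfun_apply (h' x)) (at x within S)) \<and>
     (\<forall>x\<in>S. (h' has_derivative blinfun_apply (h'' x)) (at x within S)) \<and>
     continuous_on S h'')"

text \<open>Free solution U_0 (for r \<noteq> 0).\<close>
definition U0 :: "(real \<Rightarrow> real) \<Rightarrow> (real \<Rightarrow> real) \<Rightarrow> real \<Rightarrow> real \<Rightarrow> real" where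
  "U0 f g t r = 1 / (2 * r) * ((r + t) * f (r + t) + (r - t) * f (r - t))
      + 1 / (2 * r) * integral {r - t..r + t} (\<lambda>\<rho>. \<rho> * g \<rho>)"

text \<open>Radial Duhamel operator L (for r \<noteq> 0).\<close>
definition Lop :: "(real \<Rightarrow> real \<Rightarrow> real) \<Rightarrow> real \<Rightarrow> real \<Rightarrow> real" where
  "Lop F t r = 1 / (2 * r) *
     integral {0..t} (\<lambda>s. integral {r - (t - s)..r + (t - s)} (\<lambda>\<rho>. \<rho> * F s \<rho>))"

definition dt :: "(real \<Rightarrow> real \<Rightarrow> real) \<Rightarrow> real \<Rightarrow> real \<Rightarrow> real" where
  "dt u t r = vector_derivative (\<lambda>s. u s r) (at t within {0..})"

definition w1 :: "real \<Rightarrow> real \<Rightarrow> real \<Rightarrow> real \<Rightarrow> real" where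
  "w1 p \<mu> t r = jb r * jb (t - r) powr (\<mu> / p)"

definition w2 :: "real \<Rightarrow> real \<Rightarrow> real \<Rightarrow> real \<Rightarrow> real" where
  "w2 p \<mu> t r = (if r < t / 2 then jb r powr (p - 2) * jb (t + r) powr \<mu>
                  else jb (t - r) powr (p - 3 + \<mu>) * jb (t + r))"

definition w3 :: "real \<Rightarrow> real \<Rightarrow> real \<Rightarrow> real" where
  "w3 \<mu> t r = jb (t - r) powr \<mu>"

text \<open>The norm ||(w,v)||, as an extended real (L^\<infinity> over [0,\<infinity>)\<times>[0,\<infinity>);
  for the continuous functions considered the essential sup equals the sup).\<close>
definition wnorm :: "real \<Rightarrow> real \<Rightarrow> (real \<Rightarrow> real \<Rightarrow> real) \<Rightarrow> (real \<Rightarrow> real \<Rightarrow> real) \<Rightarrow> ereal" where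
  "wnorm p \<mu> w v =
     (SUP z\<in>{0..}\<times>{0..}. ereal \<bar>w1 p \<mu> (fst z) (snd z) * w (fst z) (snd z)\<bar>)
   + (SUP z\<in>{0..}\<times>{0..}. ereal \<bar>w2 p \<mu> (fst z) (snd z) * v (fst z) (snd z)\<bar>)
   + (SUP z\<in>{0..}\<times>{0..}. ereal \<bar>w3 \<mu> (fst z) (snd z) *
         (snd z * deriv (\<lambda>\<rho>. v (fst z) \<rho>) (snd z))\<bar>)"

text \<open>All requirements on a global solution (u,v) on [0,\<infinity>) \<times> R of
  u = \<epsilon> U_0 + L|v|^q, v = \<epsilon> V_0 + L|\<partial>_t u|^p with the bound constant C.
  The integral equations are required for r \<noteq> 0 (where the formulas make sense);
  at r = 0 the values are determined by continuity.\<close>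
definition global_solution ::
  "real \<Rightarrow> real \<Rightarrow> real \<Rightarrow> real \<Rightarrow> real \<Rightarrow> (real \<Rightarrow> real) \<Rightarrow> (real \<Rightarrow> real) \<Rightarrow>
   (real \<Rightarrow> real) \<Rightarrow> (real \<Rightarrow> real) \<Rightarrow>
   (real \<Rightarrow> real \<Rightarrow> real) \<Rightarrow> (real \<Rightarrow> real \<Rightarrow> real) \<Rightarrow> bool" where
  "global_solution p q \<mu> C \<epsilon> f g ft gt u v \<longleftrightarrow>
     (\<forall>t\<ge>0. \<forall>r. r \<noteq> 0 \<longrightarrow>
        u t r = \<epsilon> * U0 f g t r + Lop (\<lambda>s \<rho>. \<bar>v s \<rho>\<bar> powr q) t r \<and>
        v t r = \<epsilon> * U0 ft gt t r + Lop (\<lambda>s \<rho>. \<bar>dt u s \<rho>\<bar> powr p) t r)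
   \<and> (\<forall>t\<ge>0. \<forall>r. (\<lambda>s. u s r) differentiable (at t within {0..}))
   \<and> wnorm p \<mu> (dt u) v \<le> ereal (C * \<epsilon>)
   \<and> (\<forall>t\<ge>0. \<forall>r. u t (- r) = u t r \<and> v t (- r) = v t r)
   \<and> continuous_on ({0..} \<times> UNIV) (\<lambda>z. u (fst z) (snd z))
   \<and> continuous_on ({0..} \<times> UNIV) (\<lambda>z. v (fst z) (snd z))
   \<and> continuous_on ({0..} \<times> UNIV) (\<lambda>z. dt u (fst z) (snd z))
   \<and> C2_on ({0..} \<times> UNIV) (\<lambda>z. snd z * u (fst z) (snd z))
   \<and> C2_on ({0..} \<times> UNIV) (\<lambda>z. snd z * v (fst z) (snd z))"

end

theory Submission
  imports Defs
begin

text \<open>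
  The unknown is \<open>w = \<partial>\<^sub>t u\<close>. Given \<open>w\<close>, the second equation defines \<open>v\<close>, and the
  \<open>t\<close>-derivative of the first one returns a new \<open>w\<close>; the solution is the fixed point of this map in
  the weighted sup norm. Since \<open>r L F\<close> is half the integral of \<open>G = \<rho> F\<close> over the backward
  characteristic triangle, its derivatives are the integrals \<open>P\<^sub>\<plusminus>\<close> of \<open>G\<close> along
  characteristics. Each majorant of \<open>G\<close> that occurs is pointwise at most a decaying weight of the
  characteristic variable times an integrable power of \<open>\<langle>\<rho>\<rangle>\<close> or
  \<open>\<langle>s - \<rho>\<rangle>\<close>; for \<open>|v|\<^sup>q\<close> this integrability is exactly the condition
  \<open>p (2 - (p - 2) q) < (p q - 1) \<mu>\<close>. Near \<open>r = 0\<close> the bound for \<open>w\<close> comes from the mean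
  value theorem and uses \<open>r \<partial>\<^sub>r v\<close>, which is why this quantity is part of the norm; the
  difference of two such terms is controlled because \<open>q > 2\<close>.
\<close>

section \<open>Calculus on the closed half plane\<close>

text \<open>Two facts make \<open>w\<close> the right unknown. Its weight is continuous, whereas the
  weight of \<open>v\<close> jumps across \<open>r = t / 2\<close>; so after multiplication by its
  weight the ball for \<open>w\<close> sits inside the bounded continuous functions. And a merely
  continuous, even \<open>w\<close> is enough to start from: the resulting \<open>r v\<close> has
  continuous first derivatives, hence the source of \<open>u\<close> is differentiable in
  \<open>r\<close>, and this is what the value of the new \<open>w\<close> on the axis requires.
  Second derivatives of \<open>r v\<close> are obtained only at the fixed point, where
  \<open>w\<close> is itself an output and \<open>r w\<close> is differentiable in \<open>r\<close>.

  The axis is the persistent obstacle. The integral formulas divide by \<open>r\<close>, so the work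
  is done on the numerators \<open>r u\<close> and \<open>r v\<close>, which are odd and
  differentiable across \<open>r = 0\<close>; the quotients are then given the derivative of the
  numerator as value on the axis.

  Uniqueness is claimed among solutions obeying the same norm bound: their time derivative lies in
  the same ball and is a fixed point there.\<close>

type_synonym field2 = "real \<Rightarrow> real \<Rightarrow> real"

definition cont2 :: "field2 \<Rightarrow> bool" where
  "cont2 F \<longleftrightarrow> continuous_on ({0..} \<times> UNIV) (\<lambda>z. F (fst z) (snd z))"

lemma cont2_compose:
  assumes "cont2 F" "continuous_on X a" "continuous_on X b" "\<And>x. x \<in> X \<Longrightarrow> 0 \<le> a x"
  shows "continuous_on X (\<lambda>x. F (a x) (b x))"
proof -
  have "continuous_on X (\<lambda>x. (\<lambda>z. F (fst z) (snd z)) (a x, b x))"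
    by (rule continuous_on_compose2[OF assms(1)[unfolded cont2_def]])
       (use assms in \<open>auto intro!: continuous_intros\<close>)
  then show ?thesis by simp
qed

lemma cont2_add: "cont2 F \<Longrightarrow> cont2 G \<Longrightarrow> cont2 (\<lambda>t r. F t r + G t r)"
  unfolding cont2_def by (intro continuous_intros)

lemma cont2_diff: "cont2 F \<Longrightarrow> cont2 G \<Longrightarrow> cont2 (\<lambda>t r. F t r - G t r)"
  unfolding cont2_def by (intro continuous_intros)

lemma cont2_mult: "cont2 F \<Longrightarrow> cont2 G \<Longrightarrow> cont2 (\<lambda>t r. F t r * G t r)"
  unfolding cont2_def by (intro continuous_intros)

lemma cont2_const: "cont2 (\<lambda>t r. c)"
  unfolding cont2_def by (intro continuous_intros)

lemma cont2_snd: "cont2 (\<lambda>t r. r)"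
  unfolding cont2_def by (intro continuous_intros)

lemma cont2_cong:
  assumes "cont2 F" "\<And>t r. 0 \<le> t \<Longrightarrow> G t r = F t r"
  shows "cont2 G"
  using assms unfolding cont2_def by (auto cong: continuous_on_cong_simp intro: continuous_on_eq)

lemma cont2_slice: "cont2 F \<Longrightarrow> 0 \<le> t \<Longrightarrow> continuous_on X (F t)"
  using cont2_compose[of F X "\<lambda>_. t" "\<lambda>x. x"] by simp

text \<open>The partials are arguments rather than existentially bound, so that second-order
  regularity is \<open>C1\<close> applied to them. At \<open>t = 0\<close> the derivative is
  relative to the closed half plane.\<close>

definition C1 :: "field2 \<Rightarrow> field2 \<Rightarrow> field2 \<Rightarrow> bool" where
  "C1 h ht hr \<longleftrightarrow> (\<forall>t\<ge>0. \<forall>r. ((\<lambda>z. h (fst z) (snd z)) has_derivative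
        (\<lambda>d. ht t r * fst d + hr t r * snd d)) (at (t, r) within {0..} \<times> UNIV)) \<and>
     cont2 ht \<and> cont2 hr"

lemma C1_add:
  assumes "C1 f ft fr" "C1 g gt gr"
  shows "C1 (\<lambda>t r. f t r + g t r) (\<lambda>t r. ft t r + gt t r) (\<lambda>t r. fr t r + gr t r)"
  unfolding C1_def
proof (intro conjI allI impI)
  fix t r :: real assume t: "0 \<le> t"
  have "((\<lambda>z. f (fst z) (snd z) + g (fst z) (snd z)) has_derivative
     (\<lambda>d. (ft t r * fst d + fr t r * snd d) + (gt t r * fst d + gr t r * snd d)))
     (at (t, r) within {0..} \<times> UNIV)"
    using assms t unfolding C1_def by (intro has_derivative_add) auto
  then show "((\<lambda>z. f (fst z) (snd z) + g (fst z) (snd z)) has_derivative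
     (\<lambda>d. (ft t r + gt t r) * fst d + (fr t r + gr t r) * snd d))
     (at (t, r) within {0..} \<times> UNIV)"
    by (simp add: algebra_simps)
qed (use assms in \<open>auto simp: C1_def intro: cont2_add\<close>)

lemma C1_cmult:
  assumes "C1 f ft fr"
  shows "C1 (\<lambda>t r. c * f t r) (\<lambda>t r. c * ft t r) (\<lambda>t r. c * fr t r)"
  unfolding C1_def
proof (intro conjI allI impI)
  fix t r :: real assume t: "0 \<le> t"
  have "((\<lambda>z. c * f (fst z) (snd z)) has_derivative
     (\<lambda>d. c * (ft t r * fst d + fr t r * snd d))) (at (t, r) within {0..} \<times> UNIV)"
    using assms t unfolding C1_def by (intro has_derivative_mult_right) auto
  then show "((\<lambda>z. c * f (fst z) (snd z)) has_derivative
     (\<lambda>d. c * ft t r * fst d + c * fr t r * snd d)) (at (t, r) within {0..} \<times> UNIV)"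
    by (simp add: algebra_simps)
qed (use assms in \<open>auto simp: C1_def intro!: cont2_mult cont2_const\<close>)

lemma C1_diff:
  assumes "C1 f ft fr" "C1 g gt gr"
  shows "C1 (\<lambda>t r. f t r - g t r) (\<lambda>t r. ft t r - gt t r) (\<lambda>t r. fr t r - gr t r)"
  using C1_add[OF assms(1) C1_cmult[OF assms(2), of "-1"]] by simp

lemma C1_cong:
  assumes "C1 h ht hr"
    and "\<And>t r. 0 \<le> t \<Longrightarrow> h1 t r = h t r" "\<And>t r. 0 \<le> t \<Longrightarrow> ht1 t r = ht t r" "\<And>t r. 0 \<le> t \<Longrightarrow> hr1 t r = hr t r"
  shows "C1 h1 ht1 hr1"
  unfolding C1_def
proof (intro conjI allI impI)
  fix t r :: real assume t: "0 \<le> t"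
  have "((\<lambda>z. h (fst z) (snd z)) has_derivative
     (\<lambda>d. ht t r * fst d + hr t r * snd d)) (at (t, r) within {0..} \<times> UNIV)"
    using assms t unfolding C1_def by auto
  then show "((\<lambda>z. h1 (fst z) (snd z)) has_derivative
     (\<lambda>d. ht1 t r * fst d + hr1 t r * snd d)) (at (t, r) within {0..} \<times> UNIV)"
    unfolding assms(3,4)[OF t]
    by (rule has_derivative_transform[rotated 2]) (use assms(2) t in auto)
qed (use assms in \<open>auto simp: C1_def intro: cont2_cong\<close>)

lemma C1_of_partials:
  assumes t: "\<And>t r. 0 \<le> t \<Longrightarrow> ((\<lambda>s. h s r) has_real_derivative ht t r) (at t within {0..})"
    and r: "\<And>t r. 0 \<le> t \<Longrightarrow> (h t has_real_derivative hr t r) (at r)"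
    and c: "cont2 ht" "cont2 hr"
  shows "C1 h ht hr"
  unfolding C1_def
proof (intro conjI allI impI c)
  fix t r :: real assume t0: "0 \<le> t"
  \<comment> \<open>The criterion for total differentiability wants the second partial as a map into
    bounded linear maps.\<close>
  have c': "continuous_on ({0..} \<times> UNIV) (\<lambda>z. blinfun_mult_right (hr (fst z) (snd z)))"
    using c(2) unfolding cont2_def by (intro continuous_intros bounded_linear.continuous_on[OF bounded_linear_blinfun_mult_right])
  have "((\<lambda>(x, y). h x y) has_derivative (\<lambda>(tx, ty). ht t r * tx + blinfun_mult_right (hr t r) ty))
     (at (t, r) within {0..} \<times> UNIV)"
  proof (rule has_derivative_partialsI[where fy="\<lambda>x y. blinfun_mult_right (hr x y)"])
    show "((\<lambda>x. h x r) has_derivative (*) (ht t r)) (at t within {0..})"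
      using t[OF t0] by (simp add: has_field_derivative_def)
    show "continuous (at (t, r) within {0..} \<times> UNIV) (\<lambda>(x, y). blinfun_mult_right (hr x y))"
      using c' t0 by (simp add: continuous_on_eq_continuous_within split_beta')
  qed (use r in \<open>auto simp: has_field_derivative_def\<close>)
  then show "((\<lambda>z. h (fst z) (snd z)) has_derivative
        (\<lambda>d. ht t r * fst d + hr t r * snd d)) (at (t, r) within {0..} \<times> UNIV)"
    by (simp add: split_beta')
qed

lemma C1_chain:
  assumes "C1 h ht hr" "(\<gamma> has_derivative \<gamma>') (at x within X)" "x \<in> X" "\<And>y. y \<in> X \<Longrightarrow> 0 \<le> fst (\<gamma> y)"
  shows "((\<lambda>y. h (fst (\<gamma> y)) (snd (\<gamma> y))) has_derivative
    (\<lambda>d. ht (fst (\<gamma> x)) (snd (\<gamma> x)) * fst (\<gamma>' d) + hr (fst (\<gamma> x)) (snd (\<gamma> x)) * snd (\<gamma>' d))) (at x within X)"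
proof (rule has_derivative_in_compose2[OF _ _ assms(3,2), where t="{0..} \<times> UNIV" and g="\<lambda>z. h (fst z) (snd z)"
    and g'="\<lambda>z d. ht (fst z) (snd z) * fst d + hr (fst z) (snd z) * snd d"])
  show "\<gamma> ` X \<subseteq> {0..} \<times> UNIV" unfolding image_subset_iff mem_Times_iff using assms(4) by simp
qed (use assms(1) in \<open>auto simp: C1_def\<close>)

text \<open>With \<open>c = 1\<close> or \<open>c = -1\<close> the shear straightens one family of
  characteristics: an integral along them becomes an integral in \<open>s\<close> at fixed
  \<open>x\<close>, evaluated at \<open>x = r + c * t\<close>.\<close>

lemma C1_shear:
  assumes "C1 h ht hr"
  shows "C1 (\<lambda>t r. h t (r + c * t)) (\<lambda>t r. ht t (r + c * t) + c * hr t (r + c * t)) (\<lambda>t r. hr t (r + c * t))"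
  unfolding C1_def
proof (intro conjI allI impI)
  fix t r :: real assume t: "0 \<le> t"
  let ?S = "{0..} \<times> UNIV :: (real \<times> real) set"
  let ?g = "\<lambda>z::real\<times>real. (fst z, snd z + c * fst z)"
  have g: "(?g has_derivative ?g) (at (t, r) within ?S)"
    by (auto intro!: derivative_eq_intros)
  have "((\<lambda>z. h (fst (?g z)) (snd (?g z))) has_derivative
        (\<lambda>d. ht t (r + c * t) * fst (?g d) + hr t (r + c * t) * snd (?g d))) (at (t, r) within ?S)"
    using C1_chain[OF assms g] t by (simp add: mem_Times_iff)
  then show "((\<lambda>z. h (fst z) (snd z + c * fst z)) has_derivative
        (\<lambda>d. (ht t (r + c * t) + c * hr t (r + c * t)) * fst d + hr t (r + c * t) * snd d)) (at (t, r) within ?S)"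
    by (simp add: algebra_simps)
next
  have 1: "cont2 ht" "cont2 hr" using assms by (auto simp: C1_def)
  have "cont2 (\<lambda>t r. F t (r + c * t))" if "cont2 F" for F
    unfolding cont2_def by (rule cont2_compose[OF that]) (auto intro!: continuous_intros)
  from this[OF 1(1)] this[OF 1(2)]
  show "cont2 (\<lambda>t r. ht t (r + c * t) + c * hr t (r + c * t))" "cont2 (\<lambda>t r. hr t (r + c * t))"
    by (auto intro!: cont2_add cont2_mult cont2_const)
qed

lemma C1_deriv_t:
  assumes "C1 h ht hr" "0 \<le> t"
  shows "((\<lambda>s. h s r) has_real_derivative ht t r) (at t within {0..})"
proof -
  have "((\<lambda>s. (s, r)) has_derivative (\<lambda>d. (d, 0))) (at t within {0..})"
    by (auto intro!: derivative_eq_intros)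
  from C1_chain[OF assms(1) this] assms(2) show ?thesis by (simp add: has_field_derivative_def)
qed

lemma C1_deriv_r:
  assumes "C1 h ht hr" "0 \<le> t"
  shows "(h t has_real_derivative hr t r) (at r)"
proof -
  have "((\<lambda>s. (t, s)) has_derivative (\<lambda>d. (0, d))) (at r)"
    by (auto intro!: derivative_eq_intros)
  from C1_chain[OF assms(1) this] assms(2) show ?thesis by (simp add: has_field_derivative_def)
qed

lemma C2_on_of_C1:
  assumes "C1 h ht hr" "C1 ht htt htr" "C1 hr hrt hrr"
  shows "C2_on ({0..} \<times> UNIV) (\<lambda>z. h (fst z) (snd z))"
proof -
  let ?S = "{0..} \<times> UNIV :: (real \<times> real) set"
  define e1 e2 :: "(real \<times> real) \<Rightarrow>\<^sub>L real" where "e1 = Blinfun fst" and "e2 = Blinfun snd"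
  have e: "blinfun_apply e1 = fst" "blinfun_apply e2 = snd"
    unfolding e1_def e2_def by (auto intro!: bounded_linear_Blinfun_apply bounded_linear_fst bounded_linear_snd)
  \<comment> \<open>Basis for the second derivative, which is a map into the dual: index
    \<open>ij\<close> sends \<open>d\<close> to its \<open>j\<close>-th coordinate times
    \<open>ei\<close>, so \<open>E12\<close> carries the \<open>r\<close>-derivative of the
    \<open>t\<close>-partial.\<close>
  define E11 E12 E21 E22 :: "(real \<times> real) \<Rightarrow>\<^sub>L (real \<times> real) \<Rightarrow>\<^sub>L real"
    where "E11 = Blinfun (\<lambda>d. fst d *\<^sub>R e1)" and "E12 = Blinfun (\<lambda>d. snd d *\<^sub>R e1)"
      and "E21 = Blinfun (\<lambda>d. fst d *\<^sub>R e2)" and "E22 = Blinfun (\<lambda>d. snd d *\<^sub>R e2)"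
  have E: "blinfun_apply E11 = (\<lambda>d. fst d *\<^sub>R e1)" "blinfun_apply E12 = (\<lambda>d. snd d *\<^sub>R e1)"
    "blinfun_apply E21 = (\<lambda>d. fst d *\<^sub>R e2)" "blinfun_apply E22 = (\<lambda>d. snd d *\<^sub>R e2)"
    unfolding E11_def E12_def E21_def E22_def
    by (auto intro!: bounded_linear_Blinfun_apply bounded_linear_scaleR_const bounded_linear_fst bounded_linear_snd)
  define h' where "h' = (\<lambda>z. ht (fst z) (snd z) *\<^sub>R e1 + hr (fst z) (snd z) *\<^sub>R e2)"
  define h'' where "h'' = (\<lambda>z. htt (fst z) (snd z) *\<^sub>R E11 + htr (fst z) (snd z) *\<^sub>R E12
      + hrt (fst z) (snd z) *\<^sub>R E21 + hrr (fst z) (snd z) *\<^sub>R E22)"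
  have "((\<lambda>z. h (fst z) (snd z)) has_derivative blinfun_apply (h' x)) (at x within ?S)" if x: "x \<in> ?S" for x
  proof -
    obtain t r where tr: "x = (t, r)" "0 \<le> t" using x by (cases x) auto
    have "((\<lambda>z. h (fst z) (snd z)) has_derivative (\<lambda>d. ht t r * fst d + hr t r * snd d)) (at (t, r) within ?S)"
      using assms(1) tr(2) by (auto simp: C1_def)
    then show ?thesis
      unfolding tr by (rule has_derivative_eq_rhs)
        (auto simp: fun_eq_iff h'_def e blinfun.add_left blinfun.scaleR_left)
  qed
  moreover have "(h' has_derivative blinfun_apply (h'' x)) (at x within ?S)" if x: "x \<in> ?S" for x
  proof -
    obtain t r where tr: "x = (t, r)" "0 \<le> t" using x by (cases x) auto
    have "(h' has_derivative (\<lambda>d. (htt t r * fst d + htr t r * snd d) *\<^sub>R e1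
        + (hrt t r * fst d + hrr t r * snd d) *\<^sub>R e2)) (at (t, r) within ?S)"
      unfolding h'_def using assms(2,3) tr(2)
      by (intro has_derivative_add has_derivative_scaleR_left) (auto simp: C1_def)
    then show ?thesis
      unfolding tr by (rule has_derivative_eq_rhs)
        (auto simp: fun_eq_iff h''_def E blinfun.add_left blinfun.scaleR_left algebra_simps)
  qed
  moreover have "continuous_on ?S h''"
    using assms(2,3) unfolding C1_def h''_def cont2_def by (auto intro!: continuous_intros)
  ultimately show ?thesis unfolding C2_on_def by blast
qed

section \<open>Integrals along characteristics\<close>

lemma deriv_affine:
  assumes "(g has_real_derivative D) (at (a * x + b))"
  shows "((\<lambda>x. g (a * x + b)) has_real_derivative a * D) (at x within S)"
proof -
  have "((\<lambda>x. a * x + b) has_real_derivative a) (at x within S)"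
    by (auto intro!: derivative_eq_intros)
  from DERIV_chain2[OF assms this] show ?thesis by (simp add: mult.commute)
qed

text \<open>The antiderivative vanishing at 0, on the whole line: an integral over
  \<open>{a..b}\<close> with \<open>b < a\<close> is 0, so only one of the two terms is active for
  \<open>x \<noteq> 0\<close>.\<close>

definition prim :: "(real \<Rightarrow> real) \<Rightarrow> real \<Rightarrow> real" where
  "prim g x = integral {0..x} g - integral {x..0} g"

lemma prim_diff:
  assumes g: "continuous_on UNIV g" and ab: "a \<le> b"
  shows "integral {a..b} g = prim g b - prim g a"
proof -
  have i: "g integrable_on {x..y}" for x y
    by (intro integrable_continuous_real continuous_on_subset[OF g]) auto
  have c: "integral {x..y} g + integral {y..z} g = integral {x..z} g" if "x \<le> y" "y \<le> z" for x y z
    using Henstock_Kurzweil_Integration.integral_combine[of x y z g] i that by auto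
  have z: "integral {x..y} g = 0" if "y \<le> x" for x y
    using that by (cases "x = y") auto
  consider "0 \<le> a" | "a \<le> 0" "0 \<le> b" | "b \<le> 0" by linarith
  then show ?thesis
    using c[of 0 a b] c[of a 0 b] c[of a b 0] ab by cases (auto simp: prim_def z)
qed

lemma prim_deriv:
  assumes g: "continuous_on UNIV g"
  shows "(prim g has_real_derivative g x) (at x)"
proof -
  \<comment> \<open>Near \<open>x\<close> the primitive differs by a constant from the integral with
    lower limit \<open>x - 1\<close>, a point strictly to the left of \<open>x\<close>.\<close>
  have "((\<lambda>u. integral {x - 1..u} g) has_real_derivative g x) (at x within {x - 1..x + 1})"
    by (rule integral_has_real_derivative) (auto intro: continuous_on_subset[OF g])
  then have "((\<lambda>u. integral {x - 1..u} g) has_real_derivative g x) (at x)"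
    by (subst (asm) at_within_Icc_at) auto
  then have "((\<lambda>u. integral {x - 1..u} g + prim g (x - 1)) has_real_derivative g x) (at x)"
    by (auto intro!: derivative_eq_intros)
  then show ?thesis
  proof (rule DERIV_cong_ev[THEN iffD1, rotated 3])
    show "\<forall>\<^sub>F u in nhds x. integral {x - 1..u} g + prim g (x - 1) = prim g u"
      using eventually_nhds_in_open[of "{x - 1<..}" x]
      by (auto elim!: eventually_mono simp: prim_diff[OF g])
  qed auto
qed

lemma prim_0 [simp]: "prim g 0 = 0"
  by (simp add: prim_def)

lemma prim_even:
  assumes g: "continuous_on UNIV g" and odd: "\<And>x. g (- x) = - g x"
  shows "prim g (- x) = prim g x"
proof -
  have "((\<lambda>x. prim g (- x) - prim g x) has_real_derivative 0) (at x)" for x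
    using DERIV_diff[OF deriv_affine[where a="-1" and b=0 and x=x and S=UNIV, OF prim_deriv[OF g]] prim_deriv[OF g, of x]]
    by (simp add: odd)
  then show ?thesis
    using DERIV_isconst_all[of "\<lambda>x. prim g (- x) - prim g x" x 0] by simp
qed

text \<open>Moves the variable limit into the integrand, so that joint continuity of
  \<open>prim (G s) x\<close> follows from continuity of integrals over a fixed interval.\<close>

lemma prim_scaled:
  assumes g: "continuous_on UNIV g"
  shows "prim g x = integral {0..1} (\<lambda>\<theta>. x * g (\<theta> * x))"
proof -
  have "((\<lambda>\<theta>. x * g (\<theta> * x)) has_integral (prim g (1 * x) - prim g (0 * x))) {0..1}"
    by (rule fundamental_theorem_of_calculus)
       (use deriv_affine[where a=x and b=0, OF prim_deriv[OF g]] in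
         \<open>auto simp: has_real_derivative_iff_has_vector_derivative[symmetric] mult.commute\<close>)
  then show ?thesis by (simp add: integral_unique del: integral_mult_right)
qed

lemma cont2_param_integral:
  assumes "cont2 H"
  shows "cont2 (\<lambda>t x. integral {0..t} (\<lambda>s. H s x))"
proof -
  \<comment> \<open>The substitution \<open>s = t * \<theta>\<close> makes the interval of
    integration independent of the parameters.\<close>
  have eq: "integral {0..t} (\<lambda>s. H s x) = integral {0..1} (\<lambda>\<theta>. t * H (t * \<theta>) x)" if t: "0 \<le> t" for t x
  proof -
    have "((\<lambda>\<theta>. t *\<^sub>R H (t * \<theta>) x) has_integral (integral {t * 0..t * 1} (\<lambda>s. H s x))) {0..1}"
      by (rule has_integral_substitution[where c=0 and d=t and f="\<lambda>s. H s x"])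
         (use t in \<open>auto intro!: derivative_eq_intros cont2_compose[OF assms] continuous_intros mult_left_le\<close>)
    then show ?thesis by (simp add: integral_unique del: integral_mult_right)
  qed
  have "continuous_on ({0..} \<times> UNIV) (\<lambda>z. integral (cbox 0 1) (\<lambda>\<theta>. fst z * H (fst z * \<theta>) (snd z)))"
    by (rule integral_continuous_on_param)
       (auto simp: split_beta intro!: continuous_intros cont2_compose[OF assms])
  then show ?thesis
    unfolding cont2_def by (rule continuous_on_eq) (auto simp: eq)
qed

lemma C1_param_integral:
  assumes H: "cont2 H" "cont2 Hx" and d: "\<And>s x. 0 \<le> s \<Longrightarrow> (H s has_real_derivative Hx s x) (at x)"
  shows "C1 (\<lambda>t x. integral {0..t} (\<lambda>s. H s x)) H (\<lambda>t x. integral {0..t} (\<lambda>s. Hx s x))"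
proof (rule C1_of_partials)
  fix t x :: real assume t: "0 \<le> t"
  have "((\<lambda>t. integral {0..t} (\<lambda>s. H s x)) has_real_derivative H t x) (at t within {0..t+1})"
    by (rule integral_has_real_derivative) (use t in \<open>auto intro!: cont2_compose[OF H(1)] continuous_intros\<close>)
  then show "((\<lambda>t. integral {0..t} (\<lambda>s. H s x)) has_real_derivative H t x) (at t within {0..})"
    by (subst (asm) at_within_nhd[of t "{..<t+1}" "{0..t+1}" "{0..}"]) auto
  have "((\<lambda>x. integral (cbox 0 t) (\<lambda>s. H s x)) has_field_derivative
     integral (cbox 0 t) (\<lambda>s. Hx s x)) (at x within UNIV)"
    by (rule leibniz_rule_field_derivative)
       (use d in \<open>auto simp: split_beta intro!: cont2_compose[OF H(2)] continuous_intros integrable_continuous_real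
          cont2_compose[OF H(1)]\<close>)
  then show "((\<lambda>x. integral {0..t} (\<lambda>s. H s x)) has_real_derivative integral {0..t} (\<lambda>s. Hx s x)) (at x)"
    by simp
qed (use H cont2_param_integral in auto)

definition Pp :: "field2 \<Rightarrow> field2" where
  "Pp G t r = integral {0..t} (\<lambda>s. G s (r + t - s))"

definition Pm :: "field2 \<Rightarrow> field2" where
  "Pm G t r = integral {0..t} (\<lambda>s. G s (r - t + s))"

definition Dop :: "field2 \<Rightarrow> field2" where
  "Dop G t r = integral {0..t} (\<lambda>s. integral {r - (t - s)..r + (t - s)} (G s))"

lemma cont2_Pp:
  assumes "cont2 G"
  shows "cont2 (Pp G)"
proof -
  have "cont2 (\<lambda>s x. G s (x - s))"
    unfolding cont2_def by (auto intro!: cont2_compose[OF assms] continuous_intros)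
  from cont2_compose[OF cont2_param_integral[OF this], of "{0..} \<times> UNIV" fst "\<lambda>z. snd z + fst z"]
  show ?thesis unfolding cont2_def Pp_def by (auto simp: continuous_on_fst continuous_on_snd continuous_on_add)
qed

text \<open>In the coordinate \<open>x = r + t\<close> the integrand is \<open>G s (x - s)\<close>.
  The \<open>t\<close>-derivative collects the endpoint value \<open>G t r\<close> from the upper
  limit and \<open>Pp Gx\<close> from the shear.\<close>

lemma C1_Pp:
  assumes G: "cont2 G" "cont2 Gx" and d: "\<And>s x. 0 \<le> s \<Longrightarrow> (G s has_real_derivative Gx s x) (at x)"
  shows "C1 (Pp G) (\<lambda>t r. G t r + Pp Gx t r) (Pp Gx)"
proof -
  have c: "cont2 (\<lambda>s x. G s (x - s))" "cont2 (\<lambda>s x. Gx s (x - s))"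
    unfolding cont2_def by (auto intro!: cont2_compose[OF G(1)] cont2_compose[OF G(2)] continuous_intros)
  have "((\<lambda>x. G s (x - s)) has_real_derivative Gx s (x - s)) (at x)" if "0 \<le> s" for s x
    using deriv_affine[where a=1 and b="- s" and x=x and S=UNIV, OF d[OF that]] by simp
  from C1_shear[OF C1_param_integral[OF c this], of 1]
  show ?thesis by (simp add: Pp_def[abs_def])
qed

lemma C1_Pm:
  assumes G: "cont2 G" "cont2 Gx" and d: "\<And>s x. 0 \<le> s \<Longrightarrow> (G s has_real_derivative Gx s x) (at x)"
  shows "C1 (Pm G) (\<lambda>t r. G t r - Pm Gx t r) (Pm Gx)"
proof -
  have c: "cont2 (\<lambda>s x. G s (x + s))" "cont2 (\<lambda>s x. Gx s (x + s))"
    unfolding cont2_def by (auto intro!: cont2_compose[OF G(1)] cont2_compose[OF G(2)] continuous_intros)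
  have "((\<lambda>x. G s (x + s)) has_real_derivative Gx s (x + s)) (at x)" if "0 \<le> s" for s x
    using deriv_affine[where a=1 and b=s and x=x and S=UNIV, OF d[OF that]] by simp
  from C1_shear[OF C1_param_integral[OF c this], of "-1"]
  show ?thesis by (simp add: Pm_def[abs_def])
qed

lemma cont2_prim:
  assumes G: "cont2 G"
  shows "cont2 (\<lambda>s. prim (G s))"
proof -
  have "continuous_on ({0..} \<times> UNIV) (\<lambda>z. integral (cbox 0 1) (\<lambda>\<theta>. snd z * G (fst z) (\<theta> * snd z)))"
    by (rule integral_continuous_on_param)
       (auto simp: split_beta intro!: continuous_intros cont2_compose[OF G])
  then show ?thesis
    unfolding cont2_def by (rule continuous_on_eq) (auto simp: prim_scaled cont2_slice[OF G])
qed

lemma integrable_Pp: "cont2 G \<Longrightarrow> (\<lambda>s. G s (r + t - s)) integrable_on {0..t}"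
  by (auto intro!: integrable_continuous_real cont2_compose[of G] continuous_intros)

lemma integrable_Pm: "cont2 G \<Longrightarrow> (\<lambda>s. G s (r - t + s)) integrable_on {0..t}"
  by (auto intro!: integrable_continuous_real cont2_compose[of G] continuous_intros)

text \<open>The inner integral is a difference of primitives at the ends of an interval, and these
  ends run along the two characteristics through \<open>(t, r)\<close>. This reduces the triangle to
  line integrals, whose derivatives are known.\<close>

lemma Dop_eq:
  assumes G: "cont2 G"
  shows "Dop G t r = Pp (\<lambda>s. prim (G s)) t r - Pm (\<lambda>s. prim (G s)) t r"
proof -
  have "Dop G t r = integral {0..t} (\<lambda>s. prim (G s) (r + t - s) - prim (G s) (r - t + s))"
    unfolding Dop_def by (intro integral_cong) (auto simp: prim_diff cont2_slice[OF G] algebra_simps)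
  then show ?thesis
    using integrable_Pp[OF cont2_prim[OF G], of r t] integrable_Pm[OF cont2_prim[OF G], of r t]
    by (simp add: Pp_def Pm_def integral_diff)
qed

text \<open>Primitives are differentiable for merely continuous \<open>G\<close>, and their endpoint
  contributions to the \<open>t\<close>-derivative cancel in the difference.\<close>

lemma C1_Dop:
  assumes G: "cont2 G"
  shows "C1 (Dop G) (\<lambda>t r. Pp G t r + Pm G t r) (\<lambda>t r. Pp G t r - Pm G t r)"
proof -
  have d: "(prim (G s) has_real_derivative G s x) (at x)" if "0 \<le> s" for s x
    by (rule prim_deriv) (use G that cont2_slice in auto)
  show ?thesis
    by (rule C1_cong[OF C1_diff[OF C1_Pp[OF cont2_prim[OF G] G d] C1_Pm[OF cont2_prim[OF G] G d]]])
       (auto simp: Dop_eq[OF G])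
qed

text \<open>Reflection in the axis exchanges the two families of characteristics.\<close>

lemma Pp_minus:
  assumes odd: "\<And>s x. 0 \<le> s \<Longrightarrow> G s (- x) = - G s x"
  shows "Pp G t (- r) = - Pm G t r"
proof -
  have "Pp G t (- r) = integral {0..t} (\<lambda>s. - G s (r - t + s))"
    unfolding Pp_def
  proof (rule integral_cong)
    fix s assume "s \<in> {0..t}"
    then show "G s (- r + t - s) = - G s (r - t + s)" using odd[of s "r - t + s"] by (simp add: algebra_simps)
  qed
  then show ?thesis by (simp add: Pm_def integral_neg)
qed

lemma Pm_minus:
  assumes odd: "\<And>s x. 0 \<le> s \<Longrightarrow> G s (- x) = - G s x"
  shows "Pm G t (- r) = - Pp G t r"
  using Pp_minus[of G t "- r"] odd by simp

text \<open>The primitive of an odd source is even, so reflection swaps the two terms of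
  \<open>Dop_eq\<close>. In particular \<open>Dop G\<close> vanishes on the axis.\<close>

lemma Dop_minus:
  assumes G: "cont2 G" and odd: "\<And>s x. 0 \<le> s \<Longrightarrow> G s (- x) = - G s x"
  shows "Dop G t (- r) = - Dop G t r"
proof -
  have *: "Pp (\<lambda>s. prim (G s)) t (- r) = Pm (\<lambda>s. prim (G s)) t r" for r
    unfolding Pp_def Pm_def
  proof (rule integral_cong)
    fix s assume "s \<in> {0..t}"
    then show "prim (G s) (- r + t - s) = prim (G s) (r - t + s)"
      using prim_even[of "G s" "r - t + s"] odd[of s] cont2_slice[OF G, of s UNIV] by (simp add: algebra_simps)
  qed
  show ?thesis using *[of r] *[of "- r"] by (simp add: Dop_eq[OF G])
qed

section \<open>Division by the radius and values on the axis\<close>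

definition quo :: "field2 \<Rightarrow> field2 \<Rightarrow> field2" where
  "quo N Nr t r = (if r = 0 then Nr t 0 else N t r / r)"

lemma mult_quo: "N t 0 = 0 \<Longrightarrow> r * quo N Nr t r = N t r"
  by (simp add: quo_def)

text \<open>Hadamard's formula: \<open>N t r / r\<close> is the mean of \<open>Nr t\<close> over the
  segment from 0 to \<open>r\<close>. It includes the axis and yields continuity there.\<close>

lemma quo_eq_integral:
  assumes "cont2 Nr" "\<And>r. (N t has_real_derivative Nr t r) (at r)" "N t 0 = 0" "0 \<le> t"
  shows "quo N Nr t r = integral {0..1} (\<lambda>\<theta>. Nr t (\<theta> * r))"
proof -
  have "((\<lambda>\<theta>. r * Nr t (\<theta> * r)) has_integral (N t (1 * r) - N t (0 * r))) {0..1}"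
    by (rule fundamental_theorem_of_calculus)
       (use deriv_affine[where a=r and b=0, OF assms(2)] in
         \<open>auto simp: has_real_derivative_iff_has_vector_derivative[symmetric] mult.commute\<close>)
  then have "integral {0..1} (\<lambda>\<theta>. r * Nr t (\<theta> * r)) = N t r"
    using assms(3) by (simp add: integral_unique del: integral_mult_right)
  then show ?thesis by (auto simp: quo_def field_simps)
qed

lemma cont2_quo:
  assumes Nr: "cont2 Nr" and d: "\<And>t r. 0 \<le> t \<Longrightarrow> (N t has_real_derivative Nr t r) (at r)"
    and 0: "\<And>t. 0 \<le> t \<Longrightarrow> N t 0 = 0"
  shows "cont2 (quo N Nr)"
proof -
  have "continuous_on ({0..} \<times> UNIV) (\<lambda>z. integral (cbox 0 1) (\<lambda>\<theta>. Nr (fst z) (\<theta> * snd z)))"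
    by (rule integral_continuous_on_param)
       (auto simp: split_beta intro!: continuous_intros cont2_compose[OF Nr])
  then show ?thesis
    unfolding cont2_def by (rule continuous_on_eq) (auto simp: quo_eq_integral[OF Nr d 0])
qed

section \<open>Weighted integrals along characteristics\<close>

lemma jb_ge_1: "1 \<le> jb x" by (simp add: jb_def)

lemma jb_pos [simp]: "0 < jb x" using jb_ge_1[of x] by linarith

lemma jb_nonneg [simp]: "0 \<le> jb x" using jb_pos[of x] by linarith

lemma jb_nonzero [simp]: "jb x \<noteq> 0" using jb_pos[of x] by linarith

lemma jb_minus [simp]: "jb (- x) = jb x" by (simp add: jb_def)

lemma jb_abs [simp]: "jb \<bar>x\<bar> = jb x" by (simp add: jb_def)

lemma jb_0 [simp]: "jb 0 = 1" by (simp add: jb_def)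

lemma jb_mono: "\<bar>x\<bar> \<le> \<bar>y\<bar> \<Longrightarrow> jb x \<le> jb y"
  by (simp add: jb_def abs_le_square_iff)

lemma jb_le: "jb x \<le> 1 + \<bar>x\<bar>"
  unfolding jb_def by (rule real_le_lsqrt) (auto simp: power2_eq_square algebra_simps)

lemma abs_le_jb: "\<bar>x\<bar> \<le> jb x"
  unfolding jb_def by (rule real_le_rsqrt) auto

lemma le_2_jb: "1 + \<bar>x\<bar> \<le> 2 * jb x"
  using jb_ge_1[of x] abs_le_jb[of x] by linarith

lemma jb_scale:
  assumes "\<bar>x\<bar> \<le> c * \<bar>y\<bar>" "1 \<le> c"
  shows "jb x \<le> c * jb y"
proof -
  have "x\<^sup>2 \<le> (c * y)\<^sup>2" using assms by (intro abs_le_square_iff[THEN iffD1]) (auto simp: abs_mult)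
  moreover have "1 \<le> c\<^sup>2" using assms by simp
  ultimately have "1 + x\<^sup>2 \<le> (c * jb y)\<^sup>2" by (simp add: jb_def power_mult_distrib algebra_simps)
  then show ?thesis unfolding jb_def[of x] using assms by (intro real_le_lsqrt) auto
qed

lemma jb_add: "jb (x + y) \<le> jb x + jb y"
proof -
  have "2 * (x * y) \<le> 2 * (jb x * jb y)"
    using mult_mono[OF abs_le_jb[of x] abs_le_jb[of y] jb_nonneg] abs_ge_self[of "x * y"]
    by (auto simp: abs_mult)
  then have "1 + (x + y)\<^sup>2 \<le> (jb x + jb y)\<^sup>2"
    by (simp add: power2_sum) (simp add: jb_def)
  then show ?thesis unfolding jb_def[of "x + y"]
    by (intro real_le_lsqrt) (auto simp: add_nonneg_nonneg)
qed

lemma jb_powr_antimono: "\<bar>x\<bar> \<le> \<bar>y\<bar> \<Longrightarrow> 0 \<le> e \<Longrightarrow> jb y powr (- e) \<le> jb x powr (- e)"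
  by (rule powr_mono2') (auto simp: jb_mono)

lemma powr_minus_scale:
  fixes x c y e :: real
  assumes "0 < x" "0 < c" "x \<le> c * y" "0 \<le> e"
  shows "y powr (- e) \<le> c powr e * x powr (- e)"
proof -
  have "0 < y" using assms using zero_less_mult_pos[of c y] by linarith
  have "(c * y) powr (- e) \<le> x powr (- e)" using assms by (intro powr_mono2') auto
  then have "c powr e * (c powr (- e) * y powr (- e)) \<le> c powr e * x powr (- e)"
    using assms \<open>0 < y\<close> by (simp add: powr_mult)
  then show ?thesis using assms by (simp add: powr_minus field_simps)
qed

lemma continuous_on_jb_powr [continuous_intros]:
  "continuous_on X h \<Longrightarrow> continuous_on X (\<lambda>x. jb (h x) powr e)"
  unfolding jb_def by (intro continuous_intros) (auto simp: add_nonneg_eq_0_iff)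

text \<open>Powers of the bracket have no convenient antiderivative; it is enough to exhibit an
  \<open>E\<close> whose derivative dominates the integrand.\<close>

lemma integral_le_diff:
  fixes f E E' :: "real \<Rightarrow> real"
  assumes "l \<le> u" "continuous_on {l..u} f"
    and "\<And>s. s \<in> {l..u} \<Longrightarrow> (E has_real_derivative E' s) (at s within {l..u})"
    and "\<And>s. s \<in> {l..u} \<Longrightarrow> f s \<le> E' s"
  shows "integral {l..u} f \<le> E u - E l"
proof -
  have "(E' has_integral (E u - E l)) {l..u}"
    by (rule fundamental_theorem_of_calculus)
       (use assms in \<open>auto simp: has_real_derivative_iff_has_vector_derivative[symmetric]\<close>)
  moreover have "(f has_integral integral {l..u} f) {l..u}"
    using assms by (intro integrable_integral integrable_continuous_real)
  ultimately show ?thesis using has_integral_le[of f _ "{l..u}" E' "E u - E l"] assms(4) by blast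
qed

text \<open>For \<open>y \<ge> 0\<close> the bracket is at least half of \<open>1 + y\<close>, whose
  powers integrate explicitly. In the constant, \<open>2 powr a\<close> pays for this comparison and
  \<open>1 / (a - 1)\<close> comes from the integration.\<close>

lemma integral_jb_powr_tail:
  assumes a: "1 < a"
  shows "\<exists>C>0. \<forall>x m. 0 \<le> m \<longrightarrow> m \<le> x \<longrightarrow>
    integral {0..m} (\<lambda>s. jb (x - s) powr (- a)) \<le> C * jb (x - m) powr (1 - a)"
proof (intro exI[of _ "2 powr a / (a - 1)"] conjI allI impI)
  fix x m :: real assume m: "0 \<le> m" "m \<le> x"
  define E where "E s = 2 powr a / (a - 1) * (1 + x - s) powr (1 - a)" for s
  have "integral {0..m} (\<lambda>s. jb (x - s) powr (- a)) \<le> E m - E 0"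
  proof (rule integral_le_diff[OF m(1)])
    fix s assume s: "s \<in> {0..m}"
    show "(E has_real_derivative 2 powr a * (1 + x - s) powr (- a)) (at s within {0..m})"
      proof -
      have "((\<lambda>s. (1 + x - s) powr (1 - a)) has_real_derivative (1 - a) * (1 + x - s) powr (1 - a - 1) * (- 1)) (at s within {0..m})"
        using s m by (auto intro!: derivative_eq_intros)
      from DERIV_cmult[OF this, of "2 powr a / (a - 1)"] show ?thesis
        unfolding E_def by (rule DERIV_cong) (use a in \<open>simp add: divide_simps\<close>, simp add: algebra_simps)
    qed
    show "jb (x - s) powr (- a) \<le> 2 powr a * (1 + x - s) powr (- a)"
      using powr_minus_scale[of "1 + x - s" 2 "jb (x - s)" a] le_2_jb[of "x - s"] s m a by auto
  qed (auto intro!: continuous_intros)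
  also have "\<dots> \<le> E m" unfolding E_def using a by simp
  also have "\<dots> \<le> 2 powr a / (a - 1) * jb (x - m) powr (1 - a)"
    unfolding E_def using a m jb_le[of "x - m"] by (intro mult_left_mono powr_mono2') auto
  finally show "integral {0..m} (\<lambda>s. jb (x - s) powr (- a)) \<le> 2 powr a / (a - 1) * jb (x - m) powr (1 - a)" .
qed (use a in auto)

text \<open>An exponent above 1 makes the integral over the whole line finite. Uniformity in the
  shift and the limits comes from a single bounded primitive, and a slope of size at least 1 only
  shrinks the integral. The slopes used later are 1, -1 and 2.\<close>

lemma integral_jb_powr_bounded:
  assumes a: "1 < a"
  shows "\<exists>C>0. \<forall>x c l u. 1 \<le> \<bar>c\<bar> \<longrightarrow> integral {l..u} (\<lambda>s. jb (x + c * s) powr (- a)) \<le> C"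
proof -
  obtain C where C: "C > 0" and Ct: "\<And>x m. 0 \<le> m \<Longrightarrow> m \<le> x \<Longrightarrow>
    integral {0..m} (\<lambda>s. jb (x - s) powr (- a)) \<le> C * jb (x - m) powr (1 - a)"
    using integral_jb_powr_tail[OF a] by blast
  define g where "g y = jb y powr (- a)" for y
  have g: "continuous_on UNIV g" unfolding g_def by (intro continuous_intros)
  have gX: "continuous_on X g" for X unfolding g_def by (intro continuous_intros)
  have P: "prim g y = integral {0..y} g" if "0 \<le> y" for y
    using that prim_diff[OF g, of 0 y] by simp
  have odd: "prim g (- y) = - prim g y" for y
  proof -
    have "((\<lambda>x. prim g (- x) + prim g x) has_real_derivative 0) (at x)" for x
      using DERIV_add[OF deriv_affine[where a="-1" and b=0 and x=x and S=UNIV, OF prim_deriv[OF g]] prim_deriv[OF g, of x]]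
      by (simp add: g_def)
    then show ?thesis
      using DERIV_isconst_all[of "\<lambda>x. prim g (- x) + prim g x" y 0] by simp
  qed
  have nn: "0 \<le> prim g y" if "0 \<le> y" for y
    unfolding P[OF that] by (intro integral_nonneg integrable_continuous_real gX) (auto simp: g_def)
  have "prim g y \<le> C" if y: "0 \<le> y" for y
  proof -
    \<comment> \<open>Reflecting \<open>s\<close> to \<open>y - s\<close> gives the tail estimate
      with \<open>x = m = y\<close>, where the remaining bracket is 1.\<close>
    have "prim g y - prim g 0 = integral {0..y} (\<lambda>s. jb (y - s) powr (- a))"
    proof -
      have "((\<lambda>s. jb (y - s) powr (- a)) has_integral (- prim g (y - y) - (- prim g (y - 0)))) {0..y}"
        by (rule fundamental_theorem_of_calculus)
         (use y DERIV_minus[OF deriv_affine[where a="-1" and b=y, OF prim_deriv[OF g]]] in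
          \<open>auto simp: has_real_derivative_iff_has_vector_derivative[symmetric] g_def[symmetric]\<close>)
      then show ?thesis by (simp add: integral_unique)
    qed
    also have "\<dots> \<le> C" using Ct[of y y] y by simp
    finally show ?thesis by simp
  qed
  with nn odd have bd: "\<bar>prim g y\<bar> \<le> C" for y
    by (cases "0 \<le> y") (auto, metis abs_minus abs_of_nonneg neg_0_le_iff_le nle_le)
  show ?thesis
  proof (intro exI[of _ "2 * C"] conjI allI impI)
    fix x c l u :: real assume c: "1 \<le> \<bar>c\<bar>"
    show "integral {l..u} (\<lambda>s. jb (x + c * s) powr (- a)) \<le> 2 * C"
    proof (cases "l \<le> u")
      case True
      have "integral {l..u} (\<lambda>s. jb (x + c * s) powr (- a)) \<le> prim g (c * u + x) / c - prim g (c * l + x) / c"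
      proof (rule integral_le_diff[OF True, where E'="\<lambda>s. g (c * s + x)"])
        fix s
        have "((\<lambda>s. prim g (c * s + x) / c) has_real_derivative (c * g (c * s + x)) / c) (at s within {l..u})"
          by (intro DERIV_cdivide deriv_affine prim_deriv g)
        then show "((\<lambda>s. prim g (c * s + x) / c) has_real_derivative g (c * s + x)) (at s within {l..u})"
          using c by auto
      qed (auto intro!: continuous_intros simp: g_def add.commute)
      also have "\<dots> \<le> \<bar>prim g (c * u + x)\<bar> / \<bar>c\<bar> + \<bar>prim g (c * l + x)\<bar> / \<bar>c\<bar>"
        unfolding abs_divide[symmetric] by linarith
      also have "\<dots> \<le> C / 1 + C / 1"
        using c bd C by (intro add_mono frac_le) auto
      finally show ?thesis by simp
    next
      case False then show ?thesis using C by simp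
    qed
  qed (use C in auto)
qed

lemma jb_deriv: "(jb has_real_derivative y / jb y) (at y)"
proof -
  have "0 < 1 + y\<^sup>2" by (simp add: add_pos_nonneg)
  then have "((\<lambda>y. sqrt (1 + y\<^sup>2)) has_real_derivative inverse (sqrt (1 + y\<^sup>2)) / 2 * (2 * y)) (at y)"
    by (auto intro!: derivative_eq_intros)
  then show ?thesis by (simp add: jb_def[abs_def] field_simps)
qed

text \<open>\<open>H y = y * jb y powr (- e)\<close> is differentiable through 0 and its derivative
  is at least \<open>(1 - e) * jb y powr (- e)\<close>, so it also serves intervals on which the
  argument changes sign.\<close>

lemma integral_jb_powr_head:
  assumes e: "0 \<le> e" "e < 1" and lu: "l \<le> u" and c: "c \<noteq> 0"
  shows "integral {l..u} (\<lambda>s. jb (c * s + x) powr (- e)) \<le>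
    ((c * u + x) * jb (c * u + x) powr (- e) - (c * l + x) * jb (c * l + x) powr (- e)) / (c * (1 - e))"
proof -
  define H where "H y = y * jb y powr (- e)" for y
  define H' where "H' y = jb y powr (- e) - e * y\<^sup>2 * jb y powr (- e - 2)" for y
  have dH: "(H has_real_derivative H' y) (at y)" for y
  proof -
    have "(H has_real_derivative (jb y powr (- e) + y * ((- e) * jb y powr (- e - 1) * (y / jb y)))) (at y)"
      unfolding H_def by (auto intro!: derivative_eq_intros jb_deriv)
    moreover have "jb y powr (- e - 1) / jb y = jb y powr (- e - 2)"
      using powr_diff[of "jb y" "- e - 1" 1] jb_pos[of y] by (simp add: algebra_simps)
    then have "jb y powr (- e) + y * ((- e) * jb y powr (- e - 1) * (y / jb y)) = H' y"
      unfolding H'_def power2_eq_square by (simp add: algebra_simps flip: times_divide_eq_right)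
    ultimately show ?thesis by simp
  qed
  have H': "(1 - e) * jb y powr (- e) \<le> H' y" for y
  proof -
    have "y\<^sup>2 * jb y powr (- e - 2) \<le> (jb y)\<^sup>2 * jb y powr (- e - 2)"
      by (intro mult_right_mono) (auto simp: jb_def)
    also have "\<dots> = jb y powr (- e)"
    proof -
      have "(jb y)\<^sup>2 = jb y powr 2" using powr_realpow[OF jb_pos, of y 2] by simp
      then show ?thesis using powr_add[of "jb y" 2 "- e - 2"] by simp
    qed
    finally have "e * (y\<^sup>2 * jb y powr (- e - 2)) \<le> e * jb y powr (- e)"
      using e by (intro mult_left_mono)
    then show ?thesis by (simp add: H'_def algebra_simps)
  qed
  have "integral {l..u} (\<lambda>s. jb (c * s + x) powr (- e)) \<le> H (c * u + x) / (c * (1 - e)) - H (c * l + x) / (c * (1 - e))"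
  proof (rule integral_le_diff[OF lu, where E'="\<lambda>s. H' (c * s + x) / (1 - e)"])
    fix s
    have "((\<lambda>s. H (c * s + x) / (c * (1 - e))) has_real_derivative (c * H' (c * s + x)) / (c * (1 - e))) (at s within {l..u})"
      by (intro DERIV_cdivide deriv_affine dH)
    then show "((\<lambda>s. H (c * s + x) / (c * (1 - e))) has_real_derivative H' (c * s + x) / (1 - e)) (at s within {l..u})"
      using c by auto
    show "jb (c * s + x) powr (- e) \<le> H' (c * s + x) / (1 - e)"
      using H'[of "c * s + x"] e by (simp add: field_simps)
  qed (auto intro!: continuous_intros)
  then show ?thesis by (simp add: H_def diff_divide_distrib)
qed

lemma integral_norm_le:
  fixes f g :: "real \<Rightarrow> real"
  assumes "continuous_on {l..u} f" "continuous_on {l..u} g" "\<And>s. s \<in> {l..u} \<Longrightarrow> \<bar>f s\<bar> \<le> g s"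
  shows "\<bar>integral {l..u} f\<bar> \<le> integral {l..u} g"
  using integral_norm_bound_integral[of f "{l..u}" g] assms integrable_continuous_real by auto

text \<open>Two bounds, because \<open>s + \<bar>\<rho>\<bar>\<close> is constant along an incoming
  characteristic and \<open>s - \<bar>\<rho>\<bar>\<close> along an outgoing one. The constant
  quantity is pulled out with exponent \<open>\<kappa>\<close>; what remains is integrable on the
  line when \<open>a > 1\<close>.\<close>

definition char_dominated :: "real \<Rightarrow> real \<Rightarrow> real \<Rightarrow> field2 \<Rightarrow> bool" where
  "char_dominated a \<kappa> K G \<longleftrightarrow> (\<forall>s\<ge>0. \<forall>\<rho>.
    \<bar>G s \<rho>\<bar> \<le> K * (jb (s + \<bar>\<rho>\<bar>) powr (- \<kappa>) * (jb \<rho> powr (- a) + jb (s - \<bar>\<rho>\<bar>) powr (- a))) \<and>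
    \<bar>G s \<rho>\<bar> \<le> K * (jb (s - \<bar>\<rho>\<bar>) powr (- \<kappa>) * jb \<rho> powr (- a)))"

lemma characteristic_integrals_bound:
  assumes a: "1 < a"
  shows "\<exists>C>0. \<forall>G K \<kappa>. cont2 G \<longrightarrow> 0 \<le> K \<longrightarrow>
    char_dominated a \<kappa> K G \<longrightarrow>
    (\<forall>t\<ge>0. \<forall>r\<ge>0. \<bar>Pp G t r\<bar> \<le> C * K * jb (t + r) powr (- \<kappa>) \<and> \<bar>Pm G t r\<bar> \<le> C * K * jb (t - r) powr (- \<kappa>))"
proof -
  obtain C where C: "C > 0" and Cb: "\<And>x c l u. 1 \<le> \<bar>c\<bar> \<Longrightarrow> integral {l..u} (\<lambda>s. jb (x + c * s) powr (- a)) \<le> C"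
    using integral_jb_powr_bounded[OF a] by blast
  have two: "integral {0..t} (\<lambda>s. K * (L * (jb (x1 + c1 * s) powr (- a) + jb (x2 + c2 * s) powr (- a)))) \<le> 2 * C * K * L"
    if "1 \<le> \<bar>c1\<bar>" "1 \<le> \<bar>c2\<bar>" "0 \<le> K" "0 \<le> L" for t x1 c1 x2 c2 K L
  proof -
    have i: "(\<lambda>s. jb (x + c * s) powr (- a)) integrable_on {0..t}" for x c
      by (intro integrable_continuous_real continuous_intros)
    have "integral {0..t} (\<lambda>s. K * (L * (jb (x1 + c1 * s) powr (- a) + jb (x2 + c2 * s) powr (- a))))
      = K * (L * (integral {0..t} (\<lambda>s. jb (x1 + c1 * s) powr (- a)) + integral {0..t} (\<lambda>s. jb (x2 + c2 * s) powr (- a))))"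
      by (simp add: integral_add[OF i i])
    also have "\<dots> \<le> K * (L * (C + C))"
      using that Cb by (intro mult_left_mono add_mono) auto
    finally show ?thesis by (simp add: algebra_simps)
  qed
  show ?thesis
  proof (intro exI[of _ "2 * C"] conjI allI impI)
    fix G K \<kappa> and t r :: real
    assume G: "cont2 G" and K: "0 \<le> K"
      and dom: "char_dominated a \<kappa> K G" and t: "0 \<le> t" and r: "0 \<le> r"
    have 1: "\<forall>s\<ge>0. \<forall>\<rho>. \<bar>G s \<rho>\<bar> \<le> K * (jb (s + \<bar>\<rho>\<bar>) powr (- \<kappa>) * (jb \<rho> powr (- a) + jb (s - \<bar>\<rho>\<bar>) powr (- a)))"
      and 2: "\<forall>s\<ge>0. \<forall>\<rho>. \<bar>G s \<rho>\<bar> \<le> K * (jb (s - \<bar>\<rho>\<bar>) powr (- \<kappa>) * jb \<rho> powr (- a))"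
      using dom by (auto simp: char_dominated_def)
    have "\<bar>Pp G t r\<bar> \<le> integral {0..t} (\<lambda>s. K * (jb (t + r) powr (- \<kappa>) * (jb ((r + t) + (-1) * s) powr (- a) + jb (- r - t + 2 * s) powr (- a))))"
      unfolding Pp_def
    proof (rule integral_norm_le)
      fix s assume s: "s \<in> {0..t}"
      have eq: "\<bar>r + t - s\<bar> = r + t - s" using s r by auto
      have "s + \<bar>r + t - s\<bar> = t + r" "s - \<bar>r + t - s\<bar> = - r - t + 2 * s" unfolding eq by auto
      moreover have "jb ((r + t) + (-1) * s) = jb (r + t - s)" by simp
      moreover note 1[rule_format, of s "r + t - s"] s
      ultimately
      show "\<bar>G s (r + t - s)\<bar> \<le> K * (jb (t + r) powr (- \<kappa>) * (jb ((r + t) + (-1) * s) powr (- a) + jb (- r - t + 2 * s) powr (- a)))"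
        by (metis atLeastAtMost_iff)
    qed (auto intro!: continuous_intros cont2_compose[OF G])
    also have "\<dots> \<le> 2 * C * K * jb (t + r) powr (- \<kappa>)"
      using K by (intro two) auto
    finally show "\<bar>Pp G t r\<bar> \<le> 2 * C * K * jb (t + r) powr (- \<kappa>)" .
    have "\<bar>Pm G t r\<bar> \<le> integral {0..t} (\<lambda>s. K * (jb (t - r) powr (- \<kappa>) * (jb ((r - t) + 1 * s) powr (- a) + jb (r - t + 2 * s) powr (- a))))"
      unfolding Pm_def
    proof (rule integral_norm_le)
      fix s assume s: "s \<in> {0..t}"
      show "\<bar>G s (r - t + s)\<bar> \<le> K * (jb (t - r) powr (- \<kappa>) * (jb ((r - t) + 1 * s) powr (- a) + jb (r - t + 2 * s) powr (- a)))"
      \<comment> \<open>As long as \<open>\<rho> < 0\<close>, the line is the mirror image of an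
        incoming characteristic: there \<open>s + \<bar>\<rho>\<bar>\<close>, not the difference,
        equals \<open>t - r\<close>.\<close>
      proof (cases "0 \<le> r - t + s")
        case True
        then have "s - \<bar>r - t + s\<bar> = t - r" by simp
        with 2[rule_format, of s "r - t + s"] s
        have "\<bar>G s (r - t + s)\<bar> \<le> K * (jb (t - r) powr (- \<kappa>) * (jb (r - t + s) powr (- a)))" by simp
        also have "\<dots> \<le> K * (jb (t - r) powr (- \<kappa>) * (jb (r - t + s) powr (- a) + jb (r - t + 2 * s) powr (- a)))"
          using K by (intro mult_left_mono) auto
        finally show ?thesis by simp
      next
        case False
        then have "s + \<bar>r - t + s\<bar> = t - r" "s - \<bar>r - t + s\<bar> = r - t + 2 * s" by simp_all
        moreover have "jb ((r - t) + 1 * s) = jb (r - t + s)" by simp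
        moreover note 1[rule_format, of s "r - t + s"] s
        ultimately show ?thesis by (metis atLeastAtMost_iff)
      qed
    qed (auto intro!: continuous_intros cont2_compose[OF G])
    also have "\<dots> \<le> 2 * C * K * jb (t - r) powr (- \<kappa>)"
      using K by (intro two) auto
    finally show "\<bar>Pm G t r\<bar> \<le> 2 * C * K * jb (t - r) powr (- \<kappa>)" .
  qed (use C in auto)
qed

section \<open>Weighted estimates for the Duhamel operator\<close>

locale exponents =
  fixes p q \<mu> :: real
  assumes q2: "2 < q" and p2: "2 < p" and p3: "p < 3" and mu_gt: "3 - p < \<mu>" and mu1: "\<mu> < 1"
    and critical: "p * (2 - (p - 2) * q) < (p * q - 1) * \<mu>"
begin

abbreviation "W1 \<equiv> w1 p \<mu>"
abbreviation "W2 \<equiv> w2 p \<mu>"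
abbreviation "W3 \<equiv> w3 \<mu>"

lemma mu_pos: "0 < \<mu>" using mu_gt p3 by simp

lemma w1_pos: "0 < W1 t r"
  by (simp add: w1_def)

lemma w2_pos: "0 < W2 t r"
  by (simp add: w2_def)

lemma w3_pos: "0 < W3 t r"
  by (simp add: w3_def)

text \<open>For use when \<open>r\<close> times the radial derivative is written as the derivative
  of \<open>r v\<close> minus \<open>v\<close>: the bound on \<open>v\<close> must then also count
  in the weight \<open>W3\<close>.\<close>

lemma w3_le_w2:
  assumes "0 \<le> t" "0 \<le> r"
  shows "W3 t r \<le> W2 t r"
proof (cases "r < t / 2")
  case True
  have "W3 t r \<le> 1 * jb (t + r) powr \<mu>"
    unfolding w3_def using assms mu_pos by (auto intro!: powr_mono2 jb_mono)
  also have "\<dots> \<le> jb r powr (p - 2) * jb (t + r) powr \<mu>"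
    using p2 jb_ge_1[of r] by (intro mult_right_mono) (auto simp: ge_one_powr_ge_zero)
  finally show ?thesis using True by (simp add: w2_def)
next
  case False
  have "jb (t - r) powr (3 - p) \<le> jb (t + r) powr (3 - p)"
    using assms p3 by (auto intro!: powr_mono2 jb_mono)
  also have "\<dots> \<le> jb (t + r) powr 1"
    using p2 jb_ge_1[of "t + r"] by (intro powr_mono) auto
  finally have "jb (t - r) powr (p - 3 + \<mu>) * jb (t - r) powr (3 - p) \<le> jb (t - r) powr (p - 3 + \<mu>) * jb (t + r)"
    by (intro mult_left_mono) auto
  then show ?thesis using False by (simp add: w2_def w3_def powr_add[symmetric])
qed

text \<open>Converts a bound with weight \<open>W3\<close> into one with weight \<open>W2\<close> at
  the cost of one bracket of \<open>r\<close>. The constant is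
  \<open>t + r \<le> 3 * (t - r)\<close> for \<open>r < t / 2\<close> and
  \<open>t + r \<le> 3 * r\<close> otherwise.\<close>

lemma w2_le_jb_w3:
  assumes "0 \<le> t" "0 \<le> r"
  shows "W2 t r \<le> 3 * (jb r * W3 t r)"
proof (cases "r < t / 2")
  case True
  have 1: "jb r powr (p - 2) \<le> jb r powr 1" using p3 jb_ge_1[of r] by (intro powr_mono) auto
  have "jb (t + r) \<le> 3 * jb (t - r)" using True assms by (intro jb_scale) auto
  then have "jb (t + r) powr \<mu> \<le> (3 * jb (t - r)) powr \<mu>"
    using mu_pos by (intro powr_mono2) auto
  also have "\<dots> = 3 powr \<mu> * jb (t - r) powr \<mu>"
    by (simp add: powr_mult)
  also have "\<dots> \<le> 3 powr 1 * jb (t - r) powr \<mu>"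
    using mu1 by (intro mult_right_mono powr_mono) auto
  finally have "jb r powr (p - 2) * jb (t + r) powr \<mu> \<le> jb r powr 1 * (3 powr 1 * jb (t - r) powr \<mu>)"
    using 1 by (intro mult_mono) auto
  then show ?thesis using True by (simp add: w2_def w3_def mult_ac)
next
  case False
  have "jb (t + r) \<le> 3 * jb r" using False assms by (intro jb_scale) auto
  moreover have "jb (t - r) powr (p - 3 + \<mu>) \<le> jb (t - r) powr \<mu>"
    using p3 jb_ge_1[of "t - r"] by (intro powr_mono) auto
  ultimately have "jb (t - r) powr (p - 3 + \<mu>) * jb (t + r) \<le> jb (t - r) powr \<mu> * (3 * jb r)"
    by (intro mult_mono) auto
  then show ?thesis using False by (simp add: w2_def w3_def mult_ac)
qed

lemma w2_0: "0 \<le> t \<Longrightarrow> W2 t 0 = W3 t 0"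
  by (cases "t = 0") (auto simp: w2_def w3_def)

end

text \<open>Trades part of the decay in the larger quantity \<open>Y\<close> for decay in
  \<open>X\<close>; the basic move of the weight comparisons.\<close>

lemma powr_split_antimono:
  fixes X Y c d :: real
  assumes "0 < X" "X \<le> Y" "0 \<le> d"
  shows "Y powr (- c - d) \<le> Y powr (- c) * X powr (- d)"
proof -
  have "Y powr (- d) \<le> X powr (- d)" using assms by (intro powr_mono2') auto
  then show ?thesis using powr_add[of Y "- c" "- d"] by (simp add: mult_left_mono)
qed

text \<open>The larger of \<open>X\<close> and \<open>Y\<close> is at least \<open>Z / 3\<close> and
  pays for the factor in \<open>Z\<close>. If it is \<open>X\<close>, it hands its surplus exponent
  \<open>a - \<mu>\<close> to \<open>Y\<close>, so one of the two always carries the full exponent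
  \<open>a\<close>.\<close>

lemma young_type:
  fixes X Y Z a \<mu> :: real
  assumes "1 \<le> X" "1 \<le> Y" "1 \<le> Z" "Z \<le> Y + 2 * X" "0 \<le> \<mu>" "\<mu> \<le> a"
  shows "X powr (- a) * Y powr (- \<mu>) \<le> 3 powr \<mu> * (Z powr (- \<mu>) * (X powr (- a) + Y powr (- a)))"
proof (cases "X \<le> Y")
  case True
  have "Y powr (- \<mu>) \<le> 3 powr \<mu> * Z powr (- \<mu>)" by (rule powr_minus_scale) (use assms True in auto)
  then have "X powr (- a) * Y powr (- \<mu>) \<le> X powr (- a) * (3 powr \<mu> * Z powr (- \<mu>))"
    by (intro mult_left_mono) auto
  also have "\<dots> \<le> (X powr (- a) + Y powr (- a)) * (3 powr \<mu> * Z powr (- \<mu>))"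
    by (intro mult_right_mono) auto
  finally show ?thesis by (simp add: mult_ac)
next
  case False
  have 1: "X powr (- \<mu>) \<le> 3 powr \<mu> * Z powr (- \<mu>)" by (rule powr_minus_scale) (use assms False in auto)
  have "X powr (- \<mu> - (a - \<mu>)) \<le> X powr (- \<mu>) * Y powr (- (a - \<mu>))"
    by (rule powr_split_antimono) (use assms False in auto)
  then have "X powr (- a) * Y powr (- \<mu>) \<le> X powr (- \<mu>) * Y powr (- (a - \<mu>)) * Y powr (- \<mu>)"
    by (intro mult_right_mono) auto
  also have "\<dots> = X powr (- \<mu>) * Y powr (- a)"
    using assms by (simp add: powr_add[symmetric] mult.assoc)
  also have "\<dots> \<le> (3 powr \<mu> * Z powr (- \<mu>)) * Y powr (- a)"
    by (intro mult_right_mono 1) auto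
  also have "\<dots> \<le> (3 powr \<mu> * Z powr (- \<mu>)) * (X powr (- a) + Y powr (- a))"
    by (intro mult_left_mono) auto
  finally show ?thesis by (simp add: mult_ac)
qed

lemma mult_jb_powr_le: "y * jb y powr (- e) \<le> jb y powr (1 - e)"
proof -
  have "y * jb y powr (- e) \<le> jb y * jb y powr (- e)"
    using abs_le_jb[of y] by (intro mult_right_mono) auto
  then show ?thesis using powr_add[of "jb y" 1 "- e"] by (simp add:)
qed

lemma C1_diagonal:
  assumes h: "C1 h ht hr" and m: "m \<le> t" and \<tau>: "\<tau> \<in> {0..m}"
  shows "((\<lambda>\<tau>. h (t - \<tau>) (r - \<tau>)) has_real_derivative - (ht (t - \<tau>) (r - \<tau>) + hr (t - \<tau>) (r - \<tau>))) (at \<tau> within {0..m})"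
proof -
  have "((\<lambda>s. (t - s, r - s)) has_derivative (\<lambda>d. (- d, - d))) (at \<tau> within {0..m})"
    by (auto intro!: derivative_eq_intros)
  from C1_chain[OF h this \<tau>]
  have "((\<lambda>s. h (t - s) (r - s)) has_derivative (\<lambda>d. ht (t - \<tau>) (r - \<tau>) * (- d) + hr (t - \<tau>) (r - \<tau>) * (- d))) (at \<tau> within {0..m})"
    using m by simp
  then have "((\<lambda>s. h (t - s) (r - s)) has_derivative (\<lambda>d. - (ht (t - \<tau>) (r - \<tau>) + hr (t - \<tau>) (r - \<tau>)) * d)) (at \<tau> within {0..m})"
    by (simp add: algebra_simps)
  then show ?thesis by (simp add: has_field_derivative_def)
qed

text \<open>Integrating the outgoing derivative \<open>(\<partial>\<^sub>t + \<partial>\<^sub>r) D = 2 P\<^sub>+\<close> from the boundary \<open>t = 0\<close> or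
  \<open>r = 0\<close>, where \<open>D\<close> vanishes, replaces the change to characteristic coordinates.\<close>

lemma Dop_eq_integral_Pp:
  assumes G: "cont2 G" and odd: "\<And>s x. 0 \<le> s \<Longrightarrow> G s (- x) = - G s x" and t: "0 \<le> t" and r: "0 \<le> r"
  shows "Dop G t r = 2 * integral {0..min t r} (\<lambda>\<tau>. Pp G (t - \<tau>) (r - \<tau>))"
proof -
  let ?m = "min t r"
  have "((\<lambda>\<tau>. - (Pp G (t - \<tau>) (r - \<tau>) + Pm G (t - \<tau>) (r - \<tau>) + (Pp G (t - \<tau>) (r - \<tau>) - Pm G (t - \<tau>) (r - \<tau>))))
      has_integral (Dop G (t - ?m) (r - ?m) - Dop G (t - 0) (r - 0))) {0..?m}"
    by (rule fundamental_theorem_of_calculus)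
       (use t r C1_diagonal[OF C1_Dop[OF G], of ?m t] in \<open>auto simp: has_real_derivative_iff_has_vector_derivative[symmetric]\<close>)
  moreover have "Dop G (t - ?m) (r - ?m) = 0"
  proof (cases "t \<le> r")
    case True then show ?thesis by (simp add: Dop_def)
  next
    case False
    then have "r - ?m = 0" by simp
    moreover have "Dop G (t - ?m) 0 = 0" using Dop_minus[OF G odd, of "t - ?m" 0] by simp
    ultimately show ?thesis by simp
  qed
  ultimately have "((\<lambda>\<tau>. - 2 * Pp G (t - \<tau>) (r - \<tau>)) has_integral (- Dop G t r)) {0..?m}"
    by (simp add: algebra_simps)
  then have "integral {0..?m} (\<lambda>\<tau>. - 2 * Pp G (t - \<tau>) (r - \<tau>)) = - Dop G t r" by (rule integral_unique)
  then show ?thesis by simp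
qed

context exponents
begin

text \<open>The integrable exponent left for the source of \<open>u\<close> after a factor with
  exponent \<open>\<mu> / p\<close>, the decay of \<open>W1\<close>, has been split off. The second
  entry counts the powers in the zone \<open>r < t / 2\<close>; the first is the decay in
  \<open>t + r\<close> that is available for \<open>r \<ge> t / 2\<close>.\<close>

definition b0 :: real where "b0 = min (q - 1) ((p - 2 + \<mu>) * q - 1 - \<mu> / p)"

lemma b0_gt_1: "1 < b0"
proof -
  have "(p * (2 - (p - 2) * q)) / p < ((p * q - 1) * \<mu>) / p"
    using critical p2 by (intro divide_strict_right_mono) auto
  moreover have "(p * (2 - (p - 2) * q)) / p = 2 - (p - 2) * q" using p2 by simp
  moreover have "((p * q - 1) * \<mu>) / p = q * \<mu> - \<mu> / p" using p2 by (simp add: field_simps)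
  ultimately have "2 - (p - 2) * q < q * \<mu> - \<mu> / p" by linarith
  then show ?thesis using q2 by (auto simp: b0_def algebra_simps)
qed

text \<open>Since \<open>Y = jb (s + \<rho>)\<close> dominates \<open>X = jb \<rho>\<close> and
  \<open>Z = jb (s - \<rho>)\<close>, its surplus powers can be turned into powers of
  \<open>X\<close> or \<open>Z\<close>. For \<open>\<rho> < s / 2\<close> the weight consists of
  \<open>X\<close> and \<open>Y\<close>, otherwise of \<open>Z\<close> and \<open>Y\<close>.\<close>

lemma jb_w2_powr_le:
  assumes "0 \<le> s" "0 \<le> \<rho>"
  shows "jb \<rho> * W2 s \<rho> powr (- q) \<le> jb (s + \<rho>) powr (- (\<mu> / p)) * (jb \<rho> powr (- b0) + jb (s - \<rho>) powr (- b0))" (is ?A)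
    and "jb \<rho> * W2 s \<rho> powr (- q) \<le> jb (s - \<rho>) powr (- (\<mu> / p)) * jb \<rho> powr (- b0)" (is ?B)
proof -
  define X Y Z \<kappa> where "X = jb \<rho>" and "Y = jb (s + \<rho>)" and "Z = jb (s - \<rho>)" and "\<kappa> = \<mu> / p"
  have X: "1 \<le> X" "X \<le> Y" and Z: "1 \<le> Z" "Z \<le> Y"
    using assms by (auto simp: X_def Y_def Z_def jb_ge_1 intro!: jb_mono)
  have \<kappa>: "0 < \<kappa>" "\<kappa> < 1" using p2 mu_pos mu1 by (auto simp: \<kappa>_def)
  have \<kappa>q: "\<kappa> \<le> \<mu> * q"
  proof -
    have "\<mu> / p \<le> \<mu> / 1" using p2 mu_pos by (intro divide_left_mono) auto
    also have "\<dots> \<le> \<mu> * q" using q2 mu_pos by simp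
    finally show ?thesis by (simp add: \<kappa>_def)
  qed
  define b where "b = (p - 2 + \<mu>) * q - 1 - \<kappa>"
  have b0: "b0 \<le> b" "b0 \<le> q - 1" by (auto simp: b0_def b_def \<kappa>_def)
  have goal: "X * W2 s \<rho> powr (- q) \<le> Y powr (- \<kappa>) * (X powr (- b0) + Z powr (- b0)) \<and>
     X * W2 s \<rho> powr (- q) \<le> Z powr (- \<kappa>) * X powr (- b0)"
  proof (cases "\<rho> < s / 2")
    case True
    have "X * W2 s \<rho> powr (- q) = X powr 1 * (X powr (- ((p - 2) * q)) * Y powr (- (\<mu> * q)))"
      using True X by (simp add: w2_def X_def[symmetric] Y_def[symmetric] powr_mult powr_powr)
    also have "\<dots> = X powr (1 - (p - 2) * q) * Y powr (- \<kappa> - (\<mu> * q - \<kappa>))"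
      using powr_add[of X 1 "- ((p - 2) * q)"] by (simp add: mult.assoc)
    also have "\<dots> \<le> X powr (1 - (p - 2) * q) * (Y powr (- \<kappa>) * X powr (- (\<mu> * q - \<kappa>)))"
      using X \<kappa>q by (intro mult_left_mono powr_split_antimono) auto
    also have "\<dots> = Y powr (- \<kappa>) * X powr (- b)"
      by (simp add: powr_add[symmetric] mult_ac b_def algebra_simps)
    also have "\<dots> \<le> Y powr (- \<kappa>) * X powr (- b0)"
      using b0 X by (intro mult_left_mono powr_mono) auto
    finally have 1: "X * W2 s \<rho> powr (- q) \<le> Y powr (- \<kappa>) * X powr (- b0)" .
    have "Y powr (- \<kappa>) * X powr (- b0) \<le> Y powr (- \<kappa>) * (X powr (- b0) + Z powr (- b0))"
      by (intro mult_left_mono) auto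
    moreover have "Y powr (- \<kappa>) * X powr (- b0) \<le> Z powr (- \<kappa>) * X powr (- b0)"
      using Z \<kappa> by (intro mult_right_mono powr_mono2') auto
    ultimately show ?thesis using 1 by linarith
  next
    case False
    define \<nu> where "\<nu> = (p - 3 + \<mu>) * q"
    have \<nu>: "\<nu> + q - 1 = b + \<kappa>" by (simp add: \<nu>_def b_def algebra_simps)
    have "X * W2 s \<rho> powr (- q) = X * (Z powr (- \<nu>) * Y powr (- q))"
      using False X Z by (simp add: w2_def Z_def[symmetric] Y_def[symmetric] powr_mult powr_powr \<nu>_def)
    also have "\<dots> \<le> Y powr 1 * (Z powr (- \<nu>) * Y powr (- q))"
      using X by (intro mult_right_mono) auto
    also have "\<dots> = Y powr (1 - q) * Z powr (- \<nu>)"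
      using powr_add[of Y 1 "- q"] by (simp add: mult_ac)
    finally have 0: "X * W2 s \<rho> powr (- q) \<le> Y powr (1 - q) * Z powr (- \<nu>)" .
    have "Y powr (- \<kappa> - (q - 1 - \<kappa>)) \<le> Y powr (- \<kappa>) * Z powr (- (q - 1 - \<kappa>))"
      using Z \<kappa> q2 by (intro powr_split_antimono) auto
    then have "Y powr (1 - q) * Z powr (- \<nu>) \<le> Y powr (- \<kappa>) * Z powr (- (q - 1 - \<kappa>)) * Z powr (- \<nu>)"
      by (intro mult_right_mono) auto
    also have "\<dots> = Y powr (- \<kappa>) * Z powr (- b)"
      using \<nu> by (simp add: powr_add[symmetric] mult.assoc) (simp add: algebra_simps)
    also have "\<dots> \<le> Y powr (- \<kappa>) * (X powr (- b0) + Z powr (- b0))"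
      using b0 Z powr_mono[of "- b" "- b0" Z] by (intro mult_left_mono) (auto simp: add_increasing)
    finally have 1: "Y powr (1 - q) * Z powr (- \<nu>) \<le> Y powr (- \<kappa>) * (X powr (- b0) + Z powr (- b0))" .
    \<comment> \<open>For the second bound \<open>X\<close> must receive the integrable exponent
      while \<open>Z\<close> keeps at least \<open>\<kappa>\<close>: of the decay in
      \<open>Y\<close>, the part \<open>b0\<close> goes to \<open>X\<close> and the rest to
      \<open>Z\<close>.\<close>
    have "Y powr (- b0 - (q - 1 - b0)) \<le> Y powr (- b0) * Z powr (- (q - 1 - b0))"
      using Z b0 by (intro powr_split_antimono) auto
    also have "\<dots> \<le> X powr (- b0) * Z powr (- (q - 1 - b0))"
      using X b0_gt_1 by (intro mult_right_mono powr_mono2') auto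
    finally have "Y powr (1 - q) * Z powr (- \<nu>) \<le> X powr (- b0) * Z powr (- (q - 1 - b0)) * Z powr (- \<nu>)"
      by (intro mult_right_mono) auto
    also have "\<dots> = X powr (- b0) * Z powr (- (b - b0) - \<kappa>)"
      using \<nu> by (simp add: powr_add[symmetric] mult.assoc) (simp add: algebra_simps)
    also have "\<dots> \<le> X powr (- b0) * Z powr (- \<kappa>)"
      using b0 Z by (intro mult_left_mono powr_mono) auto
    finally have 2: "Y powr (1 - q) * Z powr (- \<nu>) \<le> X powr (- b0) * Z powr (- \<kappa>)" .
    show ?thesis using 0 1 2 by (auto simp: mult.commute)
  qed
  then show ?A ?B by (auto simp: X_def Y_def Z_def \<kappa>_def)
qed

text \<open>The size of \<open>\<rho> * \<bar>v\<bar> powr q\<close> when \<open>v\<close> is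
  bounded by a multiple of \<open>1 / W2\<close>. The same size is later shown for its radial
  derivative.\<close>

definition v_source_bound :: "real \<Rightarrow> field2 \<Rightarrow> bool" where
  "v_source_bound K G \<longleftrightarrow> (\<forall>s\<ge>0. \<forall>\<rho>. \<bar>G s \<rho>\<bar> \<le> K * (jb \<rho> * W2 s \<bar>\<rho>\<bar> powr (- q)))"

text \<open>Dividing by \<open>r\<close> costs a factor 2 against \<open>1 / jb r\<close> in both
  ranges: \<open>jb r \<le> 2\<close> for \<open>r \<le> 1\<close> and
  \<open>jb r \<le> 2 * r\<close> beyond. The other factor 2 in the constant counts the two
  characteristic integrals, and \<open>3 powr \<kappa>\<close> pays for moving the weight to an
  intermediate radius.\<close>

lemma dt_Dop_bound:
  "\<exists>C>0. \<forall>G Gx K. cont2 G \<longrightarrow> cont2 Gx \<longrightarrow> 0 \<le> K \<longrightarrow>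
    (\<forall>s\<ge>0. \<forall>\<rho>. (G s has_real_derivative Gx s \<rho>) (at \<rho>)) \<longrightarrow>
    (\<forall>s\<ge>0. \<forall>\<rho>. G s (- \<rho>) = - G s \<rho>) \<longrightarrow>
    v_source_bound K G \<longrightarrow> v_source_bound K Gx \<longrightarrow>
    (\<forall>t\<ge>0. \<forall>r\<ge>0. \<bar>quo (\<lambda>t r. Pp G t r + Pm G t r) (\<lambda>t r. Pp Gx t r + Pm Gx t r) t r\<bar> \<le> C * K / W1 t r)"
proof -
  define \<kappa> where "\<kappa> = \<mu> / p"
  have \<kappa>: "0 < \<kappa>" using mu_pos p2 by (simp add: \<kappa>_def)
  obtain C where C: "C > 0" and CB: "\<And>G K \<kappa>. cont2 G \<Longrightarrow> 0 \<le> K \<Longrightarrow> char_dominated b0 \<kappa> K G \<Longrightarrow>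
    (\<forall>t\<ge>0. \<forall>r\<ge>0. \<bar>Pp G t r\<bar> \<le> C * K * jb (t + r) powr (- \<kappa>) \<and> \<bar>Pm G t r\<bar> \<le> C * K * jb (t - r) powr (- \<kappa>))"
    using characteristic_integrals_bound[OF b0_gt_1] by blast
  have bound: "\<bar>Pp G t r + Pm G t r\<bar> \<le> 2 * C * K * jb (t - r) powr (- \<kappa>)"
    if G: "cont2 G" and K: "0 \<le> K" and b: "v_source_bound K G"
      and t: "0 \<le> t" and r: "0 \<le> r" for G K t r
  proof -
    have 1: "\<bar>G s \<rho>\<bar> \<le> K * (jb (s + \<bar>\<rho>\<bar>) powr (- \<kappa>) * (jb \<rho> powr (- b0) + jb (s - \<bar>\<rho>\<bar>) powr (- b0)))"
      "\<bar>G s \<rho>\<bar> \<le> K * (jb (s - \<bar>\<rho>\<bar>) powr (- \<kappa>) * jb \<rho> powr (- b0))" if "0 \<le> s" for s \<rho>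
      using b[unfolded v_source_bound_def, rule_format, OF that, of \<rho>] mult_left_mono[OF jb_w2_powr_le(1)[OF that, of "\<bar>\<rho>\<bar>"] K]
        mult_left_mono[OF jb_w2_powr_le(2)[OF that, of "\<bar>\<rho>\<bar>"] K] by (auto simp: \<kappa>_def)
    have "\<bar>Pp G t r\<bar> \<le> C * K * jb (t + r) powr (- \<kappa>)" "\<bar>Pm G t r\<bar> \<le> C * K * jb (t - r) powr (- \<kappa>)"
      using CB[OF G K, of \<kappa>] 1 t r by (auto simp: char_dominated_def)
    moreover have "C * K * jb (t + r) powr (- \<kappa>) \<le> C * K * jb (t - r) powr (- \<kappa>)"
      using t r C K \<kappa> by (intro mult_left_mono jb_powr_antimono) auto
    ultimately show ?thesis by linarith
  qed
  have w1: "1 / W1 t r = jb (t - r) powr (- \<kappa>) / jb r" for t r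
    by (simp add: w1_def \<kappa>_def powr_minus field_simps)
  show ?thesis
  proof (intro exI[of _ "4 * C * 3 powr \<kappa>"] conjI allI impI)
    fix G Gx K and t r :: real
    assume G: "cont2 G" and Gx: "cont2 Gx" and K: "0 \<le> K"
      and d: "\<forall>s\<ge>0. \<forall>\<rho>. (G s has_real_derivative Gx s \<rho>) (at \<rho>)"
      and odd: "\<forall>s\<ge>0. \<forall>\<rho>. G s (- \<rho>) = - G s \<rho>"
      and b: "v_source_bound K G" "v_source_bound K Gx"
      and t: "0 \<le> t" and r: "0 \<le> r"
    let ?N = "\<lambda>t r. Pp G t r + Pm G t r" and ?Nr = "\<lambda>t r. Pp Gx t r + Pm Gx t r"
    have dN: "(?N t has_real_derivative ?Nr t x) (at x)" for x
      using C1_deriv_r[OF C1_Pp[OF G Gx] t] C1_deriv_r[OF C1_Pm[OF G Gx] t] d by (intro DERIV_add) auto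
    have N0: "?N t 0 = 0" using Pp_minus[of G t 0] odd by simp
    have bN: "\<bar>?N t r\<bar> \<le> 2 * C * K * jb (t - r) powr (- \<kappa>)" by (rule bound[OF G K b(1) t r])
    have bNr: "\<bar>?Nr t x\<bar> \<le> 2 * C * K * jb (t - x) powr (- \<kappa>)" if "0 \<le> x" for x by (rule bound[OF Gx K b(2) t that])
    have c3: "1 \<le> 3 powr \<kappa>" using \<kappa> by (simp add: ge_one_powr_ge_zero)
    define J where "J = 2 * C * K * jb (t - r) powr (- \<kappa>)"
    have J: "0 \<le> J" using C K by (simp add: J_def)
    have "\<bar>quo ?N ?Nr t r\<bar> \<le> 2 * (3 powr \<kappa> * J) / jb r"
    proof -
      consider "r = 0" | "0 < r" "r \<le> 1" | "1 < r" using r by linarith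
      then show ?thesis
      proof cases
        case 1
        have "\<bar>?Nr t 0\<bar> \<le> J" using bNr[of 0] 1 by (simp add: J_def)
        also have "\<dots> \<le> 2 * (3 powr \<kappa> * J)" using c3 J mult_right_mono[OF c3 J] by linarith
        finally show ?thesis using 1 by (simp add: quo_def)
      next
        case 2
        obtain \<xi> where \<xi>: "0 < \<xi>" "\<xi> < r" "?N t r - ?N t 0 = (r - 0) * ?Nr t \<xi>"
          using MVT2[of 0 r "?N t" "?Nr t"] 2 dN by blast
        \<comment> \<open>The intermediate radius is within distance 1 of \<open>r\<close>, so
          moving to it changes the bracket by a factor of at most 3.\<close>
        have "jb (t - r) \<le> jb (t - \<xi>) + jb (\<xi> - r)" using jb_add[of "t - \<xi>" "\<xi> - r"] by simp
        also have "jb (\<xi> - r) \<le> 2" using jb_le[of "\<xi> - r"] \<xi> 2 by simp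
        finally have "jb (t - r) \<le> 3 * jb (t - \<xi>)" using jb_ge_1[of "t - \<xi>"] by linarith
        then have *: "jb (t - \<xi>) powr (- \<kappa>) \<le> 3 powr \<kappa> * jb (t - r) powr (- \<kappa>)"
          using \<kappa> by (intro powr_minus_scale) auto
        have "\<bar>quo ?N ?Nr t r\<bar> = \<bar>?Nr t \<xi>\<bar>" using \<xi> 2 N0 by (simp add: quo_def)
        also have "\<dots> \<le> 2 * C * K * (3 powr \<kappa> * jb (t - r) powr (- \<kappa>))"
          using order_trans[OF bNr[of \<xi>] mult_left_mono[OF *, of "2 * C * K"]] \<xi>(1) C K by simp
        also have "\<dots> = 3 powr \<kappa> * J" by (simp add: J_def)
        also have "\<dots> \<le> 2 * (3 powr \<kappa> * J) / jb r"
        proof -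
          have "jb r \<le> 2" using jb_le[of r] 2 by simp
          then have "3 powr \<kappa> * J * jb r \<le> 3 powr \<kappa> * J * 2" using J by (intro mult_left_mono) auto
          then show ?thesis by (simp add: pos_le_divide_eq mult_ac)
        qed
        finally show ?thesis .
      next
        case 3
        have "\<bar>quo ?N ?Nr t r\<bar> = \<bar>?N t r\<bar> / r" using 3 by (simp add: quo_def)
        also have "\<dots> \<le> J / r" using bN 3 by (intro divide_right_mono) (auto simp: J_def)
        also have "\<dots> \<le> J / (jb r / 2)"
          using J 3 jb_le[of r] by (intro divide_left_mono) auto
        also have "\<dots> = 2 * J / jb r" by simp
        also have "\<dots> \<le> 2 * (3 powr \<kappa> * J) / jb r"
          using mult_right_mono[OF c3 J] by (intro divide_right_mono) auto
        finally show ?thesis .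
      qed
    qed
    also have "\<dots> = 4 * C * 3 powr \<kappa> * K * (jb (t - r) powr (- \<kappa>) / jb r)"
      by (simp add: J_def mult_ac)
    also have "\<dots> = 4 * C * 3 powr \<kappa> * K / W1 t r"
      unfolding w1[symmetric] by simp
    finally show "\<bar>quo ?N ?Nr t r\<bar> \<le> 4 * C * 3 powr \<kappa> * K / W1 t r" .
  qed (use C in auto)
qed

end

context exponents
begin

text \<open>The size of \<open>\<rho> * \<bar>w\<bar> powr p\<close>: the \<open>p\<close>-th power
  of \<open>W1\<close> is \<open>jb \<rho> powr p * jb (s - \<rho>) powr \<mu>\<close>, and the
  factor \<open>\<rho>\<close> uses up one power of the first bracket.\<close>

definition w_source_bound :: "real \<Rightarrow> field2 \<Rightarrow> bool" where
  "w_source_bound K G \<longleftrightarrow> (\<forall>s\<ge>0. \<forall>\<rho>. \<bar>G s \<rho>\<bar> \<le> K * (jb \<rho> powr (- (p - 1)) * jb (s - \<bar>\<rho>\<bar>) powr (- \<mu>)))"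

text \<open>Sharper than \<open>characteristic_integrals_bound\<close> by a power of
  \<open>jb r\<close>, which the integration along the outgoing line will use. Put
  \<open>x = t + r\<close>; at time \<open>s\<close> the radius is \<open>x - s\<close>. Either this
  radius exceeds \<open>x / 4\<close>, or \<open>2 * s - x\<close> is comparable with
  \<open>x\<close>, so one of the two factors can be frozen at \<open>x\<close>. What remains is a
  tail integral, which stops at radius \<open>r\<close> and produces the gain, and a head
  integral.\<close>

lemma Pp_bound:
  "\<exists>C>0. \<forall>G K t r. cont2 G \<longrightarrow> 0 \<le> K \<longrightarrow>
    w_source_bound K G \<longrightarrow> 0 \<le> t \<longrightarrow> 0 \<le> r \<longrightarrow>
    \<bar>Pp G t r\<bar> \<le> C * K * (jb r powr (- (p - 2)) * jb (t + r) powr (- \<mu>))"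
proof -
  define a where "a = p - 1"
  have a: "1 < a" "a < 2" "\<mu> \<le> a" using p2 p3 mu1 by (auto simp: a_def)
  obtain Ct where Ct: "Ct > 0" and tail: "\<And>x m. 0 \<le> m \<Longrightarrow> m \<le> x \<Longrightarrow>
    integral {0..m} (\<lambda>s. jb (x - s) powr (- a)) \<le> Ct * jb (x - m) powr (1 - a)"
    using integral_jb_powr_tail[OF a(1)] by blast
  define c where "c = 4 powr a"
  have c: "c > 0" by (simp add: c_def)
  show ?thesis
  proof (intro exI[of _ "c * (Ct + 1 / (1 - \<mu>))"] conjI allI impI)
    fix G K and t r :: real
    assume G: "cont2 G" and K: "0 \<le> K" and t: "0 \<le> t" and r: "0 \<le> r"
      and b: "w_source_bound K G"
    define x where "x = t + r"
    define i1 i2 where "i1 = integral {0..t} (\<lambda>s. jb (x - s) powr (- a))"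
      and "i2 = integral {0..t} (\<lambda>s. jb (2 * s + (- x)) powr (- \<mu>))"
    have "\<bar>Pp G t r\<bar> \<le> integral {0..t} (\<lambda>s. K * (c * (jb x powr (- \<mu>) * jb (x - s) powr (- a) + jb x powr (- a) * jb (2 * s + (- x)) powr (- \<mu>))))"
      unfolding Pp_def
    proof (rule integral_norm_le)
      fix s assume s: "s \<in> {0..t}"
      have \<rho>: "\<bar>r + t - s\<bar> = x - s" "s - \<bar>r + t - s\<bar> = 2 * s + (- x)" "r + t - s = x - s" using s r by (auto simp: x_def)
      have "\<bar>G s (r + t - s)\<bar> \<le> K * (jb (x - s) powr (- a) * jb (2 * s + (- x)) powr (- \<mu>))"
        using b[unfolded w_source_bound_def, rule_format, of s "r + t - s"] s unfolding \<rho>(2) unfolding \<rho>(3) a_def by auto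
      also have "jb (x - s) powr (- a) * jb (2 * s + (- x)) powr (- \<mu>) \<le>
        c * (jb x powr (- \<mu>) * jb (x - s) powr (- a) + jb x powr (- a) * jb (2 * s + (- x)) powr (- \<mu>))"
      proof (cases "x - s \<le> x / 4")
        case True
        have "jb x \<le> 4 * jb (2 * s + (- x))" using True s t r by (intro jb_scale) (auto simp: x_def)
        then have "jb (2 * s + (- x)) powr (- \<mu>) \<le> 4 powr \<mu> * jb x powr (- \<mu>)"
          using mu_pos by (intro powr_minus_scale) auto
        also have "\<dots> \<le> c * jb x powr (- \<mu>)" using a unfolding c_def by (intro mult_right_mono powr_mono) auto
        finally have "jb (x - s) powr (- a) * jb (2 * s + (- x)) powr (- \<mu>) \<le> jb (x - s) powr (- a) * (c * jb x powr (- \<mu>))"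
          by (intro mult_left_mono) auto
        moreover have "\<dots> = c * (jb x powr (- \<mu>) * jb (x - s) powr (- a))" by simp
        moreover have "0 \<le> c * (jb x powr (- a) * jb (2 * s + (- x)) powr (- \<mu>))" using c by simp
        ultimately show ?thesis unfolding distrib_left by linarith
      next
        case False
        have "jb x \<le> 4 * jb (x - s)" using False s t r by (intro jb_scale) (auto simp: x_def)
        then have "jb (x - s) powr (- a) \<le> c * jb x powr (- a)"
          using a unfolding c_def by (intro powr_minus_scale) auto
        then have "jb (x - s) powr (- a) * jb (2 * s + (- x)) powr (- \<mu>) \<le> (c * jb x powr (- a)) * jb (2 * s + (- x)) powr (- \<mu>)"
          by (intro mult_right_mono) auto
        moreover have "\<dots> = c * (jb x powr (- a) * jb (2 * s + (- x)) powr (- \<mu>))" by simp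
        moreover have "0 \<le> c * (jb x powr (- \<mu>) * jb (x - s) powr (- a))" using c by simp
        ultimately show ?thesis unfolding distrib_left by linarith
      qed
      finally show "\<bar>G s (r + t - s)\<bar> \<le> K * (c * (jb x powr (- \<mu>) * jb (x - s) powr (- a) + jb x powr (- a) * jb (2 * s + (- x)) powr (- \<mu>)))"
        using K by (simp add: mult_left_mono)
    qed (auto intro!: continuous_intros cont2_compose[OF G])
    also have "\<dots> = K * (c * (jb x powr (- \<mu>) * i1 + jb x powr (- a) * i2))"
    proof -
      have "(\<lambda>s. jb x powr (- \<mu>) * jb (x - s) powr (- a)) integrable_on {0..t}"
        "(\<lambda>s. jb x powr (- a) * jb (2 * s + (- x)) powr (- \<mu>)) integrable_on {0..t}"
        by (intro integrable_continuous_real continuous_intros)+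
      from integral_add[OF this] show ?thesis by (simp add: i1_def i2_def)
    qed
    also have "\<dots> \<le> K * (c * (jb x powr (- \<mu>) * (Ct * jb r powr (1 - a)) + jb r powr (1 - a) * jb x powr (- \<mu>) / (1 - \<mu>)))"
    proof (intro mult_left_mono add_mono)
      show "i1 \<le> Ct * jb r powr (1 - a)" using tail[of t x] t r by (simp add: i1_def x_def)
      have "i2 \<le> ((2 * t + (- x)) * jb (2 * t + (- x)) powr (- \<mu>) - (2 * 0 + (- x)) * jb (2 * 0 + (- x)) powr (- \<mu>)) / (2 * (1 - \<mu>))"
        unfolding i2_def by (rule integral_jb_powr_head) (use mu_pos mu1 t in auto)
      also have "\<dots> \<le> (jb x powr (1 - \<mu>) + jb x powr (1 - \<mu>)) / (2 * (1 - \<mu>))"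
      proof (rule divide_right_mono)
        have "(2 * t + (- x)) * jb (2 * t + (- x)) powr (- \<mu>) \<le> jb (2 * t + (- x)) powr (1 - \<mu>)" by (rule mult_jb_powr_le)
        also have "\<dots> \<le> jb x powr (1 - \<mu>)" using t r mu1 by (intro powr_mono2 jb_mono) (auto simp: x_def)
        finally show "(2 * t + (- x)) * jb (2 * t + (- x)) powr (- \<mu>) - (2 * 0 + (- x)) * jb (2 * 0 + (- x)) powr (- \<mu>) \<le> jb x powr (1 - \<mu>) + jb x powr (1 - \<mu>)"
          using mult_jb_powr_le[of x \<mu>] by simp
      qed (use mu1 in auto)
      also have "\<dots> = jb x powr (1 - \<mu>) / (1 - \<mu>)" using mu1 by (simp add: field_simps)
      finally have "jb x powr (- a) * i2 \<le> jb x powr (- a) * (jb x powr (1 - \<mu>) / (1 - \<mu>))" by (intro mult_left_mono) auto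
      also have "\<dots> = jb x powr (1 - a) * jb x powr (- \<mu>) / (1 - \<mu>)"
      proof -
        have "- a + (1 - \<mu>) = (1 - a) + (- \<mu>)" by simp
        then have "jb x powr (- a) * jb x powr (1 - \<mu>) = jb x powr (1 - a) * jb x powr (- \<mu>)"
          by (simp only: powr_add[symmetric])
        then show ?thesis by simp
      qed
      also have "\<dots> \<le> jb r powr (1 - a) * jb x powr (- \<mu>) / (1 - \<mu>)"
        using a t r mu1 by (intro divide_right_mono mult_right_mono powr_mono2' jb_mono) (auto simp: x_def)
      finally show "jb x powr (- a) * i2 \<le> jb r powr (1 - a) * jb x powr (- \<mu>) / (1 - \<mu>)" .
    qed (use K c in auto)
    also have "\<dots> = c * (Ct + 1 / (1 - \<mu>)) * K * (jb r powr (1 - a) * jb x powr (- \<mu>))"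
      by (simp add: algebra_simps)
    finally show "\<bar>Pp G t r\<bar> \<le> c * (Ct + 1 / (1 - \<mu>)) * K * (jb r powr (- (p - 2)) * jb (t + r) powr (- \<mu>))"
      by (simp add: a_def x_def)
  next
    show "0 < c * (Ct + 1 / (1 - \<mu>))" using c Ct mu1 by (simp add: add_pos_pos)
  qed
qed

text \<open>This is the bound of \<open>Pp_bound\<close> integrated back along the outgoing line.
  For \<open>r < t / 2\<close> the second bracket is comparable with \<open>jb (t + r)\<close>
  throughout. For \<open>r \<ge> t / 2\<close> and \<open>r > 1\<close> the line is cut where
  \<open>r - \<tau>\<close> equals \<open>\<bar>t - r\<bar>\<close>: before the cut both brackets
  are measured by \<open>r - \<tau>\<close>, with total exponent above 1 because
  \<open>\<mu> > 3 - p\<close>; after it the second is measured by \<open>t - r\<close>.\<close>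

lemma integral_weight_bound:
  "\<exists>C>0. \<forall>t r. 0 \<le> t \<longrightarrow> 0 \<le> r \<longrightarrow>
    integral {0..min t r} (\<lambda>\<tau>. jb (r - \<tau>) powr (- (p - 2)) * jb (t + r - 2 * \<tau>) powr (- \<mu>)) \<le> C * r / W2 t r"
proof -
  define e where "e = p - 2"
  have e: "0 < e" "e < 1" "1 < e + \<mu>" using p2 p3 mu_gt by (auto simp: e_def)
  obtain Ct where Ct: "Ct > 0" and tail: "\<And>x m. 0 \<le> m \<Longrightarrow> m \<le> x \<Longrightarrow>
    integral {0..m} (\<lambda>s. jb (x - s) powr (- (e + \<mu>))) \<le> Ct * jb (x - m) powr (1 - (e + \<mu>))"
    using integral_jb_powr_tail[OF e(3)] by blast
  have head: "integral {l..m} (\<lambda>s. jb (x - s) powr (- e)) \<le> (x - l) * jb (x - l) powr (- e) / (1 - e)"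
    if "l \<le> m" "m \<le> x" for l m x
  proof -
    have "integral {l..m} (\<lambda>s. jb (- 1 * s + x) powr (- e)) \<le>
      ((- 1 * m + x) * jb (- 1 * m + x) powr (- e) - (- 1 * l + x) * jb (- 1 * l + x) powr (- e)) / (- 1 * (1 - e))"
      by (rule integral_jb_powr_head) (use e that in auto)
    also have "\<dots> = ((x - l) * jb (x - l) powr (- e) - (x - m) * jb (x - m) powr (- e)) / (1 - e)"
      using e by (simp add: divide_simps) (simp add: algebra_simps)
    also have "\<dots> \<le> (x - l) * jb (x - l) powr (- e) / (1 - e)"
      using e that by (intro divide_right_mono) auto
    finally show ?thesis by simp
  qed
  \<comment> \<open>One entry per case: \<open>r < t / 2\<close>; then \<open>r \<le> 1\<close>,
    where both factors of \<open>W2\<close> are at most 4; then the line that is cut in two.\<close>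
  define C where "C = max (3 powr \<mu> / (1 - e)) (max 16 (4 * (Ct + 1 / (1 - e))))"
  show ?thesis
  proof (intro exI[of _ C] conjI allI impI)
    fix t r :: real assume t: "0 \<le> t" and r: "0 \<le> r"
    define m where "m = min t r"
    define I where "I = integral {0..m} (\<lambda>\<tau>. jb (r - \<tau>) powr (- e) * jb (t + r - 2 * \<tau>) powr (- \<mu>))"
    have m: "0 \<le> m" "m \<le> t" "m \<le> r" using t r by (auto simp: m_def)
    have int: "(\<lambda>\<tau>. jb (r - \<tau>) powr (- e) * jb (t + r - 2 * \<tau>) powr (- \<mu>)) integrable_on {l..u}" for l u
      by (intro integrable_continuous_real continuous_intros)
    have inte: "(\<lambda>\<tau>. jb (r - \<tau>) powr (- e)) integrable_on {l..u}" for l u e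
      by (intro integrable_continuous_real continuous_intros)
    have "I \<le> C * r / W2 t r"
    proof (cases "r < t / 2")
      case True
      then have mr: "m = r" using r by (simp add: m_def)
      have "I \<le> integral {0..r} (\<lambda>\<tau>. (3 powr \<mu> * jb (t + r) powr (- \<mu>)) * jb (r - \<tau>) powr (- e))"
        unfolding I_def mr
      proof (rule integral_le[OF int])
        fix \<tau> assume \<tau>: "\<tau> \<in> {0..r}"
        have "jb (t + r) \<le> 3 * jb (t + r - 2 * \<tau>)" using True \<tau> t by (intro jb_scale) auto
        then have "jb (t + r - 2 * \<tau>) powr (- \<mu>) \<le> 3 powr \<mu> * jb (t + r) powr (- \<mu>)"
          using mu_pos by (intro powr_minus_scale) auto
        then show "jb (r - \<tau>) powr (- e) * jb (t + r - 2 * \<tau>) powr (- \<mu>) \<le> (3 powr \<mu> * jb (t + r) powr (- \<mu>)) * jb (r - \<tau>) powr (- e)"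
          by (subst mult.commute) (intro mult_right_mono, auto)
      qed (intro integrable_continuous_real continuous_intros)
      also have "\<dots> = (3 powr \<mu> * jb (t + r) powr (- \<mu>)) * integral {0..r} (\<lambda>\<tau>. jb (r - \<tau>) powr (- e))"
        by simp
      also have "\<dots> \<le> (3 powr \<mu> * jb (t + r) powr (- \<mu>)) * ((r - 0) * jb (r - 0) powr (- e) / (1 - e))"
        using head[of 0 r r] r by (intro mult_left_mono) auto
      also have "\<dots> = 3 powr \<mu> / (1 - e) * (r / W2 t r)"
      proof -
        have "W2 t r = jb r powr e * jb (t + r) powr \<mu>" using True by (simp add: w2_def e_def)
        then show ?thesis by (simp add: powr_minus_divide)
      qed
      also have "\<dots> \<le> C * (r / W2 t r)"
        using r w2_pos[of t r] by (intro mult_right_mono) (auto simp: C_def)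
      finally show ?thesis by simp
    next
      case False
      define B where "B = jb (t - r)"
      have w2: "W2 t r = B powr (e + \<mu> - 1) * jb (t + r)" 
      proof -
        have "p - 3 + \<mu> = e + \<mu> - 1" by (simp add: e_def)
        then show ?thesis using False unfolding w2_def B_def by (simp only: if_False)
      qed
      show ?thesis
      proof (cases "r \<le> 1")
        case True
        have "I \<le> integral {0..m} (\<lambda>\<tau>. 1)"
          unfolding I_def
        proof (rule integral_le[OF int])
          fix \<tau>
          have "jb (r - \<tau>) powr (- e) \<le> 1" "jb (t + r - 2 * \<tau>) powr (- \<mu>) \<le> 1"
            using e mu_pos powr_mono[of "- e" 0 "jb (r - \<tau>)"] powr_mono[of "- \<mu>" 0 "jb (t + r - 2 * \<tau>)"] jb_ge_1 by auto
          then show "jb (r - \<tau>) powr (- e) * jb (t + r - 2 * \<tau>) powr (- \<mu>) \<le> 1" by (intro mult_le_one) auto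
        qed auto
        also have "\<dots> \<le> r" using m by simp
        also have "\<dots> \<le> 16 * r / W2 t r"
        proof -
          have 4: "jb (t + r) \<le> 4" using jb_le[of "t + r"] False True t r by simp
          have "\<bar>t - r\<bar> \<le> \<bar>t + r\<bar>" using t r by linarith
          from jb_mono[OF this] have "B \<le> 4" using 4 by (simp add: B_def)
          then have "B powr (e + \<mu> - 1) \<le> 4 powr (e + \<mu> - 1)" using e by (intro powr_mono2) (auto simp: B_def)
          also have "\<dots> \<le> 4 powr 1" using e mu1 by (intro powr_mono) auto
          finally have "W2 t r \<le> 4 * 4" unfolding w2 using 4 by (intro mult_mono) auto
          then have "r * W2 t r \<le> r * 16" using r by (intro mult_left_mono) auto
          then show ?thesis using w2_pos[of t r] by (simp add: pos_le_divide_eq mult_ac)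
        qed
        also have "\<dots> \<le> C * r / W2 t r"
          using r w2_pos[of t r] by (intro divide_right_mono mult_right_mono) (auto simp: C_def)
        finally show ?thesis .
      next
        case big: False
        define \<beta> where "\<beta> = \<bar>t - r\<bar>"
        have B\<beta>: "jb \<beta> = B" by (simp add: B_def \<beta>_def)
        \<comment> \<open>If \<open>t < r\<close>, the cut is the endpoint \<open>\<tau> = t\<close>
          and the second piece degenerates to a point.\<close>
        define c where "c = r - \<beta>"
        have c: "0 \<le> c" "c \<le> m" using False t r by (auto simp: c_def \<beta>_def m_def)
        have "I = integral {0..c} (\<lambda>\<tau>. jb (r - \<tau>) powr (- e) * jb (t + r - 2 * \<tau>) powr (- \<mu>))
          + integral {c..m} (\<lambda>\<tau>. jb (r - \<tau>) powr (- e) * jb (t + r - 2 * \<tau>) powr (- \<mu>))"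
          unfolding I_def by (rule Henstock_Kurzweil_Integration.integral_combine[symmetric]) (use c int in auto)
        also have "\<dots> \<le> integral {0..c} (\<lambda>\<tau>. jb (r - \<tau>) powr (- (e + \<mu>))) + integral {c..m} (\<lambda>\<tau>. B powr (- \<mu>) * jb (r - \<tau>) powr (- e))"
        proof (intro add_mono integral_le int)
          fix \<tau> assume \<tau>: "\<tau> \<in> {0..c}"
          have "jb (t + r - 2 * \<tau>) powr (- \<mu>) \<le> jb (r - \<tau>) powr (- \<mu>)"
            using \<tau> c m mu_pos by (intro jb_powr_antimono) auto
          then have "jb (r - \<tau>) powr (- e) * jb (t + r - 2 * \<tau>) powr (- \<mu>) \<le> jb (r - \<tau>) powr (- e) * jb (r - \<tau>) powr (- \<mu>)"
            by (intro mult_left_mono) auto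
          then show "jb (r - \<tau>) powr (- e) * jb (t + r - 2 * \<tau>) powr (- \<mu>) \<le> jb (r - \<tau>) powr (- (e + \<mu>))"
            by (simp add: powr_add[symmetric])
        next
          fix \<tau> assume \<tau>: "\<tau> \<in> {c..m}"
          have "jb (t + r - 2 * \<tau>) powr (- \<mu>) \<le> jb (t - r) powr (- \<mu>)"
            using \<tau> mu_pos by (intro jb_powr_antimono) (auto simp: m_def)
          then show "jb (r - \<tau>) powr (- e) * jb (t + r - 2 * \<tau>) powr (- \<mu>) \<le> B powr (- \<mu>) * jb (r - \<tau>) powr (- e)"
            unfolding B_def by (subst mult.commute) (intro mult_right_mono, auto)
        qed (auto intro!: integrable_continuous_real continuous_intros)
        also have "\<dots> \<le> Ct * jb (r - c) powr (1 - (e + \<mu>)) + B powr (- \<mu>) * ((r - c) * jb (r - c) powr (- e) / (1 - e))"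
          unfolding integral_mult_right
          by (intro add_mono mult_left_mono tail head) (use c m in auto)
        also have "\<dots> = Ct * B powr (1 - (e + \<mu>)) + B powr (- \<mu>) * (\<beta> * jb \<beta> powr (- e) / (1 - e))"
          by (simp add: c_def B\<beta>)
        also have "\<dots> \<le> Ct * B powr (1 - (e + \<mu>)) + B powr (- \<mu>) * (B powr (1 - e) / (1 - e))"
          using mult_jb_powr_le[of \<beta> e] e Ct by (intro add_mono mult_left_mono divide_right_mono) (auto simp: B\<beta>)
        also have "\<dots> = (Ct + 1 / (1 - e)) * B powr (1 - (e + \<mu>))"
        proof -
          have "- \<mu> + (1 - e) = 1 - (e + \<mu>)" by simp
          then have "B powr (- \<mu>) * B powr (1 - e) = B powr (1 - (e + \<mu>))"
            by (simp only: powr_add[symmetric])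
          then show ?thesis by (simp add: distrib_right)
        qed
        also have "\<dots> \<le> (4 * (Ct + 1 / (1 - e))) * r * B powr (1 - (e + \<mu>)) / jb (t + r)"
        proof -
          have "jb (t + r) \<le> 4 * r" using jb_le[of "t + r"] False big t r by simp
          then have "(Ct + 1 / (1 - e)) * B powr (1 - (e + \<mu>)) * jb (t + r) \<le> (Ct + 1 / (1 - e)) * B powr (1 - (e + \<mu>)) * (4 * r)"
            using Ct e by (intro mult_left_mono) auto
          then show ?thesis unfolding pos_le_divide_eq[OF jb_pos] by (simp only: mult_ac)
        qed
        also have "\<dots> = (4 * (Ct + 1 / (1 - e))) * (r / W2 t r)"
        proof -
          have "B powr (1 - (e + \<mu>)) = 1 / B powr (e + \<mu> - 1)"
            using powr_minus_divide[of B "e + \<mu> - 1"] by (simp add: algebra_simps)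
          then show ?thesis unfolding w2 by simp
        qed
        also have "\<dots> \<le> C * (r / W2 t r)"
          using r w2_pos[of t r] by (intro mult_right_mono) (auto simp: C_def)
        finally show ?thesis by simp
      qed
    qed
    then show "integral {0..min t r} (\<lambda>\<tau>. jb (r - \<tau>) powr (- (p - 2)) * jb (t + r - 2 * \<tau>) powr (- \<mu>)) \<le> C * r / W2 t r"
      by (simp add: I_def m_def e_def)
  qed (simp add: C_def)
qed

text \<open>For the radial derivative the decay of the characteristic integrals in
  \<open>t - r\<close> is enough. The quotient must gain a full \<open>1 / W2\<close> from the
  division by \<open>r\<close>, which is what \<open>Dop_eq_integral_Pp\<close> with the sharper
  \<open>Pp_bound\<close> provides. On the axis the two weights agree.\<close>

lemma Dop_bound:
  "\<exists>C>0. \<forall>G K. cont2 G \<longrightarrow> 0 \<le> K \<longrightarrow> (\<forall>s\<ge>0. \<forall>\<rho>. G s (- \<rho>) = - G s \<rho>) \<longrightarrow>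
    w_source_bound K G \<longrightarrow>
    (\<forall>t\<ge>0. \<forall>r\<ge>0. \<bar>Pp G t r - Pm G t r\<bar> \<le> C * K / W3 t r \<and>
       \<bar>quo (Dop G) (\<lambda>t r. Pp G t r - Pm G t r) t r\<bar> \<le> C * K / W2 t r)"
proof -
  have p1: "1 < p - 1" using p2 by simp
  obtain A where A: "A > 0" and AB: "\<And>G K \<kappa>. cont2 G \<Longrightarrow> 0 \<le> K \<Longrightarrow> char_dominated (p - 1) \<kappa> K G \<Longrightarrow>
    (\<forall>t\<ge>0. \<forall>r\<ge>0. \<bar>Pp G t r\<bar> \<le> A * K * jb (t + r) powr (- \<kappa>) \<and> \<bar>Pm G t r\<bar> \<le> A * K * jb (t - r) powr (- \<kappa>))"
    using characteristic_integrals_bound[OF p1] by blast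
  obtain D where D: "D > 0" and DB: "\<And>G K t r. cont2 G \<Longrightarrow> 0 \<le> K \<Longrightarrow>
    w_source_bound K G \<Longrightarrow> 0 \<le> t \<Longrightarrow> 0 \<le> r \<Longrightarrow>
    \<bar>Pp G t r\<bar> \<le> D * K * (jb r powr (- (p - 2)) * jb (t + r) powr (- \<mu>))"
    using Pp_bound by metis
  obtain E where E: "E > 0" and EB: "\<And>t r. 0 \<le> t \<Longrightarrow> 0 \<le> r \<Longrightarrow>
    integral {0..min t r} (\<lambda>\<tau>. jb (r - \<tau>) powr (- (p - 2)) * jb (t + r - 2 * \<tau>) powr (- \<mu>)) \<le> E * r / W2 t r"
    using integral_weight_bound by blast
  define C where "C = 2 * (A * 3 powr \<mu>) + 2 * (D * E)"
  show ?thesis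
  proof (intro exI[of _ C] conjI allI impI)
    show "C > 0" using A D E by (simp add: C_def add_pos_pos)
    fix G K and t r :: real
    assume G: "cont2 G" and K: "0 \<le> K" and t: "0 \<le> t" and r: "0 \<le> r"
      and odd: "\<forall>s\<ge>0. \<forall>\<rho>. G s (- \<rho>) = - G s \<rho>"
      and b: "w_source_bound K G"
    have dom: "char_dominated (p - 1) \<mu> (K * 3 powr \<mu>) G"
      unfolding char_dominated_def
    proof (intro allI impI conjI)
      fix s \<rho> :: real assume s: "0 \<le> s"
      have bs: "\<bar>G s \<rho>\<bar> \<le> K * (jb \<rho> powr (- (p - 1)) * jb (s - \<bar>\<rho>\<bar>) powr (- \<mu>))" using b s by (simp add: w_source_bound_def)
      \<comment> \<open>Brings \<open>young_type\<close> into play, with the brackets of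
        \<open>\<rho>\<close>, \<open>s - \<bar>\<rho>\<bar>\<close> and
        \<open>s + \<bar>\<rho>\<bar>\<close> as \<open>X\<close>, \<open>Y\<close> and
        \<open>Z\<close>.\<close>
      have "jb (s + \<bar>\<rho>\<bar>) \<le> jb (s - \<bar>\<rho>\<bar>) + 2 * jb \<rho>"
        using jb_add[of "s - \<bar>\<rho>\<bar>" "2 * \<bar>\<rho>\<bar>"] jb_scale[of "2 * \<bar>\<rho>\<bar>" 2 \<rho>] by (simp add: algebra_simps)
      from young_type[OF jb_ge_1 jb_ge_1 jb_ge_1 this, of \<mu> "p - 1"]
      have "jb \<rho> powr (- (p - 1)) * jb (s - \<bar>\<rho>\<bar>) powr (- \<mu>) \<le>
        3 powr \<mu> * (jb (s + \<bar>\<rho>\<bar>) powr (- \<mu>) * (jb \<rho> powr (- (p - 1)) + jb (s - \<bar>\<rho>\<bar>) powr (- (p - 1))))"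
        using mu_pos mu1 p2 by auto
      from mult_left_mono[OF this K] bs
      show "\<bar>G s \<rho>\<bar> \<le> K * 3 powr \<mu> * (jb (s + \<bar>\<rho>\<bar>) powr (- \<mu>) * (jb \<rho> powr (- (p - 1)) + jb (s - \<bar>\<rho>\<bar>) powr (- (p - 1))))"
        by (simp add: mult_ac)
      have "1 \<le> 3 powr \<mu>" using mu_pos by (simp add: ge_one_powr_ge_zero)
      then have "K * 1 \<le> K * 3 powr \<mu>" using K by (intro mult_left_mono)
      then have "K * (jb \<rho> powr (- (p - 1)) * jb (s - \<bar>\<rho>\<bar>) powr (- \<mu>)) \<le> K * 3 powr \<mu> * (jb \<rho> powr (- (p - 1)) * jb (s - \<bar>\<rho>\<bar>) powr (- \<mu>))"
        by (intro mult_right_mono) auto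
      with bs show "\<bar>G s \<rho>\<bar> \<le> K * 3 powr \<mu> * (jb (s - \<bar>\<rho>\<bar>) powr (- \<mu>) * jb \<rho> powr (- (p - 1)))"
        by (simp add: mult_ac)
    qed
    have K3: "0 \<le> K * 3 powr \<mu>" using K by simp
    have P: "\<bar>Pp G t r\<bar> \<le> A * (K * 3 powr \<mu>) * jb (t + r) powr (- \<mu>)" "\<bar>Pm G t r\<bar> \<le> A * (K * 3 powr \<mu>) * jb (t - r) powr (- \<mu>)"
      using AB[OF G K3 dom] t r by auto
    have "A * (K * 3 powr \<mu>) * jb (t + r) powr (- \<mu>) \<le> A * (K * 3 powr \<mu>) * jb (t - r) powr (- \<mu>)"
      using A K3 t r mu_pos by (intro mult_left_mono jb_powr_antimono) auto
    with P have "\<bar>Pp G t r - Pm G t r\<bar> \<le> 2 * (A * 3 powr \<mu>) * (K * jb (t - r) powr (- \<mu>))"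
      by (simp add: mult_ac)
    also have "\<dots> \<le> C * (K * jb (t - r) powr (- \<mu>))"
      using K D E by (intro mult_right_mono) (auto simp: C_def)
    also have "\<dots> = C * K / W3 t r" by (simp add: w3_def powr_minus divide_inverse)
    finally show 1: "\<bar>Pp G t r - Pm G t r\<bar> \<le> C * K / W3 t r" .
    show "\<bar>quo (Dop G) (\<lambda>t r. Pp G t r - Pm G t r) t r\<bar> \<le> C * K / W2 t r"
    proof (cases "r = 0")
      case True
      then show ?thesis using 1 t by (simp add: quo_def w2_0)
    next
      case False
      have "\<bar>integral {0..min t r} (\<lambda>\<tau>. Pp G (t - \<tau>) (r - \<tau>))\<bar> \<le> integral {0..min t r} (\<lambda>\<tau>. D * K * (jb (r - \<tau>) powr (- (p - 2)) * jb (t + r - 2 * \<tau>) powr (- \<mu>)))"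
      proof (rule integral_norm_le)
        fix \<tau> assume \<tau>: "\<tau> \<in> {0..min t r}"
        have "t + r - 2 * \<tau> = (t - \<tau>) + (r - \<tau>)" by simp
        then show "\<bar>Pp G (t - \<tau>) (r - \<tau>)\<bar> \<le> D * K * (jb (r - \<tau>) powr (- (p - 2)) * jb (t + r - 2 * \<tau>) powr (- \<mu>))"
          using DB[OF G K b, of "t - \<tau>" "r - \<tau>"] \<tau> by (metis atLeastAtMost_iff diff_ge_0_iff_ge min.bounded_iff)
      qed (auto intro!: continuous_intros cont2_compose[OF cont2_Pp[OF G]])
      also have "\<dots> \<le> D * K * (E * r / W2 t r)"
        using D K mult_left_mono[OF EB[OF t r], of "D * K"] by simp
      finally have "\<bar>Dop G t r\<bar> \<le> 2 * (D * K * (E * r / W2 t r))"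
        using Dop_eq_integral_Pp[OF G _ t r] odd by simp
      then have "\<bar>Dop G t r\<bar> / r \<le> 2 * (D * K * (E * r / W2 t r)) / r"
        using r by (intro divide_right_mono)
      also have "\<dots> = (2 * (D * E)) * K / W2 t r" using False by simp
      also have "\<dots> \<le> C * K / W2 t r"
        using K A w2_pos[of t r] by (intro divide_right_mono mult_right_mono) (auto simp: C_def)
      finally show ?thesis using False r by (simp add: quo_def)
    qed
  qed
qed

end

section \<open>Free waves and the power nonlinearity\<close>

definition free_minus :: "(real \<Rightarrow> real) \<Rightarrow> real \<Rightarrow> real \<Rightarrow> real" where
  "free_minus A t r = A (t + r) - A (t - r)"

definition free_plus :: "(real \<Rightarrow> real) \<Rightarrow> real \<Rightarrow> real \<Rightarrow> real" where
  "free_plus A t r = A (t + r) + A (t - r)"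

definition free_profile :: "(real \<Rightarrow> real) \<Rightarrow> (real \<Rightarrow> real) \<Rightarrow> (real \<Rightarrow> real) \<Rightarrow> real \<Rightarrow> bool" where
  "free_profile A A1 A2 R \<longleftrightarrow> (\<forall>x. (A has_real_derivative A1 x) (at x)) \<and> (\<forall>x. (A1 has_real_derivative A2 x) (at x)) \<and>
     continuous_on UNIV A2 \<and> 0 < R \<and> (\<forall>x. R \<le> \<bar>x\<bar> \<longrightarrow> A x = A R \<and> A1 x = 0 \<and> A2 x = 0)"

text \<open>The profile is \<open>A(x) = (x f(x) + \<integral>\<^sub>0\<^sup>x \<rho> g(\<rho>) d\<rho>) / 2\<close>. It takes the same constant value on both sides
  of the support because \<open>\<rho> g(\<rho>)\<close> is odd; hence the free solution vanishes away from the light cone.\<close>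

lemma U0_free_profile:
  assumes f: "C02 f" "even_fun f" and g: "C01 g" "even_fun g"
  shows "\<exists>A A1 A2 R. free_profile A A1 A2 R \<and> (\<forall>t\<ge>0. \<forall>r. r \<noteq> 0 \<longrightarrow> U0 f g t r = free_minus A t r / r)"
proof -
  obtain f' f'' where f': "\<And>x. (f has_real_derivative f' x) (at x)" "\<And>x. (f' has_real_derivative f'' x) (at x)"
    "continuous_on UNIV f''" and fb: "bounded {x. f x \<noteq> 0}"
    using f(1) unfolding C02_def by blast
  obtain g' where g': "\<And>x. (g has_real_derivative g' x) (at x)" "continuous_on UNIV g'" and gb: "bounded {x. g x \<noteq> 0}"
    using g(1) unfolding C01_def by blast
  obtain R1 R2 where R1: "\<And>x. f x \<noteq> 0 \<Longrightarrow> \<bar>x\<bar> \<le> R1" and R2: "\<And>x. g x \<noteq> 0 \<Longrightarrow> \<bar>x\<bar> \<le> R2"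
    using fb gb unfolding bounded_iff by auto
  \<comment> \<open>The extra 1 makes \<open>f\<close> and \<open>g\<close> vanish on an open set
    containing all \<open>x\<close> with \<open>\<bar>x\<bar> \<ge> R\<close>, so that their
    derivatives vanish there too.\<close>
  define R where "R = max 1 (max R1 R2 + 1)"
  have R: "0 < R" by (simp add: R_def)
  have open_zero: "h' x = 0" if "\<And>x. (h has_real_derivative h' x) (at x)" "\<And>x. R - 1 < \<bar>x\<bar> \<Longrightarrow> h x = 0" "R - 1 < \<bar>x\<bar>"
    for h h' :: "real \<Rightarrow> real" and x
  proof -
    have o: "open {x::real. R - 1 < \<bar>x\<bar>}" by (intro open_Collect_less continuous_intros)
    have "(h has_real_derivative 0) (at x)"
      by (rule has_field_derivative_transform_within_open[OF DERIV_const o, of x 0 h]) (use that in auto)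
    then show ?thesis using that(1) DERIV_unique by blast
  qed
  have z: "f x = 0" "g x = 0" if "R - 1 < \<bar>x\<bar>" for x
  proof -
    have "R1 < \<bar>x\<bar>" "R2 < \<bar>x\<bar>" using that unfolding R_def by linarith+
    then show "f x = 0" "g x = 0" using R1[of x] R2[of x] by linarith+
  qed
  have z': "f' x = 0" "g' x = 0" if "R - 1 < \<bar>x\<bar>" for x
    using open_zero[of f f' x] open_zero[of g g' x] f'(1) g'(1) z that by auto
  have z'': "f'' x = 0" if "R - 1 < \<bar>x\<bar>" for x
    using open_zero[of f' f'' x] f'(2) z' that by auto
  define h where "h x = x * g x" for x
  have hc: "continuous_on UNIV h" unfolding h_def
    by (intro continuous_intros DERIV_continuous_on[of _ g g']) (use g' in auto)
  have hodd: "h (- x) = - h x" for x using g(2) by (simp add: h_def even_fun_def)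
  define A where "A x = (x * f x + prim h x) / 2" for x
  define A1 where "A1 x = (f x + x * f' x + h x) / 2" for x
  define A2 where "A2 x = (2 * f' x + x * f'' x + g x + x * g' x) / 2" for x
  have dA: "(A has_real_derivative A1 x) (at x)" for x
    unfolding A_def A1_def by (auto intro!: derivative_eq_intros f' prim_deriv[OF hc] simp: algebra_simps)
  have dA1: "(A1 has_real_derivative A2 x) (at x)" for x
    unfolding A1_def A2_def h_def by (auto intro!: derivative_eq_intros f' g' simp: algebra_simps)
  have cA2: "continuous_on UNIV A2"
    unfolding A2_def
    by (intro continuous_intros f' g' DERIV_continuous_on[of _ f' f''] DERIV_continuous_on[of _ g g']) (use f' g' in auto)
  have "A x = A R" if "R \<le> \<bar>x\<bar>" for x
  proof -
    have p: "prim h y = prim h R" if "R \<le> y" for y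
    proof -
      have "prim h y - prim h R = integral {R..y} h" using prim_diff[OF hc that] by simp
      also have "\<dots> = integral {R..y} (\<lambda>_. 0)"
        by (intro integral_cong) (use R z in \<open>auto simp: h_def\<close>)
      finally show ?thesis by simp
    qed
    have "prim h x = prim h \<bar>x\<bar>" using prim_even[OF hc hodd, of x] by (auto simp: abs_if)
    also have "\<dots> = prim h R" using p that by blast
    finally show ?thesis using z[of x] z[of R] that R by (simp add: A_def)
  qed
  moreover have "A1 x = 0" "A2 x = 0" if "R \<le> \<bar>x\<bar>" for x
    using that z z' z'' by (auto simp: A1_def A2_def h_def)
  ultimately have "free_profile A A1 A2 R"
    unfolding free_profile_def using dA dA1 cA2 R by blast
  moreover have "U0 f g t r = free_minus A t r / r" if "0 \<le> t" "r \<noteq> 0" for t r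
  proof -
    have "integral {r - t..r + t} h = prim h (r + t) - prim h (r - t)" using that by (intro prim_diff[OF hc]) auto
    moreover have "prim h (t - r) = prim h (r - t)" using prim_even[OF hc hodd, of "r - t"] by simp
    moreover have "f (t - r) = f (r - t)" using f(2) unfolding even_fun_def by (metis minus_diff_eq)
    moreover have "(\<lambda>\<rho>. \<rho> * g \<rho>) = h" by (simp add: h_def fun_eq_iff)
    ultimately show ?thesis using that(2)
      unfolding U0_def free_minus_def A_def by (simp add: add.commute[of t r]) (simp add: field_simps)
  qed
  ultimately show ?thesis by blast
qed

lemma C1_travelling:
  assumes "\<And>x. (A has_real_derivative A1 x) (at x)" "continuous_on UNIV A1"
  shows "C1 (\<lambda>t r. A (t + c * r)) (\<lambda>t r. A1 (t + c * r)) (\<lambda>t r. c * A1 (t + c * r))"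
proof (rule C1_of_partials)
  fix t r :: real
  show "((\<lambda>s. A (s + c * r)) has_real_derivative A1 (t + c * r)) (at t within {0..})"
    using deriv_affine[where a=1 and b="c * r" and x=t, OF assms(1)] by simp
  show "((\<lambda>r. A (t + c * r)) has_real_derivative c * A1 (t + c * r)) (at r)"
    using deriv_affine[where a=c and b=t and x=r, OF assms(1)] by (simp add: add.commute)
qed (auto simp: cont2_def intro!: continuous_intros continuous_on_compose2[OF assms(2)])

lemma C1_free:
  assumes "\<And>x. (A has_real_derivative A1 x) (at x)" "continuous_on UNIV A1"
  shows C1_free_plus: "C1 (free_plus A) (free_plus A1) (free_minus A1)"
    and C1_free_minus: "C1 (free_minus A) (free_minus A1) (free_plus A1)"
  using C1_add[OF C1_travelling[where c=1, OF assms] C1_travelling[where c="-1", OF assms]]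
    C1_diff[OF C1_travelling[where c=1, OF assms] C1_travelling[where c="-1", OF assms]]
  by (simp_all add: free_plus_def[abs_def] free_minus_def[abs_def])

lemma bounded_of_eventually_const:
  fixes A :: "real \<Rightarrow> real"
  assumes "continuous_on UNIV A" "\<And>x. R \<le> \<bar>x\<bar> \<Longrightarrow> A x = c"
  shows "\<exists>B>0. \<forall>x. \<bar>A x\<bar> \<le> B"
proof -
  have "bounded (A ` {- R..R})"
    by (intro compact_imp_bounded compact_continuous_image continuous_on_subset[OF assms(1)]) auto
  then obtain B where "\<forall>y\<in>A ` {- R..R}. norm y \<le> B" unfolding bounded_iff by blast
  then have B: "\<And>x. x \<in> {- R..R} \<Longrightarrow> \<bar>A x\<bar> \<le> B" by auto
  have "\<bar>A x\<bar> \<le> max 1 (max B \<bar>c\<bar>)" for x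
  proof (cases "R \<le> \<bar>x\<bar>")
    case False
    then have "x \<in> {- R..R}" by auto
    from B[OF this] show ?thesis by linarith
  qed (use assms(2) in auto)
  then show ?thesis by (intro exI[of _ "max 1 (max B \<bar>c\<bar>)"]) auto
qed

text \<open>\<open>A\<close> has one constant value on both sides of \<open>[-R, R]\<close>, so both
  fields vanish once \<open>\<bar>t - r\<bar> \<ge> R\<close>. Inside this strip
  \<open>jb (t - r) powr (- \<kappa>)\<close> is bounded below, so decay of any order costs only the
  factor \<open>jb R powr \<kappa>\<close>.\<close>

lemma free_decay:
  fixes A A1 :: "real \<Rightarrow> real"
  assumes d: "\<And>x. (A has_real_derivative A1 x) (at x)" and c: "continuous_on UNIV A1"
    and out: "\<forall>x. R \<le> \<bar>x\<bar> \<longrightarrow> A x = c \<and> A1 x = 0" and \<kappa>: "0 \<le> \<kappa>"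
  shows "\<exists>C>0. \<forall>t\<ge>0. \<forall>r\<ge>0. \<bar>quo (free_minus A) (free_plus A1) t r\<bar> \<le> C * jb (t - r) powr (- \<kappa>) / jb r \<and>
     \<bar>free_plus A1 t r\<bar> \<le> C * jb (t - r) powr (- \<kappa>)"
proof -
  have cA: "continuous_on UNIV A" by (rule DERIV_continuous_on) (use d in auto)
  obtain B0 where B0: "B0 > 0" "\<And>x. \<bar>A x\<bar> \<le> B0" using bounded_of_eventually_const[OF cA] out by blast
  obtain B1 where B1: "B1 > 0" "\<And>x. \<bar>A1 x\<bar> \<le> B1" using bounded_of_eventually_const[OF c] out by blast
  define B where "B = 4 * max B0 B1"
  have B: "B > 0" using B0 by (simp add: B_def)
  define C where "C = B * jb R powr \<kappa>"
  have bq: "\<bar>quo (free_minus A) (free_plus A1) t r\<bar> \<le> B / jb r" if r: "0 \<le> r" for t r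
  proof -
    consider "r = 0" | "0 < r" "r \<le> 1" | "1 < r" using r by linarith
    then show ?thesis
    proof cases
      case 1
      then show ?thesis using B1(2)[of t] B0(1) by (simp add: quo_def free_plus_def B_def)
    next
      case 2
      have "norm (A (t + r) - A (t - r)) \<le> B1 * norm ((t + r) - (t - r))"
        by (rule field_differentiable_bound[of UNIV A A1]) (use d B1 in auto)
      then have "\<bar>free_minus A t r / r\<bar> \<le> 2 * B1" using 2 by (simp add: free_minus_def field_simps)
      also have "\<dots> \<le> B / 2" by (simp add: B_def)
      also have "\<dots> \<le> B / jb r" using jb_le[of r] 2 B by (intro divide_left_mono) auto
      finally show ?thesis using 2 by (simp add: quo_def)
    next
      case 3
      have "\<bar>free_minus A t r\<bar> \<le> 2 * B0" using B0(2)[of "t + r"] B0(2)[of "t - r"] unfolding free_minus_def by linarith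
      then have "\<bar>free_minus A t r / r\<bar> \<le> 2 * B0 / r" using 3 by (simp add: divide_right_mono)
      also have "\<dots> \<le> 2 * B0 / (jb r / 2)" using jb_le[of r] 3 B0 by (intro divide_left_mono) auto
      also have "\<dots> \<le> B / jb r" by (simp add: B_def divide_right_mono)
      finally show ?thesis using 3 by (simp add: quo_def)
    qed
  qed
  have bp: "\<bar>free_plus A1 t r\<bar> \<le> B" for t r
    using B1(2)[of "t + r"] B1(2)[of "t - r"] unfolding free_plus_def B_def by linarith
  show ?thesis
  proof (intro exI[of _ C] conjI allI impI)
    fix t r :: real assume t: "0 \<le> t" and r: "0 \<le> r"
    have "\<bar>quo (free_minus A) (free_plus A1) t r\<bar> \<le> C * jb (t - r) powr (- \<kappa>) / jb r \<and>
       \<bar>free_plus A1 t r\<bar> \<le> C * jb (t - r) powr (- \<kappa>)"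
    proof (cases "R \<le> \<bar>t - r\<bar>")
      case True
      then have "R \<le> \<bar>t + r\<bar>" using t r by linarith
      then have "free_minus A t r = 0" "free_plus A1 t r = 0"
        using True out by (auto simp: free_minus_def free_plus_def)
      then show ?thesis using B by (auto simp: quo_def C_def)
    next
      case False
      have "jb (t - r) \<le> jb R" using False by (intro jb_mono) auto
      then have "jb R powr (- \<kappa>) \<le> jb (t - r) powr (- \<kappa>)" using \<kappa> by (intro powr_mono2') auto
      then have "C * jb R powr (- \<kappa>) \<le> C * jb (t - r) powr (- \<kappa>)" using B by (intro mult_left_mono) (auto simp: C_def)
      moreover have "C * jb R powr (- \<kappa>) = B" by (simp add: C_def powr_minus)
      ultimately have "B \<le> C * jb (t - r) powr (- \<kappa>)" by simp
      then show ?thesis using bq[OF r, of t] bp[of t r] divide_right_mono[of B "C * jb (t - r) powr (- \<kappa>)" "jb r"] by auto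
    qed
    then show "\<bar>quo (free_minus A) (free_plus A1) t r\<bar> \<le> C * jb (t - r) powr (- \<kappa>) / jb r"
       "\<bar>free_plus A1 t r\<bar> \<le> C * jb (t - r) powr (- \<kappa>)" by auto
  qed (use B in \<open>auto simp: C_def\<close>)
qed

text \<open>\<open>A1\<close> with exponent \<open>\<mu> / p\<close> controls the time derivative,
  \<open>A\<close> with exponent \<open>\<mu>\<close> the value and its radial part. Passing from
  \<open>jb r * W3\<close> to \<open>W2\<close> costs the factor 3.\<close>

lemma (in exponents) free_bounds:
  assumes "free_profile A A1 A2 R"
  shows "\<exists>C>0. \<forall>t\<ge>0. \<forall>r\<ge>0. \<bar>quo (free_minus A1) (free_plus A2) t r\<bar> \<le> C / W1 t r \<and>
    \<bar>quo (free_minus A) (free_plus A1) t r\<bar> \<le> C / W2 t r \<and> \<bar>free_plus A1 t r\<bar> \<le> C / W3 t r"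
proof -
  have d: "\<And>x. (A has_real_derivative A1 x) (at x)" "\<And>x. (A1 has_real_derivative A2 x) (at x)" and c2: "continuous_on UNIV A2"
    and out: "\<forall>x. R \<le> \<bar>x\<bar> \<longrightarrow> A x = A R \<and> A1 x = 0" "\<forall>x. R \<le> \<bar>x\<bar> \<longrightarrow> A1 x = 0 \<and> A2 x = 0"
    using assms unfolding free_profile_def by blast+
  have c1: "continuous_on UNIV A1" by (rule DERIV_continuous_on) (use d in auto)
  have mp: "0 \<le> \<mu> / p" using mu_pos p2 by simp
  from free_decay[OF d(1) c1 out(1) less_imp_le[OF mu_pos]]
  obtain C where C: "C > 0" and CB': "\<forall>t\<ge>0. \<forall>r\<ge>0. \<bar>quo (free_minus A) (free_plus A1) t r\<bar> \<le> C * jb (t - r) powr (- \<mu>) / jb r \<and>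
     \<bar>free_plus A1 t r\<bar> \<le> C * jb (t - r) powr (- \<mu>)"
    by blast
  from free_decay[OF d(2) c2 out(2) mp]
  obtain D where D: "D > 0" and DB': "\<forall>t\<ge>0. \<forall>r\<ge>0. \<bar>quo (free_minus A1) (free_plus A2) t r\<bar> \<le> D * jb (t - r) powr (- (\<mu> / p)) / jb r \<and>
     \<bar>free_plus A2 t r\<bar> \<le> D * jb (t - r) powr (- (\<mu> / p))"
    by blast
  define E where "E = max (3 * C) D"
  show ?thesis
  proof (intro exI[of _ E] conjI allI impI)
    fix t r :: real assume t: "0 \<le> t" and r: "0 \<le> r"
    have w: "jb (t - r) powr (- (\<mu> / p)) / jb r = 1 / W1 t r"
      "jb (t - r) powr (- \<mu>) / jb r = 1 / (jb r * W3 t r)" "jb (t - r) powr (- \<mu>) = 1 / W3 t r"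
      by (simp_all add: w1_def w3_def powr_minus_divide)
    have "\<bar>quo (free_minus A1) (free_plus A2) t r\<bar> \<le> D / W1 t r"
      using DB'[rule_format, OF t r, THEN conjunct1] w(1) by (metis mult.right_neutral times_divide_eq_right)
    also have "\<dots> \<le> E / W1 t r" using w1_pos[of t r] by (intro divide_right_mono) (auto simp: E_def)
    finally show "\<bar>quo (free_minus A1) (free_plus A2) t r\<bar> \<le> E / W1 t r" .
    have "\<bar>quo (free_minus A) (free_plus A1) t r\<bar> \<le> C / (jb r * W3 t r)"
      using CB'[rule_format, OF t r, THEN conjunct1] w(2) by (metis mult.right_neutral times_divide_eq_right)
    also have "\<dots> \<le> 3 * C / W2 t r"
    proof -
      have "3 * C / (3 * (jb r * W3 t r)) \<le> 3 * C / W2 t r"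
        using C w2_pos[of t r] w2_le_jb_w3[OF t r] by (intro frac_le) auto
      then show ?thesis by simp
    qed
    also have "\<dots> \<le> E / W2 t r" using w2_pos[of t r] by (intro divide_right_mono) (auto simp: E_def)
    finally show "\<bar>quo (free_minus A) (free_plus A1) t r\<bar> \<le> E / W2 t r" .
    have "\<bar>free_plus A1 t r\<bar> \<le> C / W3 t r" using CB'[rule_format, OF t r, THEN conjunct2] w(3) by (metis mult.right_neutral times_divide_eq_right)
    also have "\<dots> \<le> E / W3 t r" using w3_pos[of t r] C by (intro divide_right_mono) (auto simp: E_def)
    finally show "\<bar>free_plus A1 t r\<bar> \<le> E / W3 t r" .
  qed (use C in \<open>auto simp: E_def\<close>)
qed

section \<open>The power nonlinearity: derivatives and Lipschitz bounds\<close>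

definition sgn_powr :: "real \<Rightarrow> real \<Rightarrow> real" where
  "sgn_powr k x = sgn x * \<bar>x\<bar> powr k"

lemma tendsto_abs_powr_0: "0 < k \<Longrightarrow> ((\<lambda>x::real. \<bar>x\<bar> powr k) \<longlongrightarrow> 0) (at 0)"
  by (rule tendsto_zero_powrI[where b=k]) (auto intro!: tendsto_eq_intros tendsto_rabs_zero)

text \<open>Stated for any \<open>h\<close> of this size, so that it serves both
  \<open>\<bar>x\<bar> powr k\<close> and \<open>sgn_powr k\<close>.\<close>

lemma deriv_0_of_abs_eq_powr:
  assumes k: "1 < k" and h: "\<And>x::real. \<bar>h x\<bar> = \<bar>x\<bar> powr k"
  shows "(h has_real_derivative 0) (at 0)"
proof -
  have "((\<lambda>x. h x / x) \<longlongrightarrow> 0) (at 0)"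
  proof (rule Lim_null_comparison[OF _ tendsto_abs_powr_0[of "k - 1"]])
    show "\<forall>\<^sub>F x in at 0. norm (h x / x) \<le> \<bar>x\<bar> powr (k - 1)"
      by (auto simp: eventually_at_filter powr_diff h)
  qed (use k in auto)
  then show ?thesis using h[of 0] by (simp add: DERIV_def)
qed

lemma abs_powr_deriv:
  assumes k: "1 < k"
  shows "((\<lambda>x::real. \<bar>x\<bar> powr k) has_real_derivative k * sgn_powr (k - 1) x) (at x)"
proof -
  consider "x > 0" | "x < 0" | "x = 0" by linarith
  then show ?thesis
  proof cases
    case 1
    have "((\<lambda>x. x powr k) has_real_derivative k * x powr (k - 1)) (at x)" using 1 by (rule has_real_derivative_powr)
    then have "((\<lambda>x. \<bar>x\<bar> powr k) has_real_derivative k * x powr (k - 1)) (at x)"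
      by (rule has_field_derivative_transform_within_open[of _ _ _ "{0<..}"]) (use 1 in auto)
    then show ?thesis using 1 by (simp add: sgn_powr_def)
  next
    case 2
    have "((\<lambda>x. (-1 * x + 0) powr k) has_real_derivative - 1 * (k * (-1 * x + 0) powr (k - 1))) (at x)"
      using 2 by (intro deriv_affine has_real_derivative_powr) auto
    then have "((\<lambda>x. \<bar>x\<bar> powr k) has_real_derivative - 1 * (k * (-1 * x + 0) powr (k - 1))) (at x)"
      by (rule has_field_derivative_transform_within_open[of _ _ _ "{..<0}"]) (use 2 in auto)
    then show ?thesis using 2 by (simp add: sgn_powr_def)
  next
    case 3
    then show ?thesis using deriv_0_of_abs_eq_powr[OF k, of "\<lambda>x. \<bar>x\<bar> powr k"] by (simp add: sgn_powr_def)
  qed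
qed

lemma sgn_powr_deriv:
  assumes k: "1 < k"
  shows "(sgn_powr k has_real_derivative k * \<bar>x\<bar> powr (k - 1)) (at x)"
proof -
  consider "x > 0" | "x < 0" | "x = 0" by linarith
  then show ?thesis
  proof cases
    case 1
    have "((\<lambda>x. x powr k) has_real_derivative k * x powr (k - 1)) (at x)" using 1 by (rule has_real_derivative_powr)
    then have "(sgn_powr k has_real_derivative k * x powr (k - 1)) (at x)"
      by (rule has_field_derivative_transform_within_open[of _ _ _ "{0<..}"]) (use 1 in \<open>auto simp: sgn_powr_def\<close>)
    then show ?thesis using 1 by simp
  next
    case 2
    have "((\<lambda>x. - ((-1 * x + 0) powr k)) has_real_derivative - (- 1 * (k * (-1 * x + 0) powr (k - 1)))) (at x)"
      using 2 by (intro DERIV_minus deriv_affine has_real_derivative_powr) auto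
    then have "(sgn_powr k has_real_derivative - (- 1 * (k * (-1 * x + 0) powr (k - 1)))) (at x)"
      by (rule has_field_derivative_transform_within_open[of _ _ _ "{..<0}"]) (use 2 in \<open>auto simp: sgn_powr_def\<close>)
    then show ?thesis using 2 by simp
  next
    case 3
    then show ?thesis using deriv_0_of_abs_eq_powr[OF k, of "sgn_powr k"] k
      by (simp add: sgn_powr_def abs_mult sgn_if)
  qed
qed

lemma abs_powr_diff_le:
  fixes x y M k :: real
  assumes "1 < k" "\<bar>x\<bar> \<le> M" "\<bar>y\<bar> \<le> M"
  shows "\<bar>\<bar>x\<bar> powr k - \<bar>y\<bar> powr k\<bar> \<le> k * M powr (k - 1) * \<bar>x - y\<bar>"
proof -
  have "norm (\<bar>x\<bar> powr k - \<bar>y\<bar> powr k) \<le> (k * M powr (k - 1)) * norm (x - y)"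
  proof (rule field_differentiable_bound[of "{- M..M}"])
    fix z assume "z \<in> {- M..M}"
    then have "\<bar>z\<bar> powr (k - 1) \<le> M powr (k - 1)" using assms by (intro powr_mono2) auto
    then show "norm (k * sgn_powr (k - 1) z) \<le> k * M powr (k - 1)"
      using assms by (auto simp: sgn_powr_def abs_mult sgn_if intro!: mult_left_mono)
  qed (use assms abs_powr_deriv in \<open>auto intro: has_field_derivative_at_within\<close>)
  then show ?thesis by simp
qed

lemma sgn_powr_diff_le:
  fixes x y M k :: real
  assumes "1 < k" "\<bar>x\<bar> \<le> M" "\<bar>y\<bar> \<le> M"
  shows "\<bar>sgn_powr k x - sgn_powr k y\<bar> \<le> k * M powr (k - 1) * \<bar>x - y\<bar>"
proof -
  have "norm (sgn_powr k x - sgn_powr k y) \<le> (k * M powr (k - 1)) * norm (x - y)"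
  proof (rule field_differentiable_bound[of "{- M..M}"])
    fix z assume "z \<in> {- M..M}"
    then have "\<bar>z\<bar> powr (k - 1) \<le> M powr (k - 1)" using assms by (intro powr_mono2) auto
    then show "norm (k * \<bar>z\<bar> powr (k - 1)) \<le> k * M powr (k - 1)"
      using assms by (auto simp: abs_mult intro!: mult_left_mono)
  qed (use assms sgn_powr_deriv in \<open>auto intro: has_field_derivative_at_within\<close>)
  then show ?thesis by simp
qed

definition src :: "real \<Rightarrow> field2 \<Rightarrow> field2" where
  "src k n s \<rho> = \<rho> * \<bar>n s \<rho>\<bar> powr k"

text \<open>The radial derivative of \<open>src k n\<close>, where \<open>z\<close> stands for
  \<open>\<rho>\<close> times the radial derivative of \<open>n\<close>. No quotient by
  \<open>\<rho>\<close> occurs, so the expression makes sense on the axis.\<close>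

definition src_r :: "real \<Rightarrow> field2 \<Rightarrow> field2 \<Rightarrow> field2" where
  "src_r k n z s \<rho> = \<bar>n s \<rho>\<bar> powr k + k * sgn_powr (k - 1) (n s \<rho>) * z s \<rho>"

lemma cont2_fun:
  assumes "continuous_on UNIV h" "cont2 n"
  shows "cont2 (\<lambda>t r. h (n t r))"
  using continuous_on_compose2[OF assms(1) assms(2)[unfolded cont2_def]] by (simp add: cont2_def)

lemma cont2_src:
  assumes "cont2 n" "1 < k"
  shows "cont2 (src k n)"
proof -
  have "continuous_on UNIV (\<lambda>x::real. \<bar>x\<bar> powr k)"
    using abs_powr_deriv[OF assms(2)] by (intro DERIV_continuous_on) auto
  then show ?thesis unfolding src_def[abs_def] by (intro cont2_mult cont2_snd cont2_fun[OF _ assms(1)])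
qed

lemma cont2_src_r:
  assumes "cont2 n" "cont2 z" "2 < k"
  shows "cont2 (src_r k n z)"
proof -
  have "continuous_on UNIV (\<lambda>x::real. \<bar>x\<bar> powr k)"
    using abs_powr_deriv[of k] assms(3) by (intro DERIV_continuous_on) auto
  moreover have "continuous_on UNIV (sgn_powr (k - 1))"
    using sgn_powr_deriv[of "k - 1"] assms(3) by (intro DERIV_continuous_on) auto
  ultimately show ?thesis unfolding src_r_def[abs_def]
    by (intro cont2_add cont2_mult cont2_const assms(2) cont2_fun[OF _ assms(1)])
qed

text \<open>Caratheodory's criterion with \<open>F\<close> itself as the slope function.\<close>

lemma deriv_mult_id_at_0:
  assumes "isCont F (0::real)"
  shows "((\<lambda>x. x * F x) has_real_derivative F 0) (at 0)"
  using assms by (subst CARAT_DERIV) (auto intro!: exI[of _ F])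

text \<open>Only \<open>x * n s x\<close> is known to be differentiable. Off the axis, division
  recovers the derivative \<open>z s x / x\<close> of \<open>n s\<close>. On the axis, uniqueness of
  derivatives forces \<open>z s 0 = 0\<close>, and continuity of \<open>n s\<close> does the
  rest.\<close>

lemma src_deriv:
  assumes k: "1 < k" and n: "cont2 n" and s: "0 \<le> s"
    and d: "\<And>x. ((\<lambda>x. x * n s x) has_real_derivative n s x + z s x) (at x)"
  shows "(src k n s has_real_derivative src_r k n z s x) (at x)"
proof -
  have nc: "isCont (n s) x" for x
    using cont2_slice[OF n s, of UNIV] by (simp add: continuous_on_eq_continuous_at)
  show ?thesis
  proof (cases "x = 0")
    case True
    have "n s 0 + z s 0 = n s 0"
      using DERIV_unique[OF d[of 0] deriv_mult_id_at_0[OF nc]] .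
    then have "z s 0 = 0" by simp
    moreover have "((\<lambda>x. x * \<bar>n s x\<bar> powr k) has_real_derivative \<bar>n s 0\<bar> powr k) (at 0)"
      by (rule deriv_mult_id_at_0)
         (rule isCont_o2[OF nc DERIV_isCont[OF abs_powr_deriv[OF k]]])
    ultimately show ?thesis using True by (simp add: src_def[abs_def] src_r_def)
  next
    case False
    have "((\<lambda>x. (x * n s x) / x) has_real_derivative ((n s x + z s x) * x - (x * n s x) * 1) / (x * x)) (at x)"
      by (rule DERIV_divide) (use d False in \<open>auto\<close>)
    then have "((\<lambda>x. (x * n s x) / x) has_real_derivative z s x / x) (at x)"
      using False by (simp add: field_simps)
    then have dn: "(n s has_real_derivative z s x / x) (at x)"
      by (rule has_field_derivative_transform_within_open[of _ _ _ "- {0}"]) (use False in auto)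
    have "((\<lambda>x. x * \<bar>n s x\<bar> powr k) has_real_derivative
       1 * \<bar>n s x\<bar> powr k + (k * sgn_powr (k - 1) (n s x) * (z s x / x)) * x) (at x)"
      by (intro DERIV_mult DERIV_ident DERIV_chain2[OF abs_powr_deriv[OF k] dn])
    then show ?thesis using False by (simp add: src_def[abs_def] src_r_def)
  qed
qed

lemma src_odd: "n s (- x) = n s x \<Longrightarrow> src k n s (- x) = - src k n s x"
  by (simp add: src_def)

section \<open>Solution operators and their Lipschitz estimates\<close>

lemma Pp_diff:
  assumes "cont2 G" "cont2 H"
  shows "Pp (\<lambda>s x. G s x - H s x) t r = Pp G t r - Pp H t r"
  unfolding Pp_def by (rule integral_diff[OF integrable_Pp[OF assms(1)] integrable_Pp[OF assms(2)]])

lemma Pm_diff: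
  assumes "cont2 G" "cont2 H"
  shows "Pm (\<lambda>s x. G s x - H s x) t r = Pm G t r - Pm H t r"
  unfolding Pm_def by (rule integral_diff[OF integrable_Pm[OF assms(1)] integrable_Pm[OF assms(2)]])

lemma prim_minus:
  assumes "continuous_on UNIV g" "continuous_on UNIV h"
  shows "prim (\<lambda>x. g x - h x) x = prim g x - prim h x"
proof -
  have i: "g integrable_on {a..b}" "h integrable_on {a..b}" for a b
    by (intro integrable_continuous_real continuous_on_subset[OF assms(1)] continuous_on_subset[OF assms(2)]; simp)+
  show ?thesis by (simp add: prim_def integral_diff[OF i])
qed

lemma Dop_diff:
  assumes "cont2 G" "cont2 H"
  shows "Dop (\<lambda>s x. G s x - H s x) t r = Dop G t r - Dop H t r"
proof -
  have e: "prim (\<lambda>x. G s x - H s x) y = prim (G s) y - prim (H s) y" if "0 \<le> s" for s y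
    by (rule prim_minus) (use that assms cont2_slice in auto)
  have "Pp (\<lambda>s. prim (\<lambda>x. G s x - H s x)) t r = Pp (\<lambda>s y. prim (G s) y - prim (H s) y) t r"
    "Pm (\<lambda>s. prim (\<lambda>x. G s x - H s x)) t r = Pm (\<lambda>s y. prim (G s) y - prim (H s) y) t r"
    unfolding Pp_def Pm_def by (auto intro!: integral_cong simp: e)
  then show ?thesis
    by (simp add: Dop_eq assms cont2_diff Pp_diff Pm_diff cont2_prim)
qed

lemma quo_diff: "quo (\<lambda>t r. N t r - M t r) (\<lambda>t r. Nr t r - Mr t r) t r = quo N Nr t r - quo M Mr t r"
  by (simp add: quo_def diff_divide_distrib)

lemma quo_lin: "quo (\<lambda>t r. a * N t r + b * M t r) (\<lambda>t r. a * Nr t r + b * Mr t r) t r = a * quo N Nr t r + b * quo M Mr t r"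
  by (simp add: quo_def add_divide_distrib)

text \<open>The field \<open>r u\<close> for \<open>u = \<epsilon> U_0 + L F\<close> with
  \<open>G = \<rho> F\<close>; the factor 1/2 is that of \<open>Lop\<close>. The suffixes of its
  companions name partial derivatives.\<close>

definition num :: "(real \<Rightarrow> real) \<Rightarrow> real \<Rightarrow> field2 \<Rightarrow> field2" where
  "num A \<epsilon> G t r = \<epsilon> * free_minus A t r + 1 / 2 * Dop G t r"

definition num_t :: "(real \<Rightarrow> real) \<Rightarrow> real \<Rightarrow> field2 \<Rightarrow> field2" where
  "num_t A1 \<epsilon> G t r = \<epsilon> * free_minus A1 t r + 1 / 2 * (Pp G t r + Pm G t r)"

definition num_r :: "(real \<Rightarrow> real) \<Rightarrow> real \<Rightarrow> field2 \<Rightarrow> field2" where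
  "num_r A1 \<epsilon> G t r = \<epsilon> * free_plus A1 t r + 1 / 2 * (Pp G t r - Pm G t r)"

definition num_tr :: "(real \<Rightarrow> real) \<Rightarrow> real \<Rightarrow> field2 \<Rightarrow> field2" where
  "num_tr A2 \<epsilon> Gx t r = \<epsilon> * free_plus A2 t r + 1 / 2 * (Pp Gx t r + Pm Gx t r)"

definition sol :: "(real \<Rightarrow> real) \<Rightarrow> (real \<Rightarrow> real) \<Rightarrow> real \<Rightarrow> field2 \<Rightarrow> field2" where
  "sol A A1 \<epsilon> G = quo (num A \<epsilon> G) (num_r A1 \<epsilon> G)"

text \<open>The value on the axis is the mixed derivative of the numerator, which is why the
  derivative \<open>Gx\<close> of the source is an argument.\<close>

definition sol_t :: "(real \<Rightarrow> real) \<Rightarrow> (real \<Rightarrow> real) \<Rightarrow> real \<Rightarrow> field2 \<Rightarrow> field2 \<Rightarrow> field2" where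
  "sol_t A1 A2 \<epsilon> G Gx = quo (num_t A1 \<epsilon> G) (num_tr A2 \<epsilon> Gx)"

lemma sol_split: "sol A A1 \<epsilon> G t r = \<epsilon> * quo (free_minus A) (free_plus A1) t r
    + 1 / 2 * quo (Dop G) (\<lambda>t r. Pp G t r - Pm G t r) t r"
  unfolding sol_def num_def[abs_def] num_r_def[abs_def] by (rule quo_lin)

lemma sol_t_split: "sol_t A1 A2 \<epsilon> G Gx t r = \<epsilon> * quo (free_minus A1) (free_plus A2) t r
    + 1 / 2 * quo (\<lambda>t r. Pp G t r + Pm G t r) (\<lambda>t r. Pp Gx t r + Pm Gx t r) t r"
  unfolding sol_t_def num_t_def[abs_def] num_tr_def[abs_def] by (rule quo_lin)

lemma dt_eqI:
  assumes "0 \<le> t" "((\<lambda>s. u s r) has_real_derivative D) (at t within {0..})"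
  shows "dt u t r = D"
proof -
  \<comment> \<open>The half-line has points to the right of every \<open>t \<ge> 0\<close>, so
    derivatives within it are unique, also at \<open>t = 0\<close>.\<close>
  have "at_right t \<le> at t within {0..}" using assms(1) by (intro at_le) auto
  then have "at t within {0..} \<noteq> bot" by (metis bot.extremum_unique trivial_limit_at_right_real)
  then show ?thesis
    unfolding dt_def using assms(2)
    by (intro vector_derivative_within) (auto simp: has_real_derivative_iff_has_vector_derivative)
qed

text \<open>The regularity \<open>v\<close> has inside the iteration: a continuous odd source gives
  \<open>sol\<close>, the radial derivative of \<open>r * sol\<close>, and a time derivative off the
  axis.\<close>

locale wave_source =
  fixes A A1 A2 :: "real \<Rightarrow> real" and R \<epsilon> :: real and G :: field2
  assumes profile: "free_profile A A1 A2 R" and G: "cont2 G"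
    and odd: "\<And>s x. 0 \<le> s \<Longrightarrow> G s (- x) = - G s x"
begin

lemma A_deriv: "(A has_real_derivative A1 x) (at x)" "(A1 has_real_derivative A2 x) (at x)"
  and A_cont: "continuous_on UNIV A1" "continuous_on UNIV A2"
proof -
  show 1: "(A has_real_derivative A1 x) (at x)" "(A1 has_real_derivative A2 x) (at x)" for x
    using profile by (auto simp: free_profile_def)
  show "continuous_on UNIV A1" by (rule DERIV_continuous_on) (use 1 in auto)
  show "continuous_on UNIV A2" using profile by (auto simp: free_profile_def)
qed

lemma C1_num: "C1 (num A \<epsilon> G) (num_t A1 \<epsilon> G) (num_r A1 \<epsilon> G)"
  unfolding num_def[abs_def] num_t_def[abs_def] num_r_def[abs_def]
  by (intro C1_add C1_cmult C1_free_minus A_deriv A_cont C1_Dop G)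

lemma num_0: "num A \<epsilon> G t 0 = 0"
  using Dop_minus[OF G odd, of t 0] by (simp add: num_def free_minus_def)

lemma num_minus: "num A \<epsilon> G t (- r) = - num A \<epsilon> G t r"
  using Dop_minus[OF G odd, of t r] by (simp add: num_def free_minus_def algebra_simps)

lemma num_r_minus: "num_r A1 \<epsilon> G t (- r) = num_r A1 \<epsilon> G t r"
  using Pp_minus[of G t r] Pm_minus[of G t r] odd by (simp add: num_r_def free_plus_def)

lemma num_t_0: "num_t A1 \<epsilon> G t 0 = 0"
  using Pp_minus[of G t 0] odd by (simp add: num_t_def free_minus_def)

lemma num_t_minus: "num_t A1 \<epsilon> G t (- r) = - num_t A1 \<epsilon> G t r"
  using Pp_minus[of G t r] Pm_minus[of G t r] odd by (simp add: num_t_def free_minus_def algebra_simps)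

lemma cont2_num_r: "cont2 (num_r A1 \<epsilon> G)"
  using C1_num by (simp add: C1_def)

lemma cont2_sol: "cont2 (sol A A1 \<epsilon> G)"
  unfolding sol_def by (rule cont2_quo[OF cont2_num_r C1_deriv_r[OF C1_num] num_0])

lemma sol_minus: "sol A A1 \<epsilon> G t (- r) = sol A A1 \<epsilon> G t r"
  by (simp add: sol_def quo_def num_minus)

lemma mult_sol: "r * sol A A1 \<epsilon> G t r = num A \<epsilon> G t r"
  unfolding sol_def by (rule mult_quo) (rule num_0)

lemma mult_sol_deriv: "0 \<le> t \<Longrightarrow> ((\<lambda>x. x * sol A A1 \<epsilon> G t x) has_real_derivative num_r A1 \<epsilon> G t x) (at x)"
  using C1_deriv_r[OF C1_num] by (simp add: mult_sol)

lemma sol_deriv_r: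
  assumes "0 \<le> t" "r \<noteq> 0"
  shows "(sol A A1 \<epsilon> G t has_real_derivative (num_r A1 \<epsilon> G t r - sol A A1 \<epsilon> G t r) / r) (at r)"
proof -
  have "((\<lambda>x. num A \<epsilon> G t x / x) has_real_derivative (num_r A1 \<epsilon> G t r * r - num A \<epsilon> G t r * 1) / (r * r)) (at r)"
    using C1_deriv_r[OF C1_num assms(1)] assms(2) by (intro DERIV_divide DERIV_ident) auto
  moreover have "(num_r A1 \<epsilon> G t r * r - num A \<epsilon> G t r * 1) / (r * r) = (num_r A1 \<epsilon> G t r - sol A A1 \<epsilon> G t r) / r"
    using assms(2) by (simp add: sol_def quo_def field_simps)
  ultimately have "((\<lambda>x. num A \<epsilon> G t x / x) has_real_derivative (num_r A1 \<epsilon> G t r - sol A A1 \<epsilon> G t r) / r) (at r)"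
    by simp
  then show ?thesis
    by (rule has_field_derivative_transform_within_open[of _ _ _ "- {0}"]) (use assms(2) in \<open>auto simp: sol_def quo_def\<close>)
qed

lemma sol_deriv_t_off_axis:
  assumes "0 \<le> t" "r \<noteq> 0"
  shows "((\<lambda>s. sol A A1 \<epsilon> G s r) has_real_derivative num_t A1 \<epsilon> G t r / r) (at t within {0..})"
  using DERIV_cdivide[OF C1_deriv_t[OF C1_num assms(1), of r], of r] assms(2) by (simp add: sol_def quo_def)

end

text \<open>A radial derivative of the source yields the second derivatives of the numerator and,
  with them, the time derivative on the axis. The source of \<open>u\<close> has one throughout the
  iteration; that of \<open>v\<close> acquires it at the fixed point.\<close>

locale wave_source_C1 = wave_source +
  fixes Gx :: field2
  assumes Gx: "cont2 Gx" and G_deriv: "\<And>s x. 0 \<le> s \<Longrightarrow> (G s has_real_derivative Gx s x) (at x)"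
begin

lemma C1_num_t: "C1 (num_t A1 \<epsilon> G) (\<lambda>t r. \<epsilon> * free_minus A2 t r + 1 / 2 * ((G t r + Pp Gx t r) + (G t r - Pm Gx t r))) (num_tr A2 \<epsilon> Gx)"
  unfolding num_t_def[abs_def] num_tr_def[abs_def]
  by (intro C1_add C1_cmult C1_free_minus A_deriv A_cont C1_Pp C1_Pm G Gx G_deriv)

text \<open>The endpoint terms \<open>G t r\<close> of the two characteristics cancel, so the mixed
  derivatives in both orders are the same \<open>num_tr\<close>.\<close>

lemma C1_num_r: "C1 (num_r A1 \<epsilon> G) (num_tr A2 \<epsilon> Gx) (\<lambda>t r. \<epsilon> * free_minus A2 t r + 1 / 2 * (Pp Gx t r - Pm Gx t r))"
proof -
  have "C1 (num_r A1 \<epsilon> G) (\<lambda>t r. \<epsilon> * free_plus A2 t r + 1 / 2 * ((G t r + Pp Gx t r) - (G t r - Pm Gx t r)))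
    (\<lambda>t r. \<epsilon> * free_minus A2 t r + 1 / 2 * (Pp Gx t r - Pm Gx t r))"
    unfolding num_r_def[abs_def]
    by (intro C1_add C1_diff C1_cmult C1_free_plus A_deriv A_cont C1_Pp C1_Pm G Gx G_deriv)
  then show ?thesis by (rule C1_cong) (auto simp: num_tr_def)
qed

lemma cont2_num_tr: "cont2 (num_tr A2 \<epsilon> Gx)"
  using C1_num_t by (simp add: C1_def)

lemma cont2_sol_t: "cont2 (sol_t A1 A2 \<epsilon> G Gx)"
  unfolding sol_t_def by (rule cont2_quo[OF cont2_num_tr C1_deriv_r[OF C1_num_t] num_t_0])

lemma sol_t_minus: "sol_t A1 A2 \<epsilon> G Gx t (- r) = sol_t A1 A2 \<epsilon> G Gx t r"
  by (simp add: sol_t_def quo_def num_t_minus)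

lemma mult_sol_t_deriv: "0 \<le> t \<Longrightarrow> ((\<lambda>x. x * sol_t A1 A2 \<epsilon> G Gx t x) has_real_derivative num_tr A2 \<epsilon> Gx t x) (at x)"
  using C1_deriv_r[OF C1_num_t] by (simp add: sol_t_def mult_quo num_t_0)

text \<open>On the axis \<open>sol\<close> is \<open>num_r\<close>, so its time derivative is the
  mixed derivative of the numerator, and that is the axis value of \<open>sol_t\<close>.\<close>

lemma sol_deriv_t:
  assumes "0 \<le> t"
  shows "((\<lambda>s. sol A A1 \<epsilon> G s r) has_real_derivative sol_t A1 A2 \<epsilon> G Gx t r) (at t within {0..})"
proof (cases "r = 0")
  case True
  then show ?thesis using C1_deriv_t[OF C1_num_r assms, of 0] by (simp add: sol_def sol_t_def quo_def)
next
  case False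
  then show ?thesis using sol_deriv_t_off_axis[OF assms False] by (simp add: sol_t_def quo_def)
qed

lemma dt_sol: "0 \<le> t \<Longrightarrow> dt (sol A A1 \<epsilon> G) t r = sol_t A1 A2 \<epsilon> G Gx t r"
  using dt_eqI[where u="sol A A1 \<epsilon> G"] sol_deriv_t by blast

lemma C2_mult_sol: "C2_on ({0..} \<times> UNIV) (\<lambda>z. snd z * sol A A1 \<epsilon> G (fst z) (snd z))"
  using C2_on_of_C1[OF C1_num C1_num_t C1_num_r] by (simp add: mult_sol)

end

lemma abs_half_le: "\<bar>x\<bar> \<le> y \<Longrightarrow> \<bar>1 / 2 * x\<bar> \<le> y" for x y :: real
  by linarith

lemma powr_weight:
  fixes a W \<delta> k :: real
  assumes "0 \<le> a" "0 < W"
  shows "(a / W) powr (k - 1) * (\<delta> / W) = a powr (k - 1) * \<delta> * W powr (- k)"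
proof -
  have "(a / W) powr (k - 1) = a powr (k - 1) / W powr (k - 1)" by (rule powr_divide)
  moreover have "W powr (k - 1) * W = W powr k" using powr_add[of W "k - 1" 1] assms by simp
  ultimately show ?thesis using assms by (simp add: powr_minus_divide mult.commute)
qed

context exponents
begin

definition adm_w :: "real \<Rightarrow> field2 \<Rightarrow> bool" where
  "adm_w a w \<longleftrightarrow> cont2 w \<and> (\<forall>s\<ge>0. \<forall>\<rho>. w s (- \<rho>) = w s \<rho>) \<and> (\<forall>s\<ge>0. \<forall>\<rho>\<ge>0. \<bar>w s \<rho>\<bar> \<le> a / W1 s \<rho>)"

text \<open>Here \<open>z\<close> stands for \<open>r \<partial>\<^sub>r v\<close>; the relation is stated through \<open>\<partial>\<^sub>r (r v) = v + z\<close>,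
  which also makes sense on the axis \<open>r = 0\<close>, where \<open>v\<close> itself need not be differentiable.\<close>

definition adm_v :: "real \<Rightarrow> field2 \<Rightarrow> field2 \<Rightarrow> bool" where
  "adm_v a v z \<longleftrightarrow> cont2 v \<and> cont2 z \<and> (\<forall>s\<ge>0. \<forall>\<rho>. v s (- \<rho>) = v s \<rho> \<and> z s (- \<rho>) = z s \<rho>) \<and>
     (\<forall>s\<ge>0. \<forall>\<rho>\<ge>0. \<bar>v s \<rho>\<bar> \<le> a / W2 s \<rho> \<and> \<bar>z s \<rho>\<bar> \<le> a / W3 s \<rho>) \<and>
     (\<forall>s\<ge>0. \<forall>x. ((\<lambda>x. x * v s x) has_real_derivative v s x + z s x) (at x))"

definition near_w :: "real \<Rightarrow> field2 \<Rightarrow> field2 \<Rightarrow> bool" where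
  "near_w \<delta> w w' \<longleftrightarrow> (\<forall>s\<ge>0. \<forall>\<rho>\<ge>0. \<bar>w s \<rho> - w' s \<rho>\<bar> \<le> \<delta> / W1 s \<rho>)"

definition near_v :: "real \<Rightarrow> field2 \<Rightarrow> field2 \<Rightarrow> field2 \<Rightarrow> field2 \<Rightarrow> bool" where
  "near_v \<delta> v z v' z' \<longleftrightarrow> (\<forall>s\<ge>0. \<forall>\<rho>\<ge>0.
     \<bar>v s \<rho> - v' s \<rho>\<bar> \<le> \<delta> / W2 s \<rho> \<and> \<bar>z s \<rho> - z' s \<rho>\<bar> \<le> \<delta> / W3 s \<rho>)"

text \<open>The free wave cancels in the difference and \<open>Dop\<close> is linear, so
  \<open>Dop_bound\<close> applies to the difference \<open>H\<close> of the sources. The Lipschitz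
  bound for the power gives \<open>H\<close> the form \<open>w_source_bound\<close> with
  \<open>K = p * a powr (p - 1) * \<delta>\<close>; the positive power of the radius
  \<open>a\<close> is what makes the map contract for small data.\<close>

lemma sol_lipschitz:
  "\<exists>C>0. \<forall>A A1 \<epsilon> w w' a \<delta>. adm_w a w \<longrightarrow> adm_w a w' \<longrightarrow> 0 \<le> a \<longrightarrow> 0 \<le> \<delta> \<longrightarrow>
    near_w \<delta> w w' \<longrightarrow>
    (\<forall>t\<ge>0. \<forall>r\<ge>0. \<bar>sol A A1 \<epsilon> (src p w) t r - sol A A1 \<epsilon> (src p w') t r\<bar> \<le> C * a powr (p - 1) * \<delta> / W2 t r \<and>
      \<bar>num_r A1 \<epsilon> (src p w) t r - num_r A1 \<epsilon> (src p w') t r\<bar> \<le> C * a powr (p - 1) * \<delta> / W3 t r)"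
proof -
  obtain C where C: "C > 0" and CB: "\<forall>G K. cont2 G \<longrightarrow> 0 \<le> K \<longrightarrow> (\<forall>s\<ge>0. \<forall>\<rho>. G s (- \<rho>) = - G s \<rho>) \<longrightarrow>
    w_source_bound K G \<longrightarrow>
    (\<forall>t\<ge>0. \<forall>r\<ge>0. \<bar>Pp G t r - Pm G t r\<bar> \<le> C * K / W3 t r \<and>
       \<bar>quo (Dop G) (\<lambda>t r. Pp G t r - Pm G t r) t r\<bar> \<le> C * K / W2 t r)"
    using Dop_bound by (elim exE conjE) (rule that)
  have p1: "1 < p" using p2 by simp
  show ?thesis
  proof (intro exI[of _ "C * p"] conjI[of "C * p > 0"] allI impI)
    show "C * p > 0" using C p2 by simp
    fix A A1 :: "real \<Rightarrow> real" and \<epsilon> :: real and w w' :: field2 and a \<delta> t r :: real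
    assume w: "adm_w a w" and w': "adm_w a w'" and a: "0 \<le> a" and \<delta>: "0 \<le> \<delta>"
      and dw: "near_w \<delta> w w'" and t: "0 \<le> t" and r: "0 \<le> r"
    have cw: "cont2 w" "cont2 w'" and ew: "\<And>s \<rho>. 0 \<le> s \<Longrightarrow> w s (- \<rho>) = w s \<rho>" "\<And>s \<rho>. 0 \<le> s \<Longrightarrow> w' s (- \<rho>) = w' s \<rho>"
      and bw: "\<And>s \<rho>. 0 \<le> s \<Longrightarrow> 0 \<le> \<rho> \<Longrightarrow> \<bar>w s \<rho>\<bar> \<le> a / W1 s \<rho>" "\<And>s \<rho>. 0 \<le> s \<Longrightarrow> 0 \<le> \<rho> \<Longrightarrow> \<bar>w' s \<rho>\<bar> \<le> a / W1 s \<rho>"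
      using w w' by (auto simp: adm_w_def)
    define H where "H = (\<lambda>s x. src p w s x - src p w' s x)"
    define K where "K = p * (a powr (p - 1) * \<delta>)"
    have cs: "cont2 (src p w)" "cont2 (src p w')" using cw p1 by (auto intro: cont2_src)
    have H: "cont2 H" unfolding H_def by (intro cont2_diff cs)
    have K: "0 \<le> K" using a \<delta> p2 by (simp add: K_def)
    have oH: "\<forall>s\<ge>0. \<forall>\<rho>. H s (- \<rho>) = - H s \<rho>"
      unfolding H_def using src_odd[of w] src_odd[of w'] ew by simp
    have pos: "\<bar>H s \<rho>\<bar> \<le> K * (jb \<rho> powr (- (p - 1)) * jb (s - \<rho>) powr (- \<mu>))" if s: "0 \<le> s" "0 \<le> \<rho>" for s \<rho>
    proof -
      define W where "W = W1 s \<rho>"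
      have W: "0 < W" using w1_pos by (simp add: W_def)
      have "\<bar>\<bar>w s \<rho>\<bar> powr p - \<bar>w' s \<rho>\<bar> powr p\<bar> \<le> p * (a / W) powr (p - 1) * \<bar>w s \<rho> - w' s \<rho>\<bar>"
        using abs_powr_diff_le[OF p1 bw(1)[OF s] bw(2)[OF s]] by (simp add: W_def)
      also have "\<dots> \<le> p * (a / W) powr (p - 1) * (\<delta> / W)"
        using dw s p2 by (intro mult_left_mono) (auto simp: W_def near_w_def)
      also have "\<dots> = K * W powr (- p)"
        using powr_weight[OF a W, of p \<delta>] unfolding K_def by (metis mult.assoc)
      also have "W powr (- p) = jb \<rho> powr (- p) * jb (s - \<rho>) powr (- \<mu>)"
        using p2 by (simp add: W_def w1_def powr_mult powr_powr)
      finally have "\<rho> * \<bar>\<bar>w s \<rho>\<bar> powr p - \<bar>w' s \<rho>\<bar> powr p\<bar> \<le> jb \<rho> * (K * (jb \<rho> powr (- p) * jb (s - \<rho>) powr (- \<mu>)))"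
        using s abs_le_jb[of \<rho>] by (intro mult_mono) auto
      moreover have "jb \<rho> * jb \<rho> powr (- p) = jb \<rho> powr (- (p - 1))"
        using powr_mult_base[of "jb \<rho>" "- p"] by simp
      moreover have "\<bar>H s \<rho>\<bar> = \<rho> * \<bar>\<bar>w s \<rho>\<bar> powr p - \<bar>w' s \<rho>\<bar> powr p\<bar>"
        using s by (simp add: H_def src_def right_diff_distrib[symmetric] abs_mult)
      ultimately show ?thesis by (metis mult.assoc mult.left_commute)
    qed
    have bH: "w_source_bound K H"
      unfolding w_source_bound_def
    proof (intro allI impI)
      fix s \<rho> :: real assume s: "0 \<le> s"
      have "\<bar>H s \<rho>\<bar> = \<bar>H s \<bar>\<rho>\<bar>\<bar>" using oH s by (simp add: abs_if)
      with pos[OF s, of "\<bar>\<rho>\<bar>"] show "\<bar>H s \<rho>\<bar> \<le> K * (jb \<rho> powr (- (p - 1)) * jb (s - \<bar>\<rho>\<bar>) powr (- \<mu>))" by simp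
    qed
    have 1: "\<bar>Pp H t r - Pm H t r\<bar> \<le> C * K / W3 t r" "\<bar>quo (Dop H) (\<lambda>t r. Pp H t r - Pm H t r) t r\<bar> \<le> C * K / W2 t r"
      using CB[rule_format, OF H K oH[rule_format] bH t r] by auto
    have e1: "num_r A1 \<epsilon> (src p w) t r - num_r A1 \<epsilon> (src p w') t r = 1 / 2 * (Pp H t r - Pm H t r)"
      unfolding H_def by (simp add: num_r_def Pp_diff[OF cs] Pm_diff[OF cs] algebra_simps)
    have "quo (Dop H) (\<lambda>t r. Pp H t r - Pm H t r) t r
        = quo (\<lambda>t r. Dop (src p w) t r - Dop (src p w') t r) (\<lambda>t r. (Pp (src p w) t r - Pm (src p w) t r) - (Pp (src p w') t r - Pm (src p w') t r)) t r"
      unfolding H_def by (simp add: quo_def Pp_diff[OF cs] Pm_diff[OF cs] Dop_diff[OF cs])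
    then have e2: "sol A A1 \<epsilon> (src p w) t r - sol A A1 \<epsilon> (src p w') t r = 1 / 2 * quo (Dop H) (\<lambda>t r. Pp H t r - Pm H t r) t r"
      unfolding sol_split quo_diff by (simp add: algebra_simps)
    have CK: "C * K = C * p * a powr (p - 1) * \<delta>" by (simp add: K_def)
    show "\<bar>sol A A1 \<epsilon> (src p w) t r - sol A A1 \<epsilon> (src p w') t r\<bar> \<le> C * p * a powr (p - 1) * \<delta> / W2 t r \<and>
      \<bar>num_r A1 \<epsilon> (src p w) t r - num_r A1 \<epsilon> (src p w') t r\<bar> \<le> C * p * a powr (p - 1) * \<delta> / W3 t r"
      unfolding e1 e2 CK[symmetric] using 1 abs_half_le by blast
  qed
qed

text \<open>As in \<open>sol_lipschitz\<close>, except that the difference of the radial derivatives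
  of the sources must be bounded too. There each \<open>z\<close> comes with \<open>1 / W3\<close>,
  which \<open>w2_le_jb_w3\<close> trades for \<open>1 / W2\<close> times a bracket, the factor
  allowed by \<open>v_source_bound\<close>.\<close>

lemma sol_t_lipschitz:
  "\<exists>C>0. \<forall>A1 A2 \<epsilon> v z v' z' a \<delta>. adm_v a v z \<longrightarrow> adm_v a v' z' \<longrightarrow> 0 \<le> a \<longrightarrow> 0 \<le> \<delta> \<longrightarrow>
    near_v \<delta> v z v' z' \<longrightarrow>
    near_w (C * a powr (q - 1) * \<delta>) (sol_t A1 A2 \<epsilon> (src q v) (src_r q v z)) (sol_t A1 A2 \<epsilon> (src q v') (src_r q v' z'))"
proof -
  obtain C where C: "C > 0" and CB: "\<forall>G Gx K. cont2 G \<longrightarrow> cont2 Gx \<longrightarrow> 0 \<le> K \<longrightarrow>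
    (\<forall>s\<ge>0. \<forall>\<rho>. (G s has_real_derivative Gx s \<rho>) (at \<rho>)) \<longrightarrow>
    (\<forall>s\<ge>0. \<forall>\<rho>. G s (- \<rho>) = - G s \<rho>) \<longrightarrow>
    v_source_bound K G \<longrightarrow> v_source_bound K Gx \<longrightarrow>
    (\<forall>t\<ge>0. \<forall>r\<ge>0. \<bar>quo (\<lambda>t r. Pp G t r + Pm G t r) (\<lambda>t r. Pp Gx t r + Pm Gx t r) t r\<bar> \<le> C * K / W1 t r)"
    using dt_Dop_bound by (elim exE conjE) (rule that)
  \<comment> \<open>The \<open>q\<close> bounds the difference of the powers. In
    \<open>3 * q\<^sup>2\<close> one \<open>q\<close> is the chain-rule factor, the other is
    \<open>(q - 1) + 1\<close> from splitting a difference of products, and 3 is the weight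
    comparison.\<close>
  define c where "c = q + 3 * q\<^sup>2"
  have c: "c > 0" using q2 by (simp add: c_def add_pos_nonneg)
  have q1: "1 < q" "1 < q - 1" using q2 by auto
  show ?thesis
    unfolding near_w_def
  proof (intro exI[of _ "C * c"] conjI allI impI)
    show "C * c > 0" using C c by simp
    fix A1 A2 :: "real \<Rightarrow> real" and \<epsilon> :: real and v z v' z' :: field2 and a \<delta> t r :: real
    assume v: "adm_v a v z" and v': "adm_v a v' z'" and a: "0 \<le> a" and \<delta>: "0 \<le> \<delta>"
      and dv: "near_v \<delta> v z v' z'"
      and t: "0 \<le> t" and r: "0 \<le> r"
    have cv: "cont2 v" "cont2 v'" "cont2 z" "cont2 z'"
      and ev: "\<And>s \<rho>. 0 \<le> s \<Longrightarrow> v s (- \<rho>) = v s \<rho>" "\<And>s \<rho>. 0 \<le> s \<Longrightarrow> v' s (- \<rho>) = v' s \<rho>"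
        "\<And>s \<rho>. 0 \<le> s \<Longrightarrow> z s (- \<rho>) = z s \<rho>" "\<And>s \<rho>. 0 \<le> s \<Longrightarrow> z' s (- \<rho>) = z' s \<rho>"
      and bv: "\<And>s \<rho>. 0 \<le> s \<Longrightarrow> 0 \<le> \<rho> \<Longrightarrow> \<bar>v s \<rho>\<bar> \<le> a / W2 s \<rho>" "\<And>s \<rho>. 0 \<le> s \<Longrightarrow> 0 \<le> \<rho> \<Longrightarrow> \<bar>v' s \<rho>\<bar> \<le> a / W2 s \<rho>"
        "\<And>s \<rho>. 0 \<le> s \<Longrightarrow> 0 \<le> \<rho> \<Longrightarrow> \<bar>z s \<rho>\<bar> \<le> a / W3 s \<rho>"
      and der: "\<And>s x. 0 \<le> s \<Longrightarrow> ((\<lambda>x. x * v s x) has_real_derivative v s x + z s x) (at x)"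
        "\<And>s x. 0 \<le> s \<Longrightarrow> ((\<lambda>x. x * v' s x) has_real_derivative v' s x + z' s x) (at x)"
      using v v' by (auto simp: adm_v_def)
    define H where "H = (\<lambda>s x. src q v s x - src q v' s x)"
    define Hx where "Hx = (\<lambda>s x. src_r q v z s x - src_r q v' z' s x)"
    define K where "K = c * (a powr (q - 1) * \<delta>)"
    have cs: "cont2 (src q v)" "cont2 (src q v')" "cont2 (src_r q v z)" "cont2 (src_r q v' z')"
      using cv q1 q2 by (auto intro: cont2_src cont2_src_r)
    have H: "cont2 H" "cont2 Hx" unfolding H_def Hx_def by (intro cont2_diff cs)+
    have K: "0 \<le> K" using a \<delta> c by (simp add: K_def)
    have oH: "\<forall>s\<ge>0. \<forall>\<rho>. H s (- \<rho>) = - H s \<rho>"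
      unfolding H_def using src_odd[of v] src_odd[of v'] ev by simp
    have eHx: "\<forall>s\<ge>0. \<forall>\<rho>. Hx s (- \<rho>) = Hx s \<rho>"
      unfolding Hx_def src_r_def using ev by simp
    have dH: "\<forall>s\<ge>0. \<forall>\<rho>. (H s has_real_derivative Hx s \<rho>) (at \<rho>)"
      unfolding H_def Hx_def
      by (intro allI impI DERIV_diff src_deriv q1 cv der)
    have pos: "\<bar>H s \<rho>\<bar> \<le> K * (jb \<rho> * W2 s \<rho> powr (- q)) \<and> \<bar>Hx s \<rho>\<bar> \<le> K * (jb \<rho> * W2 s \<rho> powr (- q))"
      if s: "0 \<le> s" "0 \<le> \<rho>" for s \<rho>
    proof -
      define W Z where "W = W2 s \<rho>" and "Z = W3 s \<rho>"
      have W: "0 < W" "0 < Z" using w2_pos w3_pos by (auto simp: W_def Z_def)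
      have bds: "\<bar>v s \<rho>\<bar> \<le> a / W" "\<bar>v' s \<rho>\<bar> \<le> a / W" "\<bar>z s \<rho>\<bar> \<le> a / Z" "\<bar>v s \<rho> - v' s \<rho>\<bar> \<le> \<delta> / W" "\<bar>z s \<rho> - z' s \<rho>\<bar> \<le> \<delta> / Z"
        using bv[OF s] dv s by (auto simp: W_def Z_def near_v_def)
      define M where "M = a powr (q - 1) * \<delta> * W powr (- q)"
      have M: "0 \<le> M" "(a / W) powr (q - 1) * (\<delta> / W) = M"
        using a \<delta> powr_weight[OF a W(1), of q \<delta>] by (auto simp: M_def)
      have "\<bar>\<bar>v s \<rho>\<bar> powr q - \<bar>v' s \<rho>\<bar> powr q\<bar> \<le> q * (a / W) powr (q - 1) * \<bar>v s \<rho> - v' s \<rho>\<bar>"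
        by (rule abs_powr_diff_le[OF q1(1) bds(1,2)])
      also have "\<dots> \<le> q * (a / W) powr (q - 1) * (\<delta> / W)"
        using bds q2 by (intro mult_left_mono) auto
      finally have F: "\<bar>\<bar>v s \<rho>\<bar> powr q - \<bar>v' s \<rho>\<bar> powr q\<bar> \<le> q * M" using M(2) by (metis mult.assoc)
      have J: "1 \<le> jb \<rho>" by (rule jb_ge_1)
      have cq: "q * M \<le> c * M" using M q2 by (intro mult_right_mono) (auto simp: c_def)
      have "\<bar>H s \<rho>\<bar> = \<rho> * \<bar>\<bar>v s \<rho>\<bar> powr q - \<bar>v' s \<rho>\<bar> powr q\<bar>"
        using s by (simp add: H_def src_def right_diff_distrib[symmetric] abs_mult)
      also have "\<dots> \<le> jb \<rho> * (c * M)"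
        using F cq s abs_le_jb[of \<rho>] by (intro mult_mono) auto
      finally have 1: "\<bar>H s \<rho>\<bar> \<le> K * (jb \<rho> * W powr (- q))" by (simp add: K_def M_def mult_ac)
      have Zle: "1 / Z \<le> 3 * jb \<rho> / W"
        using w2_le_jb_w3[OF s] W by (simp add: W_def Z_def field_simps)
      have key: "(a / W) powr (q - 1) * (\<delta> / Z) \<le> 3 * jb \<rho> * M"
      proof -
        have "(a / W) powr (q - 1) * \<delta> * (1 / Z) \<le> (a / W) powr (q - 1) * \<delta> * (3 * jb \<rho> / W)"
          using \<delta> by (intro mult_left_mono Zle) auto
        also have "\<dots> = 3 * jb \<rho> * ((a / W) powr (q - 1) * (\<delta> / W))" by simp
        finally show ?thesis unfolding M(2) by simp
      qed
      have aW: "(a / W) * (a / W) powr (q - 2) = (a / W) powr (q - 1)"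
        using powr_mult_base[of "a / W" "q - 2"] a W by simp
      have s1: "\<bar>sgn_powr (q - 1) (v s \<rho>) - sgn_powr (q - 1) (v' s \<rho>)\<bar> \<le> (q - 1) * (a / W) powr (q - 2) * (\<delta> / W)"
      proof -
        have "\<bar>sgn_powr (q - 1) (v s \<rho>) - sgn_powr (q - 1) (v' s \<rho>)\<bar> \<le> (q - 1) * (a / W) powr (q - 1 - 1) * \<bar>v s \<rho> - v' s \<rho>\<bar>"
          by (rule sgn_powr_diff_le[OF q1(2) bds(1,2)])
        also have "\<dots> \<le> (q - 1) * (a / W) powr (q - 2) * (\<delta> / W)"
        proof -
          have "q - 1 - 1 = q - 2" by simp
          then show ?thesis using bds(4) q2 by (auto intro!: mult_left_mono simp del: times_divide_eq_right)
        qed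
        finally show ?thesis .
      qed
      have s2: "\<bar>sgn_powr (q - 1) (v' s \<rho>)\<bar> \<le> (a / W) powr (q - 1)"
      proof -
        have "\<bar>sgn_powr (q - 1) (v' s \<rho>)\<bar> \<le> \<bar>v' s \<rho>\<bar> powr (q - 1)" by (simp add: sgn_powr_def abs_mult sgn_if)
        also have "\<dots> \<le> (a / W) powr (q - 1)" using bds q2 by (intro powr_mono2) auto
        finally show ?thesis .
      qed
      have "\<bar>sgn_powr (q - 1) (v s \<rho>) * z s \<rho> - sgn_powr (q - 1) (v' s \<rho>) * z' s \<rho>\<bar>
        = \<bar>(sgn_powr (q - 1) (v s \<rho>) - sgn_powr (q - 1) (v' s \<rho>)) * z s \<rho> + sgn_powr (q - 1) (v' s \<rho>) * (z s \<rho> - z' s \<rho>)\<bar>"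
        by (simp add: algebra_simps)
      also have "\<dots> \<le> \<bar>sgn_powr (q - 1) (v s \<rho>) - sgn_powr (q - 1) (v' s \<rho>)\<bar> * \<bar>z s \<rho>\<bar> + \<bar>sgn_powr (q - 1) (v' s \<rho>)\<bar> * \<bar>z s \<rho> - z' s \<rho>\<bar>"
        unfolding abs_mult[symmetric] by (rule abs_triangle_ineq)
      also have "\<dots> \<le> ((q - 1) * (a / W) powr (q - 2) * (\<delta> / W)) * (a / Z) + (a / W) powr (q - 1) * (\<delta> / Z)"
        using s1 s2 bds q2 a \<delta> W by (intro add_mono mult_mono) auto
      \<comment> \<open>Exchanging the denominators of \<open>\<delta> / W\<close> and
        \<open>a / Z\<close> completes the power of \<open>a / W\<close> to
        \<open>q - 1\<close>.\<close>
      also have "\<dots> = (q - 1) * ((a / W) * (a / W) powr (q - 2)) * (\<delta> / Z) + (a / W) powr (q - 1) * (\<delta> / Z)"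
        by (simp add: mult_ac)
      also have "\<dots> = q * ((a / W) powr (q - 1) * (\<delta> / Z))"
        unfolding aW by (simp add: algebra_simps)
      also have "\<dots> \<le> q * (3 * jb \<rho> * M)" using key q2 by (intro mult_left_mono) auto
      finally have P: "\<bar>sgn_powr (q - 1) (v s \<rho>) * z s \<rho> - sgn_powr (q - 1) (v' s \<rho>) * z' s \<rho>\<bar> \<le> q * (3 * jb \<rho> * M)" .
      have "\<bar>Hx s \<rho>\<bar> \<le> \<bar>\<bar>v s \<rho>\<bar> powr q - \<bar>v' s \<rho>\<bar> powr q\<bar> + q * \<bar>sgn_powr (q - 1) (v s \<rho>) * z s \<rho> - sgn_powr (q - 1) (v' s \<rho>) * z' s \<rho>\<bar>"
      proof -
        have "Hx s \<rho> = (\<bar>v s \<rho>\<bar> powr q - \<bar>v' s \<rho>\<bar> powr q) + q * (sgn_powr (q - 1) (v s \<rho>) * z s \<rho> - sgn_powr (q - 1) (v' s \<rho>) * z' s \<rho>)"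
          by (simp add: Hx_def src_r_def algebra_simps)
        moreover have "\<bar>q * y\<bar> = q * \<bar>y\<bar>" for y using q2 by (simp add: abs_mult)
        ultimately show ?thesis by (metis abs_triangle_ineq)
      qed
      also have "\<dots> \<le> q * M + q * (q * (3 * jb \<rho> * M))"
        using F P q2 by (intro add_mono mult_left_mono) auto
      also have "\<dots> \<le> jb \<rho> * (q * M) + q * (q * (3 * jb \<rho> * M))"
        using mult_right_mono[OF J, of "q * M"] M q2 by auto
      also have "\<dots> = K * (jb \<rho> * W powr (- q))" by (simp add: K_def M_def c_def power2_eq_square algebra_simps)
      finally show ?thesis using 1 by (simp add: W_def)
    qed
    have bH: "v_source_bound K H" "v_source_bound K Hx"
      unfolding v_source_bound_def
    proof -
      have "\<bar>H s \<rho>\<bar> = \<bar>H s \<bar>\<rho>\<bar>\<bar>" "\<bar>Hx s \<rho>\<bar> = \<bar>Hx s \<bar>\<rho>\<bar>\<bar>" if "0 \<le> s" for s \<rho>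
        using oH eHx that by (simp_all add: abs_if)
      with pos show "\<forall>s\<ge>0. \<forall>\<rho>. \<bar>H s \<rho>\<bar> \<le> K * (jb \<rho> * W2 s \<bar>\<rho>\<bar> powr (- q))"
        "\<forall>s\<ge>0. \<forall>\<rho>. \<bar>Hx s \<rho>\<bar> \<le> K * (jb \<rho> * W2 s \<bar>\<rho>\<bar> powr (- q))"
        by (metis abs_ge_zero jb_abs)+
    qed
    have 1: "\<bar>quo (\<lambda>t r. Pp H t r + Pm H t r) (\<lambda>t r. Pp Hx t r + Pm Hx t r) t r\<bar> \<le> C * K / W1 t r"
      using CB[rule_format, OF H K dH[rule_format] oH[rule_format] bH t r] by auto
    have "quo (\<lambda>t r. Pp H t r + Pm H t r) (\<lambda>t r. Pp Hx t r + Pm Hx t r) t r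
      = quo (\<lambda>t r. (Pp (src q v) t r + Pm (src q v) t r) - (Pp (src q v') t r + Pm (src q v') t r))
        (\<lambda>t r. (Pp (src_r q v z) t r + Pm (src_r q v z) t r) - (Pp (src_r q v' z') t r + Pm (src_r q v' z') t r)) t r"
      unfolding H_def Hx_def by (simp add: quo_def Pp_diff cs Pm_diff algebra_simps)
    then have e: "sol_t A1 A2 \<epsilon> (src q v) (src_r q v z) t r - sol_t A1 A2 \<epsilon> (src q v') (src_r q v' z') t r
      = 1 / 2 * quo (\<lambda>t r. Pp H t r + Pm H t r) (\<lambda>t r. Pp Hx t r + Pm Hx t r) t r"
      unfolding sol_t_split quo_diff by (simp add: algebra_simps)
    have CK: "C * K = C * c * a powr (q - 1) * \<delta>" by (simp add: K_def)
    show "\<bar>sol_t A1 A2 \<epsilon> (src q v) (src_r q v z) t r - sol_t A1 A2 \<epsilon> (src q v') (src_r q v' z') t r\<bar> \<le> C * c * a powr (q - 1) * \<delta> / W1 t r"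
      unfolding e CK[symmetric] using 1 by (rule abs_half_le)
  qed
qed

end

section \<open>The contraction\<close>

lemma Pp_cong: "(\<And>s x. 0 \<le> s \<Longrightarrow> G s x = H s x) \<Longrightarrow> Pp G t r = Pp H t r"
  unfolding Pp_def by (rule integral_cong) auto

lemma Pm_cong: "(\<And>s x. 0 \<le> s \<Longrightarrow> G s x = H s x) \<Longrightarrow> Pm G t r = Pm H t r"
  unfolding Pm_def by (rule integral_cong) auto

lemma Dop_cong: "(\<And>s x. 0 \<le> s \<Longrightarrow> G s x = H s x) \<Longrightarrow> Dop G t r = Dop H t r"
  unfolding Dop_def by (intro integral_cong) auto

lemma sol_cong: "(\<And>s x. 0 \<le> s \<Longrightarrow> G s x = H s x) \<Longrightarrow> sol A A1 \<epsilon> G t r = sol A A1 \<epsilon> H t r"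
  unfolding sol_split quo_def using Pp_cong[of G H] Pm_cong[of G H] Dop_cong[of G H] by simp

lemma sol_eq_free_plus_Lop:
  assumes "r \<noteq> 0" "\<And>s x. 0 \<le> s \<Longrightarrow> G s x = x * F s x" "U0 f g t r = free_minus A t r / r"
  shows "\<epsilon> * U0 f g t r + Lop F t r = sol A A1 \<epsilon> G t r"
proof -
  have "Dop G t r = Dop (\<lambda>s x. x * F s x) t r" by (rule Dop_cong) (rule assms(2))
  then show ?thesis using assms(1,3) by (simp add: sol_split quo_def Lop_def Dop_def)
qed

lemma eq_at_0:
  fixes F H :: "real \<Rightarrow> real"
  assumes "isCont F 0" "isCont H 0" "\<And>x. x \<noteq> 0 \<Longrightarrow> F x = H x"
  shows "F 0 = H 0"
proof -
  have "(H \<longlongrightarrow> F 0) (at 0)"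
    using assms(1) unfolding isCont_def
    by (rule Lim_transform_eventually) (use assms(3) in \<open>auto simp: eventually_at_filter\<close>)
  then show ?thesis using assms(2) unfolding isCont_def using LIM_unique by blast
qed

text \<open>The integral equations are given for \<open>r \<noteq> 0\<close>; continuity carries
  their consequences over to the axis.\<close>

lemma cont2_eq_everywhere:
  assumes "cont2 F" "cont2 H" "\<And>t x. 0 \<le> t \<Longrightarrow> x \<noteq> 0 \<Longrightarrow> F t x = H t x" "0 \<le> t"
  shows "F t x = H t x"
proof (cases "x = 0")
  case True
  have "isCont (F t) 0" "isCont (H t) 0"
    using cont2_slice[OF assms(1,4), of UNIV] cont2_slice[OF assms(2,4), of UNIV]
    by (simp_all add: continuous_on_eq_continuous_at)
  from eq_at_0[OF this] assms(3,4) True show ?thesis by simp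
qed (use assms in auto)

text \<open>\<open>A\<close> is the profile of the free part of \<open>u\<close>, \<open>B\<close>
  that of \<open>v\<close>.\<close>

locale wave_system = exponents +
  fixes A A1 A2 B B1 B2 :: "real \<Rightarrow> real" and R R' :: real
  assumes profA: "free_profile A A1 A2 R" and profB: "free_profile B B1 B2 R'"
begin

definition vmap :: "real \<Rightarrow> field2 \<Rightarrow> field2" where
  "vmap \<epsilon> w = sol B B1 \<epsilon> (src p w)"

text \<open>By the product rule this is \<open>r\<close> times the radial derivative of
  \<open>v\<close>, written without differentiating \<open>v\<close> on the axis.\<close>

definition zmap :: "real \<Rightarrow> field2 \<Rightarrow> field2" where
  "zmap \<epsilon> w t r = num_r B1 \<epsilon> (src p w) t r - vmap \<epsilon> w t r"

definition wmap :: "real \<Rightarrow> field2 \<Rightarrow> field2" where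
  "wmap \<epsilon> w = sol_t A1 A2 \<epsilon> (src q (vmap \<epsilon> w)) (src_r q (vmap \<epsilon> w) (zmap \<epsilon> w))"

lemma wave_source_v:
  assumes "adm_w a w"
  shows "wave_source B B1 B2 R' (src p w)"
proof
  show "cont2 (src p w)" using assms p2 by (intro cont2_src) (auto simp: adm_w_def)
  show "src p w s (- x) = - src p w s x" if "0 \<le> s" for s x
    using assms that by (intro src_odd) (auto simp: adm_w_def)
qed (rule profB)

lemma vmap_regular:
  assumes "adm_w a w"
  shows "cont2 (vmap \<epsilon> w)" "cont2 (zmap \<epsilon> w)" "vmap \<epsilon> w s (- x) = vmap \<epsilon> w s x" "zmap \<epsilon> w s (- x) = zmap \<epsilon> w s x"
    "0 \<le> s \<Longrightarrow> ((\<lambda>x. x * vmap \<epsilon> w s x) has_real_derivative vmap \<epsilon> w s x + zmap \<epsilon> w s x) (at x)"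
proof -
  interpret S: wave_source B B1 B2 R' \<epsilon> "src p w" by (rule wave_source_v[OF assms])
  show "cont2 (vmap \<epsilon> w)" unfolding vmap_def by (rule S.cont2_sol)
  show "cont2 (zmap \<epsilon> w)" unfolding zmap_def[abs_def] vmap_def by (intro cont2_diff S.cont2_sol S.cont2_num_r)
  show "vmap \<epsilon> w s (- x) = vmap \<epsilon> w s x" "zmap \<epsilon> w s (- x) = zmap \<epsilon> w s x"
    unfolding zmap_def vmap_def by (simp_all add: S.sol_minus S.num_r_minus)
  show "0 \<le> s \<Longrightarrow> ((\<lambda>x. x * vmap \<epsilon> w s x) has_real_derivative vmap \<epsilon> w s x + zmap \<epsilon> w s x) (at x)"
    unfolding zmap_def vmap_def using S.mult_sol_deriv by simp
qed

lemma wave_source_u: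
  assumes "adm_w a w"
  shows "wave_source_C1 A A1 A2 R (src q (vmap \<epsilon> w)) (src_r q (vmap \<epsilon> w) (zmap \<epsilon> w))"
proof
  note V = vmap_regular[OF assms, where \<epsilon>=\<epsilon>]
  show "cont2 (src q (vmap \<epsilon> w))" using q2 by (intro cont2_src V) auto
  show "src q (vmap \<epsilon> w) s (- x) = - src q (vmap \<epsilon> w) s x" for s x by (intro src_odd V)
  show "cont2 (src_r q (vmap \<epsilon> w) (zmap \<epsilon> w))" using q2 by (intro cont2_src_r V) auto
  show "(src q (vmap \<epsilon> w) s has_real_derivative src_r q (vmap \<epsilon> w) (zmap \<epsilon> w) s x) (at x)" if "0 \<le> s" for s x
    by (rule src_deriv) (use q2 V that in auto)
qed (rule profA)

lemma wmap_regular: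
  assumes "adm_w a w"
  shows "cont2 (wmap \<epsilon> w)" "wmap \<epsilon> w s (- x) = wmap \<epsilon> w s x"
proof -
  interpret S: wave_source_C1 A A1 A2 R \<epsilon> "src q (vmap \<epsilon> w)" "src_r q (vmap \<epsilon> w) (zmap \<epsilon> w)"
    by (rule wave_source_u[OF assms])
  show "cont2 (wmap \<epsilon> w)" unfolding wmap_def by (rule S.cont2_sol_t)
  show "wmap \<epsilon> w s (- x) = wmap \<epsilon> w s x" unfolding wmap_def by (rule S.sol_t_minus)
qed

text \<open>The images are required in balls of radius \<open>a / 3\<close> because
  \<open>wnorm\<close> adds three suprema; their sum is then at most \<open>a\<close>, the radius of
  the ball in which uniqueness is proved.\<close>

definition contracts :: "real \<Rightarrow> real \<Rightarrow> bool" where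
  "contracts a \<epsilon> \<longleftrightarrow>
    (\<forall>w. adm_w a w \<longrightarrow> adm_v (a / 3) (vmap \<epsilon> w) (zmap \<epsilon> w) \<and> adm_w (a / 3) (wmap \<epsilon> w)) \<and>
    (\<forall>w w' \<delta>. adm_w a w \<longrightarrow> adm_w a w' \<longrightarrow> 0 \<le> \<delta> \<longrightarrow> near_w \<delta> w w' \<longrightarrow>
      near_w (\<delta> / 2) (wmap \<epsilon> w) (wmap \<epsilon> w'))"

text \<open>Size bounds are Lipschitz bounds against the zero field, whose image is the free wave.
  With \<open>a = M * \<epsilon>\<close> and \<open>M = 6 * c\<close>, the free and the nonlinear
  part of \<open>w\<close> are at most \<open>a / 6\<close> each. For \<open>v\<close> and for the
  derivative of \<open>r v\<close> both parts are at most \<open>a / 12\<close>, because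
  \<open>z\<close> is the difference of these two fields; hence the factor 2 in \<open>c\<close> and
  in \<open>C\<close>.\<close>

lemma small_data_contraction:
  "\<exists>M>0. \<exists>e0>0. \<forall>\<epsilon>. 0 < \<epsilon> \<and> \<epsilon> < e0 \<longrightarrow> contracts (M * \<epsilon>) \<epsilon>"
proof -
  obtain cA where cA: "cA > 0" and cAB: "\<forall>t\<ge>0. \<forall>r\<ge>0. \<bar>quo (free_minus A1) (free_plus A2) t r\<bar> \<le> cA / W1 t r \<and>
    \<bar>quo (free_minus A) (free_plus A1) t r\<bar> \<le> cA / W2 t r \<and> \<bar>free_plus A1 t r\<bar> \<le> cA / W3 t r"
    using free_bounds[OF profA] by blast
  obtain cB where cB: "cB > 0" and cBB: "\<forall>t\<ge>0. \<forall>r\<ge>0. \<bar>quo (free_minus B1) (free_plus B2) t r\<bar> \<le> cB / W1 t r \<and>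
    \<bar>quo (free_minus B) (free_plus B1) t r\<bar> \<le> cB / W2 t r \<and> \<bar>free_plus B1 t r\<bar> \<le> cB / W3 t r"
    using free_bounds[OF profB] by blast
  obtain C1 where C1: "C1 > 0" and C1B: "\<forall>A A1 \<epsilon> w w' a \<delta>. adm_w a w \<longrightarrow> adm_w a w' \<longrightarrow> 0 \<le> a \<longrightarrow> 0 \<le> \<delta> \<longrightarrow>
    near_w \<delta> w w' \<longrightarrow>
    (\<forall>t\<ge>0. \<forall>r\<ge>0. \<bar>sol A A1 \<epsilon> (src p w) t r - sol A A1 \<epsilon> (src p w') t r\<bar> \<le> C1 * a powr (p - 1) * \<delta> / W2 t r \<and>
      \<bar>num_r A1 \<epsilon> (src p w) t r - num_r A1 \<epsilon> (src p w') t r\<bar> \<le> C1 * a powr (p - 1) * \<delta> / W3 t r)"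
    using sol_lipschitz by (elim exE conjE) (rule that)
  obtain C2 where C2: "C2 > 0" and C2B: "\<forall>A1 A2 \<epsilon> v z v' z' a \<delta>. adm_v a v z \<longrightarrow> adm_v a v' z' \<longrightarrow> 0 \<le> a \<longrightarrow> 0 \<le> \<delta> \<longrightarrow>
    near_v \<delta> v z v' z' \<longrightarrow>
    near_w (C2 * a powr (q - 1) * \<delta>) (sol_t A1 A2 \<epsilon> (src q v) (src_r q v z)) (sol_t A1 A2 \<epsilon> (src q v') (src_r q v' z'))"
    using sol_t_lipschitz by (elim exE conjE) (rule that)
  define c where "c = 2 * max cA cB"
  define C where "C = 2 * max C1 C2"
  have c: "c > 0" "cA \<le> c" "2 * cB \<le> c" using cA cB by (auto simp: c_def)
  have C: "C > 0" "C2 \<le> C" "2 * C1 \<le> C" using C1 C2 by (auto simp: C_def)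
  define M where "M = 6 * c"
  \<comment> \<open>The first entry gives \<open>a \<le> 1\<close>, so that
    \<open>a powr k \<le> a\<close> for \<open>k \<ge> 1\<close>, to be used with
    \<open>k = p - 1\<close> and \<open>k = q - 1\<close>; the second gives
    \<open>C * a \<le> 1 / 6\<close>.\<close>
  define e0 where "e0 = min (1 / M) (1 / (6 * C * M))"
  have M: "M > 0" using c by (simp add: M_def)
  show ?thesis
  proof (rule exI[of _ M], intro conjI[OF M], rule exI[of _ e0], unfold contracts_def, intro conjI allI impI)
    show "e0 > 0" using M C by (simp add: e0_def)
    fix \<epsilon> :: real assume \<epsilon>: "0 < \<epsilon> \<and> \<epsilon> < e0"
    define a where "a = M * \<epsilon>"
    have a: "0 < a" "a \<le> 1" "C * a \<le> 1 / 6"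
    proof -
      show "0 < a" using M \<epsilon> by (simp add: a_def)
      have "\<epsilon> < 1 / M" "\<epsilon> < 1 / (6 * C * M)" using \<epsilon> by (auto simp: e0_def)
      then show "a \<le> 1" "C * a \<le> 1 / 6" using M C by (auto simp: a_def field_simps)
    qed
    have c\<epsilon>: "c * \<epsilon> = a / 6" by (simp add: a_def M_def)
    have pw: "C * x powr k \<le> 1 / 6" if "0 < x" "x \<le> a" "1 \<le> k" for x k
    proof -
      have "x powr k \<le> x powr 1" using that a by (intro powr_mono') auto
      then have "x powr k \<le> a" using that by simp
      then have "C * x powr k \<le> C * a" using C by (intro mult_left_mono) auto
      then show ?thesis using a by linarith
    qed
    have zero_w: "adm_w a (\<lambda>_ _. 0)" using a w1_pos by (simp add: adm_w_def cont2_const less_imp_le)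
    have zero_v: "adm_v a (\<lambda>_ _. 0) (\<lambda>_ _. 0)"
      using a w2_pos w3_pos by (simp add: adm_v_def cont2_const less_imp_le)
    have src0: "src k (\<lambda>_ _. 0) = (\<lambda>_ _. 0)" "src_r k (\<lambda>_ _. 0) (\<lambda>_ _. 0) = (\<lambda>_ _. 0)" for k
      by (auto simp: src_def src_r_def fun_eq_iff)
    have P0: "Pp (\<lambda>_ _. 0) = (\<lambda>_ _. 0)" "Pm (\<lambda>_ _. 0) = (\<lambda>_ _. 0)" "Dop (\<lambda>_ _. 0) = (\<lambda>_ _. 0)"
      by (auto simp: fun_eq_iff Pp_def Pm_def Dop_def)
    have v_diff: "\<bar>vmap \<epsilon> w t r - vmap \<epsilon> w' t r\<bar> \<le> (\<delta> / 6) / W2 t r \<and> \<bar>zmap \<epsilon> w t r - zmap \<epsilon> w' t r\<bar> \<le> (\<delta> / 6) / W3 t r \<and>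
        \<bar>vmap \<epsilon> w t r - vmap \<epsilon> w' t r\<bar> \<le> (\<delta> / 12) / W2 t r \<and> \<bar>num_r B1 \<epsilon> (src p w) t r - num_r B1 \<epsilon> (src p w') t r\<bar> \<le> (\<delta> / 12) / W3 t r"
      if w: "adm_w a w" "adm_w a w'" and \<delta>: "0 \<le> \<delta>" and dw: "near_w \<delta> w w'"
        and t: "0 \<le> t" and r: "0 \<le> r" for w w' \<delta> t r
    proof -
      have 1: "\<bar>vmap \<epsilon> w t r - vmap \<epsilon> w' t r\<bar> \<le> C1 * a powr (p - 1) * \<delta> / W2 t r"
        "\<bar>num_r B1 \<epsilon> (src p w) t r - num_r B1 \<epsilon> (src p w') t r\<bar> \<le> C1 * a powr (p - 1) * \<delta> / W3 t r"
        using C1B[rule_format, OF w less_imp_le[OF a(1)] \<delta> dw t r] by (auto simp: vmap_def)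
      have "2 * C1 * a powr (p - 1) \<le> C * a powr (p - 1)" using C by (intro mult_right_mono) auto
      also have "\<dots> \<le> 1 / 6" using a p2 by (intro pw) auto
      finally have "C1 * a powr (p - 1) \<le> 1 / 12" by simp
      then have "C1 * a powr (p - 1) * \<delta> \<le> 1 / 12 * \<delta>" using \<delta> by (intro mult_right_mono)
      then have k: "C1 * a powr (p - 1) * \<delta> \<le> \<delta> / 12" by simp
      have 2: "\<bar>vmap \<epsilon> w t r - vmap \<epsilon> w' t r\<bar> \<le> (\<delta> / 12) / W2 t r"
        "\<bar>num_r B1 \<epsilon> (src p w) t r - num_r B1 \<epsilon> (src p w') t r\<bar> \<le> (\<delta> / 12) / W3 t r"
        using 1 divide_right_mono[OF k less_imp_le[OF w2_pos[of t r]]] divide_right_mono[OF k less_imp_le[OF w3_pos[of t r]]] by linarith+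
      have 3: "(\<delta> / 12) / W2 t r \<le> (\<delta> / 12) / W3 t r"
        using w3_le_w2[OF t r] w3_pos[of t r] \<delta> by (intro divide_left_mono) (auto simp: w2_pos)
      have 4: "(\<delta> / 12) / W2 t r \<le> (\<delta> / 6) / W2 t r" using \<delta> w2_pos[of t r] by (intro divide_right_mono) auto
      have 5: "(\<delta> / 12) / W3 t r + (\<delta> / 12) / W3 t r = (\<delta> / 6) / W3 t r" by (simp add: add_divide_distrib[symmetric])
      show ?thesis using 2 3 4 5 unfolding zmap_def by linarith
    qed
    have v_bound: "adm_v (a / 3) (vmap \<epsilon> w) (zmap \<epsilon> w)" if w: "adm_w a w" for w
    proof -
      note V = vmap_regular[OF w, where \<epsilon>=\<epsilon>]
      have "\<bar>vmap \<epsilon> w t r\<bar> \<le> (a / 3) / W2 t r \<and> \<bar>zmap \<epsilon> w t r\<bar> \<le> (a / 3) / W3 t r" if t: "0 \<le> t" and r: "0 \<le> r" for t r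
      proof -
        have v0: "vmap \<epsilon> (\<lambda>_ _. 0) t r = \<epsilon> * quo (free_minus B) (free_plus B1) t r"
          "num_r B1 \<epsilon> (src p (\<lambda>_ _. 0)) t r = \<epsilon> * free_plus B1 t r"
          unfolding vmap_def sol_split num_r_def src0 P0 by (simp_all add: quo_def)
        have "2 * cB * \<epsilon> \<le> c * \<epsilon>" using c \<epsilon> by (intro mult_right_mono) auto
        then have h: "\<epsilon> * cB \<le> a / 12" unfolding c\<epsilon> by (simp add: mult.commute)
        have "\<bar>vmap \<epsilon> (\<lambda>_ _. 0) t r\<bar> \<le> \<epsilon> * (cB / W2 t r)" "\<bar>num_r B1 \<epsilon> (src p (\<lambda>_ _. 0)) t r\<bar> \<le> \<epsilon> * (cB / W3 t r)"
          unfolding v0 abs_mult using cBB t r \<epsilon> by (auto intro!: mult_left_mono simp del: times_divide_eq_right)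
        moreover have "\<epsilon> * (cB / W2 t r) \<le> (a / 12) / W2 t r" "\<epsilon> * (cB / W3 t r) \<le> (a / 12) / W3 t r"
          using divide_right_mono[OF h less_imp_le[OF w2_pos[of t r]]] divide_right_mono[OF h less_imp_le[OF w3_pos[of t r]]] by simp_all
        moreover have "\<bar>vmap \<epsilon> w t r - vmap \<epsilon> (\<lambda>_ _. 0) t r\<bar> \<le> (a / 12) / W2 t r"
          "\<bar>num_r B1 \<epsilon> (src p w) t r - num_r B1 \<epsilon> (src p (\<lambda>_ _. 0)) t r\<bar> \<le> (a / 12) / W3 t r"
          using v_diff[OF w zero_w less_imp_le[OF a(1)] _ t r] w by (auto simp: adm_w_def near_w_def)
        moreover have "(a / 12) / W + (a / 12) / W = (a / 6) / W" for W :: real by (simp add: add_divide_distrib[symmetric])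
        ultimately have 1: "\<bar>vmap \<epsilon> w t r\<bar> \<le> (a / 6) / W2 t r" "\<bar>num_r B1 \<epsilon> (src p w) t r\<bar> \<le> (a / 6) / W3 t r"
          by (smt (verit))+
        have 3: "(a / 6) / W2 t r \<le> (a / 6) / W3 t r"
          using w3_le_w2[OF t r] w3_pos[of t r] a by (intro divide_left_mono) (auto simp: w2_pos)
        have 4: "(a / 6) / W2 t r \<le> (a / 3) / W2 t r" using a w2_pos[of t r] by (intro divide_right_mono) auto
        have 5: "(a / 6) / W3 t r + (a / 6) / W3 t r = (a / 3) / W3 t r" by (simp add: add_divide_distrib[symmetric])
        show ?thesis using 1 3 4 5 unfolding zmap_def by linarith
      qed
      then show ?thesis unfolding adm_v_def using V by blast
    qed
    have v_bound': "adm_v a (vmap \<epsilon> w) (zmap \<epsilon> w)" if "adm_w a w" for w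
    proof -
      have "(a / 3) / W \<le> a / W" if "0 < W" for W using a that by (intro divide_right_mono) auto
      then have "(a / 3) / W2 s x \<le> a / W2 s x" "(a / 3) / W3 s x \<le> a / W3 s x" for s x
        using w2_pos w3_pos by auto
      then show ?thesis using v_bound[OF that] unfolding adm_v_def by (meson order_trans)
    qed
    have C2a: "C2 * a powr (q - 1) * \<delta> \<le> \<delta> / 6" if "0 \<le> \<delta>" for \<delta>
    proof -
      have "C2 * a powr (q - 1) \<le> C * a powr (q - 1)" using C by (intro mult_right_mono) auto
      also have "\<dots> \<le> 1 / 6" using a q2 by (intro pw) auto
      finally have "C2 * a powr (q - 1) * \<delta> \<le> 1 / 6 * \<delta>" using that by (intro mult_right_mono)
      then show ?thesis by simp
    qed
    have w_diff: "\<bar>sol_t A1 A2 \<epsilon> (src q v) (src_r q v z) t r - sol_t A1 A2 \<epsilon> (src q v') (src_r q v' z') t r\<bar> \<le> (\<delta> / 6) / W1 t r"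
      if "adm_v a v z" "adm_v a v' z'" "0 \<le> \<delta>"
        "near_v \<delta> v z v' z'" "0 \<le> t" "0 \<le> r" for v z v' z' \<delta> t r
    proof -
      have "near_w (C2 * a powr (q - 1) * \<delta>) (sol_t A1 A2 \<epsilon> (src q v) (src_r q v z)) (sol_t A1 A2 \<epsilon> (src q v') (src_r q v' z'))"
        using C2B less_imp_le[OF a(1)] that by blast
      then have "\<bar>sol_t A1 A2 \<epsilon> (src q v) (src_r q v z) t r - sol_t A1 A2 \<epsilon> (src q v') (src_r q v' z') t r\<bar> \<le> C2 * a powr (q - 1) * \<delta> / W1 t r"
        using that by (simp add: near_w_def)
      also have "\<dots> \<le> (\<delta> / 6) / W1 t r"
        by (rule divide_right_mono[OF C2a[OF that(3)] less_imp_le[OF w1_pos]])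
      finally show ?thesis .
    qed
    show "adm_v (M * \<epsilon> / 3) (vmap \<epsilon> w) (zmap \<epsilon> w)" if "adm_w (M * \<epsilon>) w" for w
      using v_bound that by (simp add: a_def)
    show "adm_w (M * \<epsilon> / 3) (wmap \<epsilon> w)" if w: "adm_w (M * \<epsilon>) w" for w
    proof -
      have wa: "adm_w a w" using w by (simp add: a_def)
      have "\<bar>wmap \<epsilon> w t r\<bar> \<le> (a / 3) / W1 t r" if t: "0 \<le> t" and r: "0 \<le> r" for t r
      proof -
        have w0: "sol_t A1 A2 \<epsilon> (src q (\<lambda>_ _. 0)) (src_r q (\<lambda>_ _. 0) (\<lambda>_ _. 0)) t r = \<epsilon> * quo (free_minus A1) (free_plus A2) t r"
          unfolding sol_t_split src0 P0 by (simp add: quo_def)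
        have "cA * \<epsilon> \<le> c * \<epsilon>" using c \<epsilon> by (intro mult_right_mono) auto
        then have h: "\<epsilon> * cA \<le> a / 6" unfolding c\<epsilon> by (simp add: mult.commute)
        have "\<bar>\<epsilon> * quo (free_minus A1) (free_plus A2) t r\<bar> \<le> \<epsilon> * (cA / W1 t r)"
          unfolding abs_mult using cAB t r \<epsilon> by (auto intro!: mult_left_mono simp del: times_divide_eq_right)
        moreover have "\<epsilon> * (cA / W1 t r) \<le> (a / 6) / W1 t r"
          using divide_right_mono[OF h less_imp_le[OF w1_pos[of t r]]] by simp
        moreover have "\<bar>wmap \<epsilon> w t r - \<epsilon> * quo (free_minus A1) (free_plus A2) t r\<bar> \<le> (a / 6) / W1 t r"
          using w_diff[OF v_bound'[OF wa] zero_v less_imp_le[OF a(1)] _ t r] v_bound'[OF wa]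
          unfolding w0 by (auto simp: adm_v_def wmap_def near_v_def)
        moreover have "(a / 6) / W + (a / 6) / W = (a / 3) / W" for W :: real by (simp add: add_divide_distrib[symmetric])
        ultimately show ?thesis by (smt (verit))
      qed
      then show ?thesis unfolding adm_w_def using wmap_regular[OF w, where \<epsilon>=\<epsilon>] by (auto simp: a_def)
    qed
    show "near_w (\<delta> / 2) (wmap \<epsilon> w) (wmap \<epsilon> w')"
      if w: "adm_w (M * \<epsilon>) w" "adm_w (M * \<epsilon>) w'" and \<delta>: "0 \<le> \<delta>" and dw: "near_w \<delta> w w'" for w w' \<delta>
      unfolding near_w_def
    proof (intro allI impI)
      fix t r :: real assume t: "0 \<le> t" and r: "0 \<le> r"
      have wa: "adm_w a w" "adm_w a w'" using w by (simp_all add: a_def)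
      have "near_v (\<delta> / 6) (vmap \<epsilon> w) (zmap \<epsilon> w) (vmap \<epsilon> w') (zmap \<epsilon> w')"
        unfolding near_v_def using v_diff[OF wa \<delta> dw] by blast
      from w_diff[OF v_bound'[OF wa(1)] v_bound'[OF wa(2)] _ this t r] \<delta>
      have "\<bar>wmap \<epsilon> w t r - wmap \<epsilon> w' t r\<bar> \<le> (\<delta> / 6 / 6) / W1 t r" by (simp add: wmap_def)
      \<comment> \<open>Each of the two maps contracts by 1/6; the cruder factor 1/2 is enough for
        the iteration.\<close>
      also have "\<dots> \<le> (\<delta> / 2) / W1 t r" using \<delta> w1_pos[of t r] by (intro divide_right_mono) auto
      finally show "\<bar>wmap \<epsilon> w t r - wmap \<epsilon> w' t r\<bar> \<le> (\<delta> / 2) / W1 t r" .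
    qed
  qed
qed

end

context wave_system
begin

text \<open>Multiplication by the weight turns the ball of fields \<open>w\<close> into a closed
  ball of bounded continuous functions under the sup norm, where Banach's theorem applies. Those
  functions live on the whole plane, so fields are extended by clamping \<open>t\<close> at 0 and by
  evenness in \<open>r\<close>.\<close>

lemma contraction_fixed_point:
  assumes a: "0 < a" and contr: "contracts a \<epsilon>"
  shows "\<exists>w. adm_w a w \<and> (\<forall>t\<ge>0. \<forall>r. wmap \<epsilon> w t r = w t r)"
proof -
  have inv: "adm_w (a / 3) (wmap \<epsilon> w)" if "adm_w a w" for w using contr that by (simp add: contracts_def)
  define W where "W z = W1 (max (fst z) 0) \<bar>snd z\<bar>" for z :: "real \<times> real"
  have W: "0 < W z" for z by (simp add: W_def w1_pos)
  have Wc: "continuous_on X W" for X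
  proof -
    have "continuous_on X (\<lambda>z. jb \<bar>snd z\<bar> powr 1 * jb (max (fst z) 0 - \<bar>snd z\<bar>) powr (\<mu> / p))"
      by (intro continuous_intros)
    then show ?thesis by (simp add: W_def[abs_def] w1_def)
  qed
  define wf :: "((real \<times> real) \<Rightarrow>\<^sub>C real) \<Rightarrow> real \<Rightarrow> real \<Rightarrow> real"
    where "wf \<phi> t r = apply_bcontfun \<phi> (max t 0, \<bar>r\<bar>) / W (t, r)" for \<phi> t r
  define \<Phi> where "\<Phi> \<phi> = (\<lambda>z. W z * wmap \<epsilon> (wf \<phi>) (max (fst z) 0) \<bar>snd z\<bar>)" for \<phi>
  have adm: "adm_w a (wf \<phi>)" if \<phi>: "\<phi> \<in> cball 0 a" for \<phi>
    unfolding adm_w_def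
  proof (intro conjI allI impI)
    show "cont2 (wf \<phi>)"
      unfolding cont2_def wf_def
      using W by (auto intro!: continuous_intros continuous_on_compose2[OF continuous_on_apply_bcontfun[of UNIV \<phi>]]
          continuous_on_compose2[OF Wc[of UNIV]] simp: less_imp_neq[symmetric])
    show "wf \<phi> s (- \<rho>) = wf \<phi> s \<rho>" for s \<rho> by (simp add: wf_def W_def)
    fix s \<rho> :: real assume s: "0 \<le> s" "0 \<le> \<rho>"
    have "\<bar>apply_bcontfun \<phi> (max s 0, \<bar>\<rho>\<bar>)\<bar> \<le> norm \<phi>" using norm_bounded[of \<phi> "(max s 0, \<bar>\<rho>\<bar>)"] by simp
    also have "\<dots> \<le> a" using \<phi> by (simp add: dist_norm)
    finally have "\<bar>wf \<phi> s \<rho>\<bar> \<le> a / W (s, \<rho>)"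
      using W[of "(s, \<rho>)"] by (simp add: wf_def divide_right_mono)
    then show "\<bar>wf \<phi> s \<rho>\<bar> \<le> a / W1 s \<rho>" using s by (simp add: W_def)
  qed
  have \<Phi>b: "norm (\<Phi> \<phi> z) \<le> a / 3" if "\<phi> \<in> cball 0 a" for \<phi> z
  proof -
    have "\<bar>wmap \<epsilon> (wf \<phi>) (max (fst z) 0) \<bar>snd z\<bar>\<bar> \<le> (a / 3) / W z"
      using inv[OF adm[OF that]] by (simp add: adm_w_def W_def)
    then have "W z * \<bar>wmap \<epsilon> (wf \<phi>) (max (fst z) 0) \<bar>snd z\<bar>\<bar> \<le> a / 3"
      unfolding pos_le_divide_eq[OF W] by (subst mult.commute)
    then show ?thesis unfolding \<Phi>_def real_norm_def abs_mult abs_of_pos[OF W] .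
  qed
  have \<Phi>c: "\<Phi> \<phi> \<in> bcontfun" if "\<phi> \<in> cball 0 a" for \<phi>
  proof (rule bcontfun_normI[OF _ \<Phi>b[OF that]])
    have "cont2 (wmap \<epsilon> (wf \<phi>))" using inv[OF adm[OF that]] by (simp add: adm_w_def)
    then have "continuous_on UNIV (\<lambda>z. wmap \<epsilon> (wf \<phi>) (max (fst z) 0) \<bar>snd z\<bar>)"
      by (rule cont2_compose) (auto intro!: continuous_intros)
    then show "continuous_on UNIV (\<Phi> \<phi>)"
      unfolding \<Phi>_def by (intro continuous_on_mult Wc)
  qed
  have app: "apply_bcontfun (Bcontfun (\<Phi> \<phi>)) = \<Phi> \<phi>" if "\<phi> \<in> cball 0 a" for \<phi>
    by (rule Bcontfun_inverse[OF \<Phi>c[OF that]])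
  have "\<exists>!\<phi>\<in>cball 0 a. Bcontfun (\<Phi> \<phi>) = \<phi>"
  proof (rule Banach_fix[where c="1 / 2"])
    show "complete (cball 0 a :: ((real \<times> real) \<Rightarrow>\<^sub>C real) set)" by (simp add: complete_eq_closed)
    show "cball 0 a \<noteq> ({} :: ((real \<times> real) \<Rightarrow>\<^sub>C real) set)" using a by simp
    show "(\<lambda>\<phi>. Bcontfun (\<Phi> \<phi>)) ` cball 0 a \<subseteq> cball 0 a"
    proof
      fix \<psi> assume "\<psi> \<in> (\<lambda>\<phi>. Bcontfun (\<Phi> \<phi>)) ` cball 0 a"
      then obtain \<phi> where \<phi>: "\<phi> \<in> cball 0 a" "\<psi> = Bcontfun (\<Phi> \<phi>)" by blast
      have "norm \<psi> \<le> a / 3" by (rule norm_bound) (use \<Phi>b[OF \<phi>(1)] in \<open>simp add: \<phi>(2) app[OF \<phi>(1)]\<close>)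
      then show "\<psi> \<in> cball 0 a" using a by (simp add: dist_norm)
    qed
    fix \<phi> \<psi> :: "(real \<times> real) \<Rightarrow>\<^sub>C real" assume \<phi>: "\<phi> \<in> cball 0 a" and \<psi>: "\<psi> \<in> cball 0 a"
    have d: "near_w (dist \<phi> \<psi>) (wf \<phi>) (wf \<psi>)"
      unfolding near_w_def
    proof (intro allI impI)
      fix s \<rho> :: real assume s: "0 \<le> s" "0 \<le> \<rho>"
      have "\<bar>apply_bcontfun \<phi> (max s 0, \<bar>\<rho>\<bar>) - apply_bcontfun \<psi> (max s 0, \<bar>\<rho>\<bar>)\<bar> \<le> dist \<phi> \<psi>"
        using dist_bounded[of \<phi> "(max s 0, \<bar>\<rho>\<bar>)" \<psi>] by (simp add: dist_real_def)
      then have "\<bar>wf \<phi> s \<rho> - wf \<psi> s \<rho>\<bar> \<le> dist \<phi> \<psi> / W (s, \<rho>)"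
        using W[of "(s, \<rho>)"] by (simp add: wf_def diff_divide_distrib[symmetric] divide_right_mono)
      then show "\<bar>wf \<phi> s \<rho> - wf \<psi> s \<rho>\<bar> \<le> dist \<phi> \<psi> / W1 s \<rho>" using s by (simp add: W_def)
    qed
    show "dist (Bcontfun (\<Phi> \<phi>)) (Bcontfun (\<Phi> \<psi>)) \<le> 1 / 2 * dist \<phi> \<psi>"
    proof (rule dist_bound)
      fix z
      have "\<bar>wmap \<epsilon> (wf \<phi>) (max (fst z) 0) \<bar>snd z\<bar> - wmap \<epsilon> (wf \<psi>) (max (fst z) 0) \<bar>snd z\<bar>\<bar> \<le> (dist \<phi> \<psi> / 2) / W z"
        using contr adm[OF \<phi>] adm[OF \<psi>] d by (simp add: contracts_def near_w_def W_def)
      then have "W z * \<bar>wmap \<epsilon> (wf \<phi>) (max (fst z) 0) \<bar>snd z\<bar> - wmap \<epsilon> (wf \<psi>) (max (fst z) 0) \<bar>snd z\<bar>\<bar> \<le> dist \<phi> \<psi> / 2"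
        unfolding pos_le_divide_eq[OF W] by (subst mult.commute)
      then have "\<bar>\<Phi> \<phi> z - \<Phi> \<psi> z\<bar> \<le> dist \<phi> \<psi> / 2"
        unfolding \<Phi>_def right_diff_distrib[symmetric] abs_mult abs_of_pos[OF W] .
      then show "dist (apply_bcontfun (Bcontfun (\<Phi> \<phi>)) z) (apply_bcontfun (Bcontfun (\<Phi> \<psi>)) z) \<le> 1 / 2 * dist \<phi> \<psi>"
        unfolding app[OF \<phi>] app[OF \<psi>] by (simp add: dist_real_def)
    qed
  qed auto
  then obtain \<phi> where \<phi>: "\<phi> \<in> cball 0 a" "Bcontfun (\<Phi> \<phi>) = \<phi>" by blast
  have fp: "\<Phi> \<phi> z = apply_bcontfun \<phi> z" for z using app[OF \<phi>(1)] \<phi>(2) by simp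
  have "wmap \<epsilon> (wf \<phi>) t r = wf \<phi> t r" if t: "0 \<le> t" for t r
  proof -
    \<comment> \<open>The equation is read off at \<open>\<bar>r\<bar>\<close>, where no extension
      is involved, and evenness of both sides transfers it to \<open>r\<close>.\<close>
    have "wmap \<epsilon> (wf \<phi>) t \<bar>r\<bar> = wf \<phi> t \<bar>r\<bar>"
      using fp[of "(t, \<bar>r\<bar>)"] t W[of "(t, \<bar>r\<bar>)"] by (simp add: \<Phi>_def wf_def field_simps)
    moreover have "wmap \<epsilon> (wf \<phi>) t \<bar>r\<bar> = wmap \<epsilon> (wf \<phi>) t r" "wf \<phi> t \<bar>r\<bar> = wf \<phi> t r"
      using wmap_regular(2)[OF adm[OF \<phi>(1)], of \<epsilon> t r] by (auto simp: wf_def W_def abs_if)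
    ultimately show ?thesis by simp
  qed
  then show ?thesis using adm[OF \<phi>(1)] by blast
qed

text \<open>Two elements of the ball are at distance at most \<open>2 * a\<close>; applying
  \<open>wmap\<close> leaves fixed points in place but halves the bound on their distance.\<close>

lemma contraction_fixed_point_unique:
  assumes a: "0 < a" and contr: "contracts a \<epsilon>"
    and w: "adm_w a w" "\<And>t r. 0 \<le> t \<Longrightarrow> wmap \<epsilon> w t r = w t r"
    and w': "adm_w a w'" "\<And>t r. 0 \<le> t \<Longrightarrow> wmap \<epsilon> w' t r = w' t r"
    and t: "0 \<le> t"
  shows "w' t r = w t r"
proof -
  have n: "near_w (2 * a * (1 / 2) ^ n) w w'" for n
  proof (induction n)
    case 0
    show ?case
      unfolding near_w_def
    proof (intro allI impI)
      fix s \<rho> :: real assume "0 \<le> s" "0 \<le> \<rho>"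
      then have "\<bar>w s \<rho>\<bar> \<le> a / W1 s \<rho>" "\<bar>w' s \<rho>\<bar> \<le> a / W1 s \<rho>" using w w' by (auto simp: adm_w_def)
      then have "\<bar>w s \<rho> - w' s \<rho>\<bar> \<le> a / W1 s \<rho> + a / W1 s \<rho>" by linarith
      then show "\<bar>w s \<rho> - w' s \<rho>\<bar> \<le> (2 * a * (1 / 2) ^ 0) / W1 s \<rho>" by simp
    qed
  next
    case (Suc n)
    have "0 \<le> 2 * a * (1 / 2) ^ n" using a by simp
    then have "near_w (2 * a * (1 / 2) ^ n / 2) (wmap \<epsilon> w) (wmap \<epsilon> w')"
      using contr w(1) w'(1) Suc unfolding contracts_def by blast
    then show ?case using w(2) w'(2) by (simp add: near_w_def)
  qed
  have pos: "w' t r = w t r" if r: "0 \<le> r" for r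
  proof -
    have "\<bar>w t r - w' t r\<bar> \<le> 0"
    proof (rule LIMSEQ_le_const)
      have "(\<lambda>n. (2 * a * (1 / 2) ^ n) / W1 t r) \<longlonglongrightarrow> (2 * a * 0) / W1 t r"
        by (intro tendsto_intros LIMSEQ_realpow_zero) (use w1_pos[of t r] in auto)
      then show "(\<lambda>n. (2 * a * (1 / 2) ^ n) / W1 t r) \<longlonglongrightarrow> 0" by simp
    qed (use n t r in \<open>auto simp: near_w_def\<close>)
    then show ?thesis by simp
  qed
  have e: "w t \<bar>r\<bar> = w t r" "w' t \<bar>r\<bar> = w' t r"
    using w(1) w'(1) t by (auto simp: adm_w_def abs_if)
  show ?thesis using pos[of "\<bar>r\<bar>"] e by simp
qed

end

section \<open>Correspondence between fixed points and global solutions\<close>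

lemma SUP_weighted_le:
  fixes h W :: field2 and k :: real
  assumes "\<And>t r. 0 \<le> t \<Longrightarrow> 0 \<le> r \<Longrightarrow> \<bar>h t r\<bar> \<le> k / W t r" "\<And>t r. 0 < W t r"
  shows "(SUP z\<in>{0..}\<times>{0..}. ereal \<bar>W (fst z) (snd z) * h (fst z) (snd z)\<bar>) \<le> ereal k"
proof (rule SUP_least)
  fix z :: "real \<times> real" assume "z \<in> {0..} \<times> {0..}"
  then have "\<bar>h (fst z) (snd z)\<bar> \<le> k / W (fst z) (snd z)" using assms(1) by auto
  then have "W (fst z) (snd z) * \<bar>h (fst z) (snd z)\<bar> \<le> k"
    unfolding pos_le_divide_eq[OF assms(2)] by (subst mult.commute)
  then show "ereal \<bar>W (fst z) (snd z) * h (fst z) (snd z)\<bar> \<le> ereal k"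
    unfolding abs_mult abs_of_pos[OF assms(2)] by simp
qed

text \<open>Each of the other two suprema is nonnegative, so the first is at most the whole norm.
  This bound on \<open>w\<close> is what places an arbitrary solution in the ball.\<close>

lemma (in exponents) abs_le_of_wnorm:
  assumes "wnorm p \<mu> w v \<le> ereal k" "0 \<le> t" "0 \<le> r"
  shows "\<bar>w t r\<bar> \<le> k / W1 t r"
proof -
  let ?S1 = "SUP z\<in>{0..}\<times>{0..}. ereal \<bar>W1 (fst z) (snd z) * w (fst z) (snd z)\<bar>"
  have nn: "0 \<le> (SUP z\<in>{0..}\<times>{0..}. ereal \<bar>h z\<bar>)" for h :: "real \<times> real \<Rightarrow> real"
    by (rule SUP_upper2[of "(0, 0)"]) auto
  have "ereal \<bar>W1 t r * w t r\<bar> \<le> ?S1"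
    by (rule SUP_upper2[of "(t, r)"]) (use assms in auto)
  also have "\<dots> \<le> wnorm p \<mu> w v"
    unfolding wnorm_def by (intro add_increasing2 nn order_refl)
  also note assms(1)
  finally have "W1 t r * \<bar>w t r\<bar> \<le> k" using w1_pos[of t r] by (simp add: abs_mult)
  then show ?thesis using w1_pos[of t r] by (simp add: pos_le_divide_eq mult.commute)
qed

context wave_system
begin

text \<open>The regularity bootstrap: the fixed point equation presents \<open>w\<close> as a value
  of \<open>sol_t\<close>, so the source of \<open>v\<close> has a continuous radial derivative and
  \<open>v\<close> rises to the level of \<open>wave_source_C1\<close>.\<close>

lemma fixed_point_global_solution:
  assumes w: "adm_w a w" and fp: "\<And>t r. 0 \<le> t \<Longrightarrow> wmap \<epsilon> w t r = w t r"
    and v3: "adm_v (a / 3) (vmap \<epsilon> w) (zmap \<epsilon> w)" and w3: "adm_w (a / 3) (wmap \<epsilon> w)" and a: "a = M * \<epsilon>"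
    and f: "\<forall>t\<ge>0. \<forall>r. r \<noteq> 0 \<longrightarrow> U0 f g t r = free_minus A t r / r"
    and ft: "\<forall>t\<ge>0. \<forall>r. r \<noteq> 0 \<longrightarrow> U0 ft gt t r = free_minus B t r / r"
  shows "global_solution p q \<mu> M \<epsilon> f g ft gt (sol A A1 \<epsilon> (src q (vmap \<epsilon> w))) (vmap \<epsilon> w)"
proof -
  define v z u where "v = vmap \<epsilon> w" and "z = zmap \<epsilon> w" and "u = sol A A1 \<epsilon> (src q v)"
  interpret U: wave_source_C1 A A1 A2 R \<epsilon> "src q v" "src_r q v z"
    unfolding v_def z_def by (rule wave_source_u[OF w])
  have dtu: "dt u t r = w t r" if "0 \<le> t" for t r
    using U.dt_sol[OF that, of r] fp[OF that, of r] by (simp add: u_def wmap_def v_def z_def)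
  have cw: "cont2 w" using w by (simp add: adm_w_def)
  \<comment> \<open>\<open>x\<close> is \<open>r\<close> times the radial derivative of
    \<open>w\<close>, read off from the mixed derivative of the numerator of
    \<open>u\<close>.\<close>
  define x where "x = (\<lambda>s y. num_tr A2 \<epsilon> (src_r q v z) s y - w s y)"
  have dw: "((\<lambda>y. y * w s y) has_real_derivative w s y + x s y) (at y)" if "0 \<le> s" for s y
  proof -
    have "(\<lambda>y. y * w s y) = (\<lambda>y. y * sol_t A1 A2 \<epsilon> (src q v) (src_r q v z) s y)"
      using fp[OF that] by (simp add: wmap_def v_def z_def)
    then show ?thesis using U.mult_sol_t_deriv[OF that, of y] by (simp add: x_def)
  qed
  have cx: "cont2 x" unfolding x_def by (intro cont2_diff U.cont2_num_tr cw)
  interpret V: wave_source_C1 B B1 B2 R' \<epsilon> "src p w" "src_r p w x"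
  proof (intro wave_source_C1.intro wave_source_v[OF w] wave_source_C1_axioms.intro)
    show "cont2 (src_r p w x)" using p2 by (intro cont2_src_r cw cx)
    show "(src p w s has_real_derivative src_r p w x s y) (at y)" if "0 \<le> s" for s y
      by (rule src_deriv) (use p2 cw dw that in auto)
  qed
  have vV: "v = sol B B1 \<epsilon> (src p w)" by (simp add: v_def vmap_def)
  have eqs: "u t r = \<epsilon> * U0 f g t r + Lop (\<lambda>s \<rho>. \<bar>v s \<rho>\<bar> powr q) t r"
      "v t r = \<epsilon> * U0 ft gt t r + Lop (\<lambda>s \<rho>. \<bar>dt u s \<rho>\<bar> powr p) t r" if "0 \<le> t" "r \<noteq> 0" for t r
    unfolding u_def vV[unfolded v_def[symmetric]]
    by (rule sol_eq_free_plus_Lop[symmetric]; use that f ft dtu in \<open>simp add: src_def u_def vV\<close>)+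
  have wn: "wnorm p \<mu> (dt u) v \<le> ereal (M * \<epsilon>)"
  proof -
    have 1: "(SUP z\<in>{0..}\<times>{0..}. ereal \<bar>W1 (fst z) (snd z) * dt u (fst z) (snd z)\<bar>) \<le> ereal (a / 3)"
      by (rule SUP_weighted_le) (use w3 dtu fp w1_pos in \<open>auto simp: adm_w_def\<close>)
    have 2: "(SUP z\<in>{0..}\<times>{0..}. ereal \<bar>W2 (fst z) (snd z) * v (fst z) (snd z)\<bar>) \<le> ereal (a / 3)"
      by (rule SUP_weighted_le) (use v3 w2_pos in \<open>auto simp: adm_v_def v_def\<close>)
    have d: "\<bar>r * deriv (\<lambda>\<rho>. v t \<rho>) r\<bar> \<le> (a / 3) / W3 t r" if "0 \<le> t" "0 \<le> r" for t r
    proof (cases "r = 0")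
      case True
      \<comment> \<open>On the axis the factor \<open>r\<close> makes the left-hand side 0; the
        bound on \<open>z\<close> supplies nonnegativity of the right-hand side.\<close>
      have "\<bar>zmap \<epsilon> w t r\<bar> \<le> (a / 3) / W3 t r" using v3 that by (auto simp: adm_v_def)
      then show ?thesis using True by simp
    next
      case False
      have "deriv (v t) r = (num_r B1 \<epsilon> (src p w) t r - v t r) / r"
        unfolding vV by (rule DERIV_imp_deriv[OF V.sol_deriv_r[OF that(1) False]])
      then have "r * deriv (\<lambda>\<rho>. v t \<rho>) r = zmap \<epsilon> w t r" using False by (simp add: zmap_def v_def)
      then show ?thesis using v3 that by (simp add: adm_v_def)
    qed
    have 3: "(SUP z\<in>{0..}\<times>{0..}. ereal \<bar>W3 (fst z) (snd z) * (snd z * deriv (\<lambda>\<rho>. v (fst z) \<rho>) (snd z))\<bar>) \<le> ereal (a / 3)"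
      by (rule SUP_weighted_le[where h="\<lambda>t r. r * deriv (\<lambda>\<rho>. v t \<rho>) r"]) (use d w3_pos in auto)
    have "wnorm p \<mu> (dt u) v \<le> ereal (a / 3) + ereal (a / 3) + ereal (a / 3)"
      unfolding wnorm_def by (intro add_mono 1 2 3)
    then show ?thesis by (simp add: a)
  qed
  have "global_solution p q \<mu> M \<epsilon> f g ft gt u v"
    unfolding global_solution_def
  proof (intro conjI allI impI)
    show "(\<lambda>s. u s r) differentiable (at t within {0..})" if "0 \<le> t" for t r
      using U.sol_deriv_t[OF that, of r] unfolding u_def
      by (auto simp: real_differentiable_def)
    show "u t (- r) = u t r" for t r unfolding u_def by (rule U.sol_minus)
    show "v t (- r) = v t r" for t r unfolding vV by (rule V.sol_minus)
    show "continuous_on ({0..} \<times> UNIV) (\<lambda>z. u (fst z) (snd z))"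
      using U.cont2_sol by (simp add: cont2_def u_def)
    show "continuous_on ({0..} \<times> UNIV) (\<lambda>z. v (fst z) (snd z))"
      using V.cont2_sol by (simp add: cont2_def vV)
    show "continuous_on ({0..} \<times> UNIV) (\<lambda>z. dt u (fst z) (snd z))"
      using cont2_cong[OF cw dtu] by (simp add: cont2_def)
    show "C2_on ({0..} \<times> UNIV) (\<lambda>z. snd z * u (fst z) (snd z))" unfolding u_def by (rule U.C2_mult_sol)
    show "C2_on ({0..} \<times> UNIV) (\<lambda>z. snd z * v (fst z) (snd z))" unfolding vV by (rule V.C2_mult_sol)
  qed (use eqs wn in auto)
  then show ?thesis by (simp add: u_def v_def)
qed

text \<open>The norm bound puts \<open>dt u\<close> into the ball. The second equation identifies
  \<open>v\<close> off the axis, continuity on it; then the first identifies \<open>u\<close>, and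
  differentiating this representation in \<open>t\<close> is the fixed point equation.\<close>

lemma global_solution_fixed_point:
  assumes sol: "global_solution p q \<mu> M \<epsilon> f g ft gt u v" and a: "a = M * \<epsilon>"
    and f: "\<forall>t\<ge>0. \<forall>r. r \<noteq> 0 \<longrightarrow> U0 f g t r = free_minus A t r / r"
    and ft: "\<forall>t\<ge>0. \<forall>r. r \<noteq> 0 \<longrightarrow> U0 ft gt t r = free_minus B t r / r"
  shows "adm_w a (dt u)" "\<And>t r. 0 \<le> t \<Longrightarrow> wmap \<epsilon> (dt u) t r = dt u t r"
    "\<And>t r. 0 \<le> t \<Longrightarrow> v t r = vmap \<epsilon> (dt u) t r"
    "\<And>t r. 0 \<le> t \<Longrightarrow> u t r = sol A A1 \<epsilon> (src q (vmap \<epsilon> (dt u))) t r"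
proof -
  have eqs: "\<And>t r. 0 \<le> t \<Longrightarrow> r \<noteq> 0 \<Longrightarrow> u t r = \<epsilon> * U0 f g t r + Lop (\<lambda>s \<rho>. \<bar>v s \<rho>\<bar> powr q) t r"
    "\<And>t r. 0 \<le> t \<Longrightarrow> r \<noteq> 0 \<Longrightarrow> v t r = \<epsilon> * U0 ft gt t r + Lop (\<lambda>s \<rho>. \<bar>dt u s \<rho>\<bar> powr p) t r"
    and diff: "\<And>t r. 0 \<le> t \<Longrightarrow> (\<lambda>s. u s r) differentiable (at t within {0..})"
    and wn: "wnorm p \<mu> (dt u) v \<le> ereal (M * \<epsilon>)"
    and even: "\<And>t r. 0 \<le> t \<Longrightarrow> u t (- r) = u t r"
    and cont: "cont2 u" "cont2 v" "cont2 (dt u)"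
    using sol by (auto simp: global_solution_def cont2_def)
  have even_dt: "dt u t (- r) = dt u t r" if t: "0 \<le> t" for t r
  proof -
    obtain D where D: "((\<lambda>s. u s r) has_real_derivative D) (at t within {0..})"
      using diff[OF t, of r] by (auto simp: real_differentiable_def)
    have "((\<lambda>s. u s (- r)) has_real_derivative D) (at t within {0..})"
      unfolding has_field_derivative_def
      by (rule has_derivative_transform[OF _ _ D[unfolded has_field_derivative_def]]) (use t even in auto)
    then show ?thesis using dt_eqI[where u=u and r=r, OF t D] dt_eqI[where u=u and r="- r", OF t] by simp
  qed
  show adm: "adm_w a (dt u)"
    unfolding adm_w_def a using cont(3) even_dt abs_le_of_wnorm[OF wn] by blast
  note V = vmap_regular[OF adm, where \<epsilon>=\<epsilon>]
  interpret U: wave_source_C1 A A1 A2 R \<epsilon> "src q (vmap \<epsilon> (dt u))" "src_r q (vmap \<epsilon> (dt u)) (zmap \<epsilon> (dt u))"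
    by (rule wave_source_u[OF adm])
  have "v t r = vmap \<epsilon> (dt u) t r" if "0 \<le> t" "r \<noteq> 0" for t r
    unfolding vmap_def eqs(2)[OF that] by (rule sol_eq_free_plus_Lop) (use that ft in \<open>auto simp: src_def\<close>)
  then show v: "v t r = vmap \<epsilon> (dt u) t r" if "0 \<le> t" for t r
    using cont2_eq_everywhere[OF cont(2) V(1)] that by blast
  have "u t r = sol A A1 \<epsilon> (src q (vmap \<epsilon> (dt u))) t r" if "0 \<le> t" "r \<noteq> 0" for t r
    unfolding eqs(1)[OF that] by (rule sol_eq_free_plus_Lop) (use that f v in \<open>auto simp: src_def\<close>)
  then show u: "u t r = sol A A1 \<epsilon> (src q (vmap \<epsilon> (dt u))) t r" if "0 \<le> t" for t r
    using cont2_eq_everywhere[OF cont(1) U.cont2_sol] that by blast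
  show "wmap \<epsilon> (dt u) t r = dt u t r" if t: "0 \<le> t" for t r
  proof -
    have "((\<lambda>s. u s r) has_real_derivative wmap \<epsilon> (dt u) t r) (at t within {0..})"
      unfolding has_field_derivative_def
      by (rule has_derivative_transform[OF _ _ U.sol_deriv_t[OF t, of r, unfolded has_field_derivative_def, folded wmap_def]])
         (use t u in auto)
    then show ?thesis using dt_eqI[where u=u and r=r, OF t] by simp
  qed
qed

end

theorem theorem1p2:
  fixes p q \<mu> :: real and f g ft gt :: "real \<Rightarrow> real"
  assumes "q > 2" and "2 < p" and "p < 3"
    and "(p - 1) * (p * q - 1) > p + 2"
    and "3 - p < \<mu>" and "\<mu> < 1"
    and "p * (2 - (p - 2) * q) < (p * q - 1) * \<mu>"
    and "C02 f" and "C02 ft" and "C01 g" and "C01 gt"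
    and "even_fun f" and "even_fun ft" and "even_fun g" and "even_fun gt"
  shows "\<exists>\<epsilon>2 > 0. \<exists>C2 > 0. \<forall>\<epsilon>. 0 < \<epsilon> \<and> \<epsilon> < \<epsilon>2 \<longrightarrow>
           (\<exists>u v. global_solution p q \<mu> C2 \<epsilon> f g ft gt u v \<and>
              (\<forall>u' v'. global_solution p q \<mu> C2 \<epsilon> f g ft gt u' v' \<longrightarrow>
                 (\<forall>t\<ge>0. \<forall>r. u' t r = u t r \<and> v' t r = v t r)))"
proof -
  obtain A A1 A2 R where A: "free_profile A A1 A2 R" and f: "\<forall>t\<ge>0. \<forall>r. r \<noteq> 0 \<longrightarrow> U0 f g t r = free_minus A t r / r"
    using U0_free_profile[of f g] assms by blast
  obtain B B1 B2 R' where B: "free_profile B B1 B2 R'" and ft: "\<forall>t\<ge>0. \<forall>r. r \<noteq> 0 \<longrightarrow> U0 ft gt t r = free_minus B t r / r"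
    using U0_free_profile[of ft gt] assms by blast
  interpret wave_system p q \<mu> A A1 A2 B B1 B2 R R'
    using assms A B by unfold_locales auto
  obtain M e0 where M: "M > 0" and e0: "e0 > 0" and contr: "\<And>\<epsilon>. 0 < \<epsilon> \<and> \<epsilon> < e0 \<Longrightarrow> contracts (M * \<epsilon>) \<epsilon>"
    using small_data_contraction by blast
  show ?thesis
  proof (rule exI[of _ e0], intro conjI[OF e0], rule exI[of _ M], intro conjI[OF M] allI impI)
    fix \<epsilon> :: real assume \<epsilon>: "0 < \<epsilon> \<and> \<epsilon> < e0"
    \<comment> \<open>The constant \<open>C2\<close> is \<open>M\<close> itself, so the bound
      \<open>C2 * \<epsilon>\<close> on solutions is exactly the radius of the ball of the
      contraction.\<close>
    define a where "a = M * \<epsilon>"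
    have a: "0 < a" using M \<epsilon> by (simp add: a_def)
    have contr': "contracts a \<epsilon>" using contr[OF \<epsilon>] by (simp add: a_def)
    then have inv: "adm_v (a / 3) (vmap \<epsilon> w) (zmap \<epsilon> w)" "adm_w (a / 3) (wmap \<epsilon> w)" if "adm_w a w" for w
      using that unfolding contracts_def by blast+
    obtain w where w: "adm_w a w" and fp: "\<And>t r. 0 \<le> t \<Longrightarrow> wmap \<epsilon> w t r = w t r"
      using contraction_fixed_point[OF a contr'] by blast
    show "\<exists>u v. global_solution p q \<mu> M \<epsilon> f g ft gt u v \<and>
              (\<forall>u' v'. global_solution p q \<mu> M \<epsilon> f g ft gt u' v' \<longrightarrow>
                 (\<forall>t\<ge>0. \<forall>r. u' t r = u t r \<and> v' t r = v t r))"
    proof (intro exI conjI)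
      show "global_solution p q \<mu> M \<epsilon> f g ft gt (sol A A1 \<epsilon> (src q (vmap \<epsilon> w))) (vmap \<epsilon> w)"
        by (rule fixed_point_global_solution[OF w fp inv[OF w] a_def f ft])
      show "\<forall>u' v'. global_solution p q \<mu> M \<epsilon> f g ft gt u' v' \<longrightarrow>
          (\<forall>t\<ge>0. \<forall>r. u' t r = sol A A1 \<epsilon> (src q (vmap \<epsilon> w)) t r \<and> v' t r = vmap \<epsilon> w t r)"
      proof (intro allI impI)
        fix u' v' and t r :: real
        assume s: "global_solution p q \<mu> M \<epsilon> f g ft gt u' v'" and t: "0 \<le> t"
        note S = global_solution_fixed_point[OF s a_def f ft]
        have eq: "dt u' s x = w s x" if "0 \<le> s" for s x
          by (rule contraction_fixed_point_unique[OF a contr' w fp S(1) S(2) that])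
        \<comment> \<open>\<open>v\<close> and then \<open>u\<close> depend on \<open>w\<close> only
          through its values for times \<open>\<ge> 0\<close>, where the two fixed points
          agree.\<close>
        have v: "vmap \<epsilon> (dt u') s x = vmap \<epsilon> w s x" for s x
          unfolding vmap_def by (rule sol_cong) (simp add: src_def eq)
        have "sol A A1 \<epsilon> (src q (vmap \<epsilon> (dt u'))) t r = sol A A1 \<epsilon> (src q (vmap \<epsilon> w)) t r"
          by (rule sol_cong) (simp add: src_def v)
        then show "u' t r = sol A A1 \<epsilon> (src q (vmap \<epsilon> w)) t r \<and> v' t r = vmap \<epsilon> w t r"
          using S(3,4)[OF t, of r] v by simp
      qed
    qed
  qed
qed

end
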